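(* Fix $C>0$ and $0\le\rho<1$. There are $\alpha,\beta,\gamma,h>0$ and $n_1\in\mathbb N$ such that, for each fixed $x\in[-1,1]^n$ with $n\ge n_1$, the following holds with probability at least $1-e^{-\gamma n}$ over independent uniform random signs $Y\in\{-1,1\}^n$: $$E_\rho(P;z,Y)>\beta n$$ simultaneously for all $P\in\mathbb C[X]$ and $z\in[-1,1]^n$ satisfying $$\deg P\le(1+\alpha)n,\qquad\|P\|_{[-1,1]}\le C,\qquad\max_i d_{\mathrm{ang}}(x_i,z_i)\le h/n.$$ One may take, with $\rho'=(1+\rho)/2$ and with $k$ any even integer $k\ge2$ supplied by the finite obstruction (see context) for the parameter $C/(1-\rho')$, $$\alpha=\frac1{k-1},\quad\beta=\frac{2^{1-k}}{8k(k+1)},\quad\gamma=\frac{2^{1-k}}{16k(k+1)},\quad n_1=2(k^2-1),\quad h=\frac{1-\rho}{2eC(1+\alpha)}.$$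
   Context: $\|P\|_{[-1,1]}=\max_{-1\le t\le1}|P(t)|$; $\deg 0=-\infty$. Node vectors may have repeated entries; counts refer to indices. For $x,y\in[-1,1]^n$ and $\rho\ge0$, $E_\rho(P;x,y):=\#\{i\in\{1,\dots,n\}:|P(x_i)-y_i|>\rho\}$. The angular distance is $d_{\mathrm{ang}}(x,z)=|\arccos x-\arccos z|$ for $x,z\in[-1,1]$. Bernstein space: for $\sigma>0$, $\mathcal B_\sigma$ is the space of entire functions $f$ that are bounded on $\mathbb R$ and of exponential type at most $\sigma$ (for every $\delta>0$ there is $M_\delta<\infty$ with $|f(z)|\le M_\delta e^{(\sigma+\delta)|z|}$ for all $z\in\mathbb C$), with norm $\|f\|_\infty=\sup_{t\in\mathbb R}|f(t)|$. Finite obstruction: for $H>0$, an even integer $k\ge2$ is supplied by the finite obstruction for $H$ if $k\le e^{A_0(1+H)}$ and for every indexed $k$-tuple $(t_1,\dots,t_k)$ of real numbers (repetitions allowed) in an interval of length $k+1$ there are real data $v_1,\dots,v_k$ with $|v_i|\le1$ such that no $f\in\mathcal B_\pi$ with $\|f\|_\infty\le H$ satisfies $f(t_i)=v_i$ for all $i$. Here $A_0>0$ is an absolute constant for which such a $k$ exists for every $H>0$. *)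

theory Defs
  imports
    "HOL-Complex_Analysis.Complex_Analysis"
    "HOL-Probability.Probability"
    "HOL-Computational_Algebra.Polynomial"
begin

text \<open>Vectors with \<open>n\<close> entries are functions on \<open>nat\<close>, of which only the values at the
  indices \<open>1, \<dots>, n\<close> are used.\<close>

definition unit_norm :: "complex poly \<Rightarrow> real" where
  "unit_norm P = (SUP t\<in>{-1..1::real}. cmod (poly P (of_real t)))"

definition error_count :: "nat \<Rightarrow> real \<Rightarrow> complex poly \<Rightarrow> (nat \<Rightarrow> real) \<Rightarrow> (nat \<Rightarrow> real) \<Rightarrow> nat" where
  "error_count n \<rho> P x y =
     card {i\<in>{1..n}. cmod (poly P (of_real (x i)) - of_real (y i)) > \<rho>}"

definition dang :: "real \<Rightarrow> real \<Rightarrow> real" where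
  "dang x z = \<bar>arccos x - arccos z\<bar>"

definition bernstein_space :: "real \<Rightarrow> (complex \<Rightarrow> complex) set" where
  "bernstein_space \<sigma> = {f. f holomorphic_on UNIV \<and> bounded (f ` \<real>) \<and>
     (\<forall>\<delta>>0. \<exists>M. \<forall>z. cmod (f z) \<le> M * exp ((\<sigma> + \<delta>) * cmod z))}"

definition real_sup_norm :: "(complex \<Rightarrow> complex) \<Rightarrow> real" where
  "real_sup_norm f = (SUP t::real. cmod (f (of_real t)))"

text \<open>The integer \<open>k\<close> is supplied by the finite obstruction for \<open>H\<close>, with \<open>A\<^sub>0\<close> as the constant
  in the bound on \<open>k\<close>. It suffices to consider closed intervals, since every interval of
  length \<open>k + 1\<close> is contained in a closed one of the same length.\<close>

definition obstruction_supplies :: "real \<Rightarrow> real \<Rightarrow> nat \<Rightarrow> bool" where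
  "obstruction_supplies A\<^sub>0 H k \<longleftrightarrow>
     even k \<and> k \<ge> 2 \<and> real k \<le> exp (A\<^sub>0 * (1 + H)) \<and>
     (\<forall>t :: nat \<Rightarrow> real. \<forall>a. (\<forall>i\<in>{1..k}. t i \<in> {a..a + real k + 1}) \<longrightarrow>
        (\<exists>v :: nat \<Rightarrow> real. (\<forall>i\<in>{1..k}. \<bar>v i\<bar> \<le> 1) \<and>
           \<not> (\<exists>f\<in>bernstein_space pi. real_sup_norm f \<le> H \<and>
                 (\<forall>i\<in>{1..k}. f (of_real (t i)) = of_real (v i)))))"

definition random_signs :: "nat \<Rightarrow> (nat \<Rightarrow> real) pmf" where
  "random_signs n = Pi_pmf {1..n} 0 (\<lambda>_. pmf_of_set {-1, 1})"

text \<open>Here \<open>degree 0 = 0\<close> instead of \<open>-\<infinity>\<close>; this makes no difference, because the bound on the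
  degree is nonnegative.\<close>

definition robust_failure_event ::
  "real \<Rightarrow> real \<Rightarrow> real \<Rightarrow> real \<Rightarrow> real \<Rightarrow> nat \<Rightarrow> (nat \<Rightarrow> real) \<Rightarrow> (nat \<Rightarrow> real) set" where
  "robust_failure_event C \<rho> \<alpha> \<beta> h n x =
     {Y. \<forall>(P :: complex poly) (z :: nat \<Rightarrow> real).
           (\<forall>i\<in>{1..n}. z i \<in> {-1..1}) \<longrightarrow>
           real (degree P) \<le> (1 + \<alpha>) * real n \<longrightarrow>
           unit_norm P \<le> C \<longrightarrow>
           (\<forall>i\<in>{1..n}. dang (x i) (z i) \<le> h / real n) \<longrightarrow>
           real (error_count n \<rho> P z Y) > \<beta> * real n}"

definition admissible_constants ::
  "real \<Rightarrow> real \<Rightarrow> real \<Rightarrow> real \<Rightarrow> real \<Rightarrow> real \<Rightarrow> nat \<Rightarrow> bool" where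
  "admissible_constants C \<rho> \<alpha> \<beta> \<gamma> h n\<^sub>1 \<longleftrightarrow>
     \<alpha> > 0 \<and> \<beta> > 0 \<and> \<gamma> > 0 \<and> h > 0 \<and>
     (\<forall>n\<ge>n\<^sub>1. \<forall>x :: nat \<Rightarrow> real. (\<forall>i\<in>{1..n}. x i \<in> {-1..1}) \<longrightarrow>
        measure_pmf.prob (random_signs n) (robust_failure_event C \<rho> \<alpha> \<beta> h n x)
          \<ge> 1 - exp (- \<gamma> * real n))"

end

theory Submission
  imports Defs
begin

text \<open>
  If every sign pattern on a set of nodes is approximated up to \<open>\<rho>' < 1\<close> by admissible polynomials,
  then by convexity all data in \<open>[-1,1]\<close> are interpolated with norm \<open>C / (1 - \<rho>')\<close>. Hence a block of
  \<open>k\<close> nodes whose data cannot all be interpolated has a sign pattern, and with it the negated one,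
  that is missed; the perturbation of the nodes is absorbed by the passage from \<open>\<rho>\<close> to \<open>\<rho>'\<close> and
  Cauchy's estimate for \<open>P(cos z)\<close>. Linearly many disjoint such blocks are missed independently, and an
  exponential moment bound gives the probability.

  For explicit constants the blocks are \<open>k\<close> nodes in intervals of length \<open>k + 1\<close> after rescaling
  angles, where \<open>P(cos z)\<close> lies in the Bernstein space.

  For the existence of some constants the blocks are a maximal disjoint family of small sets that
  are not interpolable with constant \<open>H\<close>. It has linear size, because \<open>(1 - \<epsilon>) n\<close> nodes all of whose
  small subsets are interpolable cannot exist, for the following reason. Lift the nodes to the unit
  circle and complete them, nearly maximising a weighted Vandermonde product, to a unisolvent set
  for a slightly larger degree. The Lagrange
  polynomials \<open>l\<^sub>z\<close> of the extra points are then bounded, and few of the nodes are lost. Interpolating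
  suitable phases and multiplying by a localizing kernel centred at a grid point gives an upper bound
  for \<open>\<Sum> |l\<^sub>z(y)|\<close> over the nodes \<open>z\<close> in a cell, by Parseval's identity over the grid. Since
  \<open>|l\<^sub>z(y\<^sub>w) l\<^sub>w(y\<^sub>z)|\<close> is at least about \<open>1 / (1 + M |z - w|)\<^sup>2\<close> for suitable \<open>y\<^sub>z\<close> near \<open>z\<close>, the same sum is
  on average at least logarithmic in the number of nodes of the cell, which is a contradiction.
\<close>

section \<open>Polynomials in the cosine\<close>

text \<open>The finite obstruction is a hypothesis of the second half of the theorem only, so the
  bare existence of constants needs a density argument of its own, which fills most of the proof.
  That argument compares two scales. There are \<open>32 * q\<close> cells on the circle, and
  \<open>n / q\<close> lies between \<open>R\<close> and \<open>2 * R\<close>. The completion to a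
  unisolvent set adds only O(q) points outside the lifted nodes, so a typical cell feels a
  disturbance from them that is bounded independently of \<open>R\<close>. The logarithmic lower
  bound grows with log \<open>R\<close>, so a large \<open>R\<close> wins. All other losses (nodes
  dropped by the completion, nodes outside the window of a cell, cells near the ends of a window)
  are multiplied by the maximal number of nodes per cell, which is of order \<open>R\<close>. They
  are made small afterwards: the weight \<open>A\<close> protects the nodes, and long windows make
  the localizer small beyond them. Hence the parameters are fixed in the order \<open>L\<close>,
  \<open>R\<close>, \<open>A\<close>, \<open>m\<close>, \<open>r\<close>, \<open>k\<close>. The
  localizer enters with its fourth power: two factors give the decay, the other two are left for
  Parseval.\<close>

lemma poly_bound_closed_disc:
  fixes F :: "complex poly"
  assumes "\<And>w. cmod w = 1 \<Longrightarrow> cmod (poly F w) \<le> B" and "cmod y \<le> 1"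
  shows "cmod (poly F y) \<le> B"
proof (rule maximum_modulus_frontier[of "poly F" "cball 0 1"])
  show "poly F holomorphic_on interior (cball 0 1)"
    by (intro holomorphic_intros)
  show "continuous_on (closure (cball 0 1)) (poly F)"
    by (intro continuous_intros)
qed (use assms in \<open>auto simp: frontier_cball\<close>)

text \<open>Bernstein-Walsh for the disc: the reversed polynomial has on the unit circle the same
  modulus as \<open>F\<close> at the inverse point, so the maximum principle applies to it at
  \<open>inverse y\<close>.\<close>

lemma poly_growth_outside_disc:
  fixes F :: "complex poly"
  assumes B: "\<And>w. cmod w = 1 \<Longrightarrow> cmod (poly F w) \<le> B" and deg: "degree F \<le> M" and y: "1 \<le> cmod y"
  shows "cmod (poly F y) \<le> B * cmod y ^ M"
proof -
  have y0: "y \<noteq> 0" using y by auto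
  have refl: "poly (reflect_poly F) (inverse y) = inverse y ^ degree F * poly F y"
    using y0 by (simp add: poly_reflect_poly_nz)
  have "cmod (poly (reflect_poly F) (inverse y)) \<le> B"
  proof (rule poly_bound_closed_disc)
    fix w :: complex assume w: "cmod w = 1"
    then have "w \<noteq> 0" by auto
    then have "cmod (poly (reflect_poly F) w) = cmod (poly F (inverse w))"
      using w by (simp add: poly_reflect_poly_nz norm_mult norm_power)
    also have "\<dots> \<le> B" using w by (intro B) (simp add: norm_inverse)
    finally show "cmod (poly (reflect_poly F) w) \<le> B" .
  qed (use y in \<open>simp add: norm_inverse inverse_le_1_iff\<close>)
  then have "cmod (poly F y) / cmod y ^ degree F \<le> B"
    unfolding refl by (simp add: norm_mult norm_power norm_inverse divide_inverse mult.commute power_inverse)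
  then have *: "cmod (poly F y) \<le> B * cmod y ^ degree F"
    using y0 by (simp add: divide_le_eq)
  have "0 \<le> B" using B[of 1] by (simp add: order_trans[OF norm_ge_zero])
  then have "B * cmod y ^ degree F \<le> B * cmod y ^ M"
    using deg y by (intro mult_left_mono power_increasing) auto
  with * show ?thesis by linarith
qed

text \<open>The factor is (1 + 1/M)^M, at most e. It is needed because the Lagrange polynomials will
  be tested on spheres of radius \<open>1 / M\<close> around the nodes, not on the circle
  itself.\<close>

lemma poly_growth_near_disc:
  fixes F :: "complex poly"
  assumes B: "\<And>w. cmod w = 1 \<Longrightarrow> cmod (poly F w) \<le> B" and deg: "degree F \<le> M"
    and M: "M > 0" and y: "cmod y \<le> 1 + 1 / real M"
  shows "cmod (poly F y) \<le> exp 1 * B"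
proof -
  have B0: "0 \<le> B" using B[of 1] by (simp add: order_trans[OF norm_ge_zero])
  have e1: "(1::real) \<le> exp 1" by simp
  show ?thesis
  proof (cases "cmod y \<le> 1")
    case True
    then have "cmod (poly F y) \<le> 1 * B" using poly_bound_closed_disc[OF B] by simp
    also have "\<dots> \<le> exp 1 * B" using B0 e1 by (intro mult_right_mono)
    finally show ?thesis .
  next
    case False
    then have bound: "cmod (poly F y) \<le> B * cmod y ^ M"
      by (intro poly_growth_outside_disc[OF B deg]) auto
    have "cmod y ^ M \<le> (exp (1 / real M)) ^ M"
      using y exp_ge_add_one_self[of "1 / real M"] by (intro power_mono) (linarith, simp)
    also have "(exp (1 / real M)) ^ M = exp 1"
      using M by (simp flip: exp_of_nat_mult)
    finally have "B * cmod y ^ M \<le> B * exp 1" using B0 by (rule mult_left_mono)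
    with bound show ?thesis by (simp add: mult.commute)
  qed
qed

lemma exists_large_on_sphere:
  fixes F :: "complex poly"
  assumes r: "r > 0"
  obtains y where "cmod (y - z) = r" "cmod (poly F y) \<ge> cmod (poly F z)"
proof -
  have ne: "sphere z r \<noteq> {}" using r by simp
  obtain y where y: "y \<in> sphere z r" "\<forall>x\<in>sphere z r. cmod (poly F x) \<le> cmod (poly F y)"
    using continuous_attains_sup[OF compact_sphere ne, of "\<lambda>x. cmod (poly F x)"]
      continuous_on_norm[OF continuous_on_poly[OF continuous_on_id]] by blast
  have "cmod (poly F z) \<le> cmod (poly F y)"
  proof (rule maximum_modulus_frontier[of "poly F" "cball z r"])
    show "poly F holomorphic_on interior (cball z r)" by (intro holomorphic_intros)
    show "continuous_on (closure (cball z r)) (poly F)" by (intro continuous_intros)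
  qed (use y r in \<open>auto simp: frontier_cball\<close>)
  with y that show ?thesis by (auto simp: dist_norm norm_minus_commute)
qed

lemma unit_norm_bound:
  assumes "t \<in> {-1..1}"
  shows "cmod (poly P (complex_of_real t)) \<le> unit_norm P"
proof -
  have "compact ((\<lambda>t. cmod (poly P (complex_of_real t))) ` {-1..1})"
    by (intro compact_continuous_image continuous_intros) auto
  then have "bdd_above ((\<lambda>t. cmod (poly P (complex_of_real t))) ` {-1..1})"
    by (intro bounded_imp_bdd_above compact_imp_bounded)
  then show ?thesis unfolding unit_norm_def using assms by (intro cSUP_upper)
qed

lemma unit_norm_leI:
  assumes "\<And>t. t \<in> {-1..1} \<Longrightarrow> cmod (poly P (complex_of_real t)) \<le> B"
  shows "unit_norm P \<le> B"
  unfolding unit_norm_def using assms by (intro cSUP_least) auto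

lemma unit_norm_nonneg: "0 \<le> unit_norm P"
  using unit_norm_bound[of 0 P] by (simp add: order_trans[OF norm_ge_zero])

text \<open>This is \<open>w ^ N * P((w + 1/w) / 2)\<close> with the negative powers cleared, the
  usual lift from the interval to the circle. The number \<open>N\<close> only has to bound the
  degree of \<open>P\<close>.\<close>

definition joukowski_poly :: "nat \<Rightarrow> complex poly \<Rightarrow> complex poly" where
  "joukowski_poly N P = (\<Sum>j\<le>N. smult (coeff P j / 2 ^ j) (monom 1 (N - j) * [:1, 0, 1:] ^ j))"

lemma poly_joukowski:
  assumes "degree P \<le> N" and "w \<noteq> 0"
  shows "poly (joukowski_poly N P) w = w ^ N * poly P ((w + inverse w) / 2)"
proof -
  have "poly P ((w + inverse w) / 2) = (\<Sum>j\<le>N. coeff P j * ((w + inverse w) / 2) ^ j)"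
    unfolding poly_altdef using assms(1)
    by (intro sum.mono_neutral_left) (auto simp: coeff_eq_0)
  then have "w ^ N * poly P ((w + inverse w) / 2)
      = (\<Sum>j\<le>N. w ^ N * (coeff P j * ((w + inverse w) / 2) ^ j))"
    by (simp add: sum_distrib_left)
  also have "\<dots> = (\<Sum>j\<le>N. coeff P j / 2 ^ j * (w ^ (N - j) * (1 + w * w) ^ j))"
  proof (intro sum.cong refl)
    fix j assume "j \<in> {..N}"
    then have "w ^ N = w ^ (N - j) * w ^ j" by (simp flip: power_add)
    moreover have "w ^ j * (w + inverse w) ^ j = (1 + w * w) ^ j"
      using assms(2) by (simp add: algebra_simps flip: power_mult_distrib)
    ultimately show "w ^ N * (coeff P j * ((w + inverse w) / 2) ^ j)
        = coeff P j / 2 ^ j * (w ^ (N - j) * (1 + w * w) ^ j)"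
      by (simp add: power_divide mult_ac)
  qed
  also have "\<dots> = poly (joukowski_poly N P) w"
    by (simp add: joukowski_poly_def poly_sum poly_monom algebra_simps)
  finally show ?thesis ..
qed

lemma degree_joukowski: "degree (joukowski_poly N P) \<le> 2 * N"
  unfolding joukowski_poly_def
proof (rule degree_sum_le)
  fix j assume j: "j \<in> {..N}"
  have "degree (monom (1::complex) (N - j) * [:1, 0, 1:] ^ j) \<le> (N - j) + 2 * j"
    using degree_power_le[of "[:1, 0, 1::complex:]" j]
    by (intro order_trans[OF degree_mult_le] add_mono degree_monom_le) auto
  then show "degree (smult (coeff P j / 2 ^ j) (monom 1 (N - j) * [:1, 0, 1:] ^ j)) \<le> 2 * N"
    using j by (intro order_trans[OF degree_smult_le]) auto
qed auto

lemma unit_circle_joukowski: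
  assumes w: "cmod w = 1"
  shows "(w + inverse w) / 2 = of_real (Re w)"
proof -
  have "w * cnj w = 1" using w complex_norm_square[of w] by simp
  then have "inverse w = cnj w" by (simp add: inverse_unique)
  then show ?thesis by (simp add: complex_add_cnj)
qed

lemma norm_poly_joukowski_circle:
  assumes "degree P \<le> N" and w: "cmod w = 1"
  shows "cmod (poly (joukowski_poly N P) w) = cmod (poly P (of_real (Re w)))"
proof -
  have w0: "w \<noteq> 0" using w by auto
  show ?thesis using poly_joukowski[OF assms(1) w0] unit_circle_joukowski[OF w] w by (simp add: norm_mult norm_power)
qed

text \<open>For z in the closed upper half-plane, w = exp(\<i> z) lies in the closed unit disc,
  where the Joukowski lift is bounded by \<open>C\<close> by the maximum principle. The lower
  half-plane follows because cosine is even.\<close>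

lemma poly_cos_growth:
  assumes deg: "degree P \<le> N" and C: "unit_norm P \<le> C"
  shows "cmod (poly P (cos z)) \<le> C * exp (real N * \<bar>Im z\<bar>)"
proof -
  have main: "cmod (poly P (cos z)) \<le> C * exp (real N * \<bar>Im z\<bar>)" if "Im z \<ge> 0" for z
  proof -
    define w where "w = exp (\<i> * z)"
    have w0: "w \<noteq> 0" by (simp add: w_def)
    have nw: "cmod w = exp (- Im z)" by (simp add: w_def)
    have "cmod (poly (joukowski_poly N P) w) \<le> C"
    proof (rule poly_bound_closed_disc)
      fix u :: complex assume u: "cmod u = 1"
      have "\<bar>Re u\<bar> \<le> 1" using u abs_Re_le_cmod[of u] by simp
      then show "cmod (poly (joukowski_poly N P) u) \<le> C"
        unfolding norm_poly_joukowski_circle[OF deg u]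
        by (intro order_trans[OF unit_norm_bound C]) auto
    qed (use that nw in simp)
    moreover have "(w + inverse w) / 2 = cos z"
      by (simp add: w_def cos_exp_eq exp_minus)
    ultimately have "cmod w ^ N * cmod (poly P (cos z)) \<le> C"
      using poly_joukowski[OF deg w0] by (simp add: norm_mult norm_power)
    moreover have "cmod w ^ N = inverse (exp (real N * \<bar>Im z\<bar>))"
      using that by (simp add: nw exp_minus exp_of_nat_mult power_inverse)
    ultimately show ?thesis by (simp add: field_simps)
  qed
  show ?thesis
  proof (cases "Im z \<ge> 0")
    case False
    then have "cmod (poly P (cos (- z))) \<le> C * exp (real N * \<bar>Im (- z)\<bar>)"
      by (intro main) simp
    then show ?thesis by simp
  qed (use main in simp)
qed

section \<open>Stability under angular perturbation of the nodes\<close>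

lemma exp_type_lipschitz:
  fixes f :: "complex \<Rightarrow> complex" and a b \<sigma> C :: real
  assumes hol: "f holomorphic_on UNIV" and \<sigma>: "\<sigma> > 0"
    and bd: "\<And>z. cmod (f z) \<le> C * exp (\<sigma> * \<bar>Im z\<bar>)"
  shows "cmod (f (of_real a) - f (of_real b)) \<le> exp 1 * \<sigma> * C * \<bar>a - b\<bar>"
proof -
  have C0: "0 \<le> C" using bd[of 0] by (simp add: order_trans[OF norm_ge_zero])
  have der: "cmod (deriv f (of_real t)) \<le> exp 1 * \<sigma> * C" for t :: real
  proof -
    \<comment> \<open>On a disc of radius \<open>1 / \<sigma>\<close> the exponential growth costs
      only a factor e. This is the e in the constant \<open>h\<close>.\<close>
    have "cmod ((deriv ^^ 1) f (of_real t)) \<le> fact 1 * (C * exp 1) / (1 / \<sigma>) ^ 1"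
    proof (rule Cauchy_inequality)
      show "f holomorphic_on ball (of_real t) (1 / \<sigma>)" using hol holomorphic_on_subset by blast
      show "continuous_on (cball (of_real t) (1 / \<sigma>)) f"
        using hol holomorphic_on_imp_continuous_on holomorphic_on_subset by blast
      fix x assume x: "cmod (of_real t - x) = 1 / \<sigma>"
      have "\<bar>Im x\<bar> \<le> 1 / \<sigma>" using abs_Im_le_cmod[of "of_real t - x"] x by simp
      then have "\<sigma> * \<bar>Im x\<bar> \<le> 1" using \<sigma> by (simp add: field_simps)
      then have "C * exp (\<sigma> * \<bar>Im x\<bar>) \<le> C * exp 1" using C0 by (intro mult_left_mono) auto
      then show "cmod (f x) \<le> C * exp 1" using bd[of x] by linarith
    qed (use \<sigma> in auto)
    then show ?thesis by (simp add: mult_ac)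
  qed
  have "cmod (f (of_real a) - f (of_real b)) \<le> exp 1 * \<sigma> * C * cmod (of_real a - of_real b :: complex)"
  proof (rule field_differentiable_bound[of "of_real ` UNIV" f "deriv f"])
    show "convex (range complex_of_real)"
      by (intro convex_linear_image bounded_linear.linear[OF bounded_linear_of_real] convex_UNIV)
    show "(f has_field_derivative deriv f z) (at z within range complex_of_real)" for z
      using hol holomorphic_derivI[OF hol open_UNIV, of z] by (auto intro: DERIV_subset)
  qed (use der in auto)
  then show ?thesis by (metis norm_of_real of_real_diff)
qed

lemma poly_cos_lipschitz:
  assumes deg: "real (degree P) \<le> \<sigma>" and \<sigma>: "\<sigma> > 0" and C: "unit_norm P \<le> C"
  shows "cmod (poly P (of_real (cos a)) - poly P (of_real (cos b))) \<le> exp 1 * \<sigma> * C * \<bar>a - b\<bar>"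
proof -
  have "0 \<le> C" using unit_norm_nonneg C order_trans by blast
  have "cmod ((\<lambda>z. poly P (cos z)) (of_real a) - (\<lambda>z. poly P (cos z)) (of_real b))
      \<le> exp 1 * \<sigma> * C * \<bar>a - b\<bar>"
  proof (rule exp_type_lipschitz[OF _ \<sigma>])
    show "(\<lambda>z. poly P (cos z)) holomorphic_on UNIV" by (intro holomorphic_intros)
    fix z
    have "cmod (poly P (cos z)) \<le> C * exp (real (degree P) * \<bar>Im z\<bar>)"
      by (rule poly_cos_growth[OF order_refl C])
    also have "\<dots> \<le> C * exp (\<sigma> * \<bar>Im z\<bar>)"
      using deg \<open>0 \<le> C\<close> by (intro mult_left_mono) (auto intro: mult_right_mono)
    finally show "cmod (poly P (cos z)) \<le> C * exp (\<sigma> * \<bar>Im z\<bar>)" .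
  qed
  then show ?thesis by (simp add: cos_of_real)
qed

lemma poly_arccos_lipschitz:
  assumes deg: "real (degree P) \<le> \<sigma>" and \<sigma>: "\<sigma> > 0" and C: "unit_norm P \<le> C"
    and x: "x \<in> {-1..1}" and z: "z \<in> {-1..1}"
  shows "cmod (poly P (of_real x) - poly P (of_real z)) \<le> exp 1 * \<sigma> * C * dang x z"
  using poly_cos_lipschitz[OF deg \<sigma> C, of "arccos x" "arccos z"] x z
  by (simp add: dang_def cos_arccos)

section \<open>Interpolation, approximation of signs and the Bernstein space\<close>

text \<open>Coordinates are turned one at a time from a sign constraint into an exact value.
  Demanding the sign 1 at \<open>s\<close> gives a value at least \<open>1 - r\<close>, demanding -1
  gives one at most \<open>-(1 - r)\<close>, and a convex combination hits \<open>w s\<close> while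
  keeping all the other constraints. The set \<open>U\<close> of coordinates still under sign
  constraints makes the induction work.\<close>

lemma cube_in_convex_family:
  fixes \<F> :: "('a \<Rightarrow> real) set" and r :: real
  assumes "finite S" and r: "r < 1"
    and convex: "\<And>p q t. p \<in> \<F> \<Longrightarrow> q \<in> \<F> \<Longrightarrow> 0 \<le> t \<Longrightarrow> t \<le> 1 \<Longrightarrow> (\<lambda>i. (1 - t) * p i + t * q i) \<in> \<F>"
    and approx: "\<And>e. (\<And>i. i \<in> S \<union> U \<Longrightarrow> e i \<in> {-1, 1}) \<Longrightarrow> \<exists>p\<in>\<F>. \<forall>i\<in>S \<union> U. \<bar>p i - e i\<bar> \<le> r"
    and "S \<inter> U = {}"
    and w: "\<And>i. i \<in> S \<Longrightarrow> \<bar>w i\<bar> \<le> 1 - r" and e: "\<And>i. i \<in> U \<Longrightarrow> e i \<in> {-1, 1}"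
  shows "\<exists>p\<in>\<F>. (\<forall>i\<in>S. p i = w i) \<and> (\<forall>i\<in>U. \<bar>p i - e i\<bar> \<le> r)"
  using assms(1) approx assms(5) w e
proof (induction S arbitrary: U e)
  case empty
  then show ?case by simp
next
  case (insert s S)
  have corner: "\<exists>p\<in>\<F>. (\<forall>i\<in>S. p i = w i) \<and> (\<forall>i\<in>U. \<bar>p i - e i\<bar> \<le> r) \<and> \<bar>p s - c\<bar> \<le> r"
    if c: "c \<in> {-1, 1}" for c
  proof -
    have s: "s \<notin> U" using insert.prems(2) by auto
    have "\<exists>p\<in>\<F>. (\<forall>i\<in>S. p i = w i) \<and> (\<forall>i\<in>insert s U. \<bar>p i - (e(s := c)) i\<bar> \<le> r)"
    proof (rule insert.IH)
      fix e' assume "\<And>i. i \<in> S \<union> insert s U \<Longrightarrow> e' i \<in> {-1, 1::real}"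
      then show "\<exists>p\<in>\<F>. \<forall>i\<in>S \<union> insert s U. \<bar>p i - e' i\<bar> \<le> r"
        using insert.prems(1)[of e'] by auto
    qed (use insert.hyps insert.prems c in auto)
    then show ?thesis using s by (metis (mono_tags, lifting) fun_upd_apply insertCI)
  qed
  obtain p where p: "p \<in> \<F>" "\<And>i. i \<in> S \<Longrightarrow> p i = w i" "\<And>i. i \<in> U \<Longrightarrow> \<bar>p i - e i\<bar> \<le> r" "\<bar>p s - 1\<bar> \<le> r"
    using corner[of 1] by auto
  obtain q where q: "q \<in> \<F>" "\<And>i. i \<in> S \<Longrightarrow> q i = w i" "\<And>i. i \<in> U \<Longrightarrow> \<bar>q i - e i\<bar> \<le> r" "\<bar>q s - (-1)\<bar> \<le> r"
    using corner[of "-1"] by auto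
  have ws: "\<bar>w s\<bar> \<le> 1 - r" using insert.prems(3)[of s] by simp
  have gap: "p s - q s > 0" "q s \<le> w s" "w s \<le> p s" using p(4) q(4) ws r by auto
  define t where "t = (p s - w s) / (p s - q s)"
  have t: "0 \<le> t" "t \<le> 1" unfolding t_def using gap by auto
  have ts: "(1 - t) * p s + t * q s = w s"
  proof -
    have "t * (p s - q s) = p s - w s" using gap by (simp add: t_def)
    then show ?thesis by (simp add: algebra_simps)
  qed
  show ?case
  proof (intro bexI conjI ballI)
    show "(\<lambda>i. (1 - t) * p i + t * q i) \<in> \<F>" by (rule convex[OF p(1) q(1) t])
    fix i assume "i \<in> insert s S"
    then show "(1 - t) * p i + t * q i = w i"
      using ts p(2) q(2) by (auto simp: algebra_simps)
  next
    fix i assume i: "i \<in> U"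
    have "\<bar>(1 - t) * p i + t * q i - e i\<bar> = \<bar>(1 - t) * (p i - e i) + t * (q i - e i)\<bar>"
      by (simp add: algebra_simps)
    also have "\<dots> \<le> (1 - t) * \<bar>p i - e i\<bar> + t * \<bar>q i - e i\<bar>"
      using t by (intro order_trans[OF abs_triangle_ineq]) (simp add: abs_mult)
    also have "\<dots> \<le> (1 - t) * r + t * r"
      using t p(3)[OF i] q(3)[OF i] by (intro add_mono mult_left_mono) auto
    finally show "\<bar>(1 - t) * p i + t * q i - e i\<bar> \<le> r" by (simp add: algebra_simps)
  qed
qed

definition sign_approximable :: "(nat \<Rightarrow> real) \<Rightarrow> real \<Rightarrow> real \<Rightarrow> real \<Rightarrow> nat set \<Rightarrow> bool" where
  "sign_approximable x \<sigma> C r S \<longleftrightarrow>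
     (\<forall>e. (\<forall>i\<in>S. e i \<in> {-1, 1::real}) \<longrightarrow>
        (\<exists>P. real (degree P) \<le> \<sigma> \<and> unit_norm P \<le> C \<and>
             (\<forall>i\<in>S. cmod (poly P (of_real (x i)) - of_real (e i)) \<le> r)))"

definition interpolable :: "(nat \<Rightarrow> real) \<Rightarrow> real \<Rightarrow> real \<Rightarrow> nat set \<Rightarrow> bool" where
  "interpolable x \<sigma> H S \<longleftrightarrow>
     (\<forall>v. (\<forall>i\<in>S. \<bar>v i\<bar> \<le> (1::real)) \<longrightarrow>
        (\<exists>P. real (degree P) \<le> \<sigma> \<and> unit_norm P \<le> H \<and>
             (\<forall>i\<in>S. poly P (of_real (x i)) = of_real (v i))))"

lemma unit_norm_add: "unit_norm (P + Q) \<le> unit_norm P + unit_norm Q"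
  by (intro unit_norm_leI) (auto intro!: order_trans[OF norm_triangle_ineq] add_mono unit_norm_bound)

lemma unit_norm_smult: "unit_norm (smult c P) \<le> cmod c * unit_norm P"
  by (intro unit_norm_leI) (auto simp: norm_mult intro!: mult_left_mono unit_norm_bound)

text \<open>Taking real parts of the coefficients takes the real part of the values on the real
  line. Convexity only controls these real parts, but interpolation demands exact complex
  values.\<close>

lemma poly_real_part:
  obtains R where "degree R \<le> degree P" "\<And>t::real. poly R (of_real t) = of_real (Re (poly P (of_real t)))"
    "unit_norm R \<le> unit_norm P"
proof -
  define R where "R = map_poly (\<lambda>c. complex_of_real (Re c)) P"
  have ev: "poly R (of_real t) = of_real (Re (poly P (of_real t)))" for t :: real
  proof -
    have d: "degree R \<le> degree P" by (intro degree_le) (auto simp: R_def coeff_map_poly coeff_eq_0)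
    have "poly R (of_real t) = (\<Sum>i\<le>degree P. coeff R i * of_real t ^ i)"
      unfolding poly_altdef using d by (intro sum.mono_neutral_left) (auto simp: coeff_eq_0)
    also have "\<dots> = of_real (Re (poly P (of_real t)))"
      unfolding poly_altdef R_def by (simp add: coeff_map_poly Re_sum flip: of_real_power)
    finally show ?thesis .
  qed
  show thesis
  proof
    show "degree R \<le> degree P" by (intro degree_le) (auto simp: R_def coeff_map_poly coeff_eq_0)
    show "unit_norm R \<le> unit_norm P"
      by (intro unit_norm_leI) (auto simp: ev intro!: order_trans[OF abs_Re_le_cmod] unit_norm_bound)
  qed (rule ev)
qed

text \<open>The cube lemma is applied to the real parts of admissible polynomials with the shrunken
  data \<open>(1 - r) * v\<close>; dividing by \<open>1 - r\<close> afterwards produces the norm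
  \<open>C / (1 - r)\<close>.\<close>

lemma sign_approximable_imp_interpolable:
  assumes fin: "finite S" and r: "r < 1" and approx: "sign_approximable x \<sigma> C r S"
  shows "interpolable x \<sigma> (C / (1 - r)) S"
  unfolding interpolable_def
proof (intro allI impI)
  fix v :: "nat \<Rightarrow> real" assume v: "\<forall>i\<in>S. \<bar>v i\<bar> \<le> 1"
  define \<F> where "\<F> = {\<lambda>i. Re (poly P (of_real (x i))) | P. real (degree P) \<le> \<sigma> \<and> unit_norm P \<le> C}"
  have "\<exists>p\<in>\<F>. (\<forall>i\<in>S. p i = (1 - r) * v i) \<and> (\<forall>i\<in>{}. \<bar>p i - 1\<bar> \<le> r)"
  proof (rule cube_in_convex_family[OF fin r])
    fix p q and t :: real assume p: "p \<in> \<F>" and q: "q \<in> \<F>" and t: "0 \<le> t" "t \<le> 1"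
    obtain P where P: "p = (\<lambda>i. Re (poly P (of_real (x i))))" "real (degree P) \<le> \<sigma>" "unit_norm P \<le> C"
      using p by (auto simp: \<F>_def)
    obtain Q where Q: "q = (\<lambda>i. Re (poly Q (of_real (x i))))" "real (degree Q) \<le> \<sigma>" "unit_norm Q \<le> C"
      using q by (auto simp: \<F>_def)
    let ?R = "smult (of_real (1 - t)) P + smult (of_real t) Q"
    have "unit_norm ?R \<le> (1 - t) * unit_norm P + t * unit_norm Q"
      using unit_norm_add[of "smult (of_real (1 - t)) P" "smult (of_real t) Q"]
        unit_norm_smult[of "of_real (1 - t)" P] unit_norm_smult[of "of_real t" Q] t
      by (simp del: of_real_diff)
    also have "\<dots> \<le> (1 - t) * C + t * C" using t P Q by (intro add_mono mult_left_mono) auto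
    finally have "unit_norm ?R \<le> C" by (simp add: algebra_simps)
    moreover have "degree ?R \<le> max (degree P) (degree Q)"
      by (intro order_trans[OF degree_add_le_max] max.mono degree_smult_le)
    then have "real (degree ?R) \<le> \<sigma>" using P(2) Q(2) by linarith
    ultimately show "(\<lambda>i. (1 - t) * p i + t * q i) \<in> \<F>"
      unfolding \<F>_def P(1) Q(1) by (intro CollectI exI[of _ ?R]) auto
  next
    fix e assume "\<And>i. i \<in> S \<union> {} \<Longrightarrow> e i \<in> {-1, 1::real}"
    then have "\<forall>i\<in>S. e i \<in> {-1, 1}" by blast
    then obtain P where P: "real (degree P) \<le> \<sigma>" "unit_norm P \<le> C"
      "\<And>i. i \<in> S \<Longrightarrow> cmod (poly P (of_real (x i)) - of_real (e i)) \<le> r"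
      using approx unfolding sign_approximable_def by blast
    show "\<exists>p\<in>\<F>. \<forall>i\<in>S \<union> {}. \<bar>p i - e i\<bar> \<le> r"
    proof (intro bexI ballI)
      show "(\<lambda>i. Re (poly P (of_real (x i)))) \<in> \<F>" using P by (auto simp: \<F>_def)
      fix i assume "i \<in> S \<union> {}"
      then show "\<bar>Re (poly P (of_real (x i))) - e i\<bar> \<le> r"
        using abs_Re_le_cmod[of "poly P (of_real (x i)) - of_real (e i)"] P(3)[of i] by auto
    qed
  next
    show "\<bar>(1 - r) * v i\<bar> \<le> 1 - r" if "i \<in> S" for i
      using v that r by (simp add: abs_mult mult_left_le)
  qed auto
  then obtain P where P: "real (degree P) \<le> \<sigma>" "unit_norm P \<le> C"
    "\<And>i. i \<in> S \<Longrightarrow> Re (poly P (of_real (x i))) = (1 - r) * v i"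
    by (auto simp: \<F>_def)
  obtain R where R: "degree R \<le> degree P" "\<And>t::real. poly R (of_real t) = of_real (Re (poly P (of_real t)))"
    "unit_norm R \<le> unit_norm P"
    using poly_real_part by blast
  let ?R = "smult (of_real (1 / (1 - r))) R"
  show "\<exists>P. real (degree P) \<le> \<sigma> \<and> unit_norm P \<le> C / (1 - r) \<and>
             (\<forall>i\<in>S. poly P (of_real (x i)) = of_real (v i))"
  proof (intro exI[of _ ?R] conjI ballI)
    show "real (degree ?R) \<le> \<sigma>" using P(1) R(1) degree_smult_le[of "of_real (1 / (1 - r))" R] by linarith
    have "unit_norm ?R \<le> 1 / (1 - r) * unit_norm R"
      using unit_norm_smult[of "of_real (1 / (1 - r))" R] r by (simp del: of_real_diff of_real_divide)
    also have "\<dots> \<le> 1 / (1 - r) * C" using r R(3) P(2) by (intro mult_left_mono) auto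
    finally show "unit_norm ?R \<le> C / (1 - r)" by simp
    fix i assume "i \<in> S"
    then have "poly ?R (of_real (x i)) = of_real (1 / (1 - r) * ((1 - r) * v i))"
      by (simp only: poly_smult R(2) P(3) of_real_mult)
    then show "poly ?R (of_real (x i)) = of_real (v i)" using r by simp
  qed
qed

lemma poly_cos_bernstein_space:
  assumes deg: "real (degree P) * c \<le> \<sigma>" and c: "c > 0" and H: "unit_norm P \<le> H"
  shows "(\<lambda>z. poly P (cos (of_real c * z))) \<in> bernstein_space \<sigma>"
    and "real_sup_norm (\<lambda>z. poly P (cos (of_real c * z))) \<le> H"
proof -
  have on_real: "cmod (poly P (cos (of_real c * of_real t))) \<le> H" for t :: real
  proof -
    have "cos (of_real c * of_real t) = complex_of_real (cos (c * t))"
      by (simp flip: of_real_mult cos_of_real)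
    then show ?thesis using unit_norm_bound[of "cos (c * t)" P] H by simp
  qed
  then show "real_sup_norm (\<lambda>z. poly P (cos (of_real c * z))) \<le> H"
    unfolding real_sup_norm_def by (intro cSUP_least) auto
  have H0: "0 \<le> H" using unit_norm_nonneg H order_trans by blast
  show "(\<lambda>z. poly P (cos (of_real c * z))) \<in> bernstein_space \<sigma>"
    unfolding bernstein_space_def
  proof (intro CollectI conjI allI impI exI)
    show "(\<lambda>z. poly P (cos (of_real c * z))) holomorphic_on UNIV" by (intro holomorphic_intros)
    show "bounded ((\<lambda>z. poly P (cos (of_real c * z))) ` \<real>)"
      using on_real by (intro boundedI[of _ H]) (auto elim!: Reals_cases)
    fix \<delta> :: real and z :: complex assume \<delta>: "\<delta> > 0"
    have "real (degree P) * \<bar>Im (of_real c * z)\<bar> = (real (degree P) * c) * \<bar>Im z\<bar>"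
      using c by (simp add: abs_mult)
    also have "\<dots> \<le> (\<sigma> + \<delta>) * cmod z"
    proof (rule mult_mono)
      have "0 \<le> real (degree P) * c" using c by simp
      then show "0 \<le> \<sigma> + \<delta>" using deg \<delta> by linarith
    qed (use deg \<delta> abs_Im_le_cmod[of z] in auto)
    finally have "H * exp (real (degree P) * \<bar>Im (of_real c * z)\<bar>) \<le> H * exp ((\<sigma> + \<delta>) * cmod z)"
      using H0 by (intro mult_left_mono) auto
    then show "cmod (poly P (cos (of_real c * z))) \<le> H * exp ((\<sigma> + \<delta>) * cmod z)"
      using poly_cos_growth[OF order_refl H, of "of_real c * z"] by linarith
  qed
qed

text \<open>With \<open>L\<close> bounding the degree, P(cos(pi z / L)) has exponential type at most
  pi. So in angles rescaled by \<open>L / pi\<close> the obstruction applies as it stands.\<close>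

lemma obstruction_not_sign_approximable:
  assumes supplies: "obstruction_supplies A (C / (1 - r)) k" and r: "r < 1"
    and S: "card S = k" and L: "L > 0" and x: "\<And>i. i \<in> S \<Longrightarrow> x i \<in> {-1..1}"
    and t: "\<And>i. i \<in> S \<Longrightarrow> arccos (x i) * L / pi \<in> {a..a + real k + 1}"
  shows "\<not> sign_approximable x L C r S"
proof
  assume approx: "sign_approximable x L C r S"
  have k: "k \<ge> 2" using supplies by (simp add: obstruction_supplies_def)
  then have fin: "finite S" using S by (metis card.infinite not_numeral_le_zero)
  then obtain g where g: "bij_betw g {1..k} S"
    using S ex_bij_betw_nat_finite_1 by metis
  then have gS: "g i \<in> S" if "i \<in> {1..k}" for i using that by (auto simp: bij_betw_def)
  obtain v :: "nat \<Rightarrow> real" where v: "\<forall>i\<in>{1..k}. \<bar>v i\<bar> \<le> 1" and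
    none: "\<not> (\<exists>f\<in>bernstein_space pi. real_sup_norm f \<le> C / (1 - r) \<and>
                 (\<forall>i\<in>{1..k}. f (of_real (arccos (x (g i)) * L / pi)) = of_real (v i)))"
    using supplies unfolding obstruction_supplies_def
    by (elim conjE allE[of _ "\<lambda>i. arccos (x (g i)) * L / pi"] allE[of _ a]) (use t gS in blast)
  \<comment> \<open>The obstruction speaks of an indexed tuple, interpolability of data on the index
    set \<open>S\<close>. The data are carried over by indices, so repeated node values do no
    harm.\<close>
  define v' where "v' = (\<lambda>j. v (the_inv_into {1..k} g j))"
  have v'g: "v' (g i) = v i" if "i \<in> {1..k}" for i
    using that g by (simp add: v'_def bij_betw_def the_inv_into_f_f)
  have "\<forall>j\<in>S. \<bar>v' j\<bar> \<le> 1"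
    using v v'g g by (auto simp: bij_betw_def)
  then obtain P where P: "real (degree P) \<le> L" "unit_norm P \<le> C / (1 - r)"
    "\<forall>j\<in>S. poly P (of_real (x j)) = of_real (v' j)"
    using sign_approximable_imp_interpolable[OF fin r approx] unfolding interpolable_def by blast
  let ?f = "\<lambda>z. poly P (cos (of_real (pi / L) * z))"
  have "real (degree P) * (pi / L) \<le> pi"
    using P(1) L by (simp add: field_simps)
  then have f: "?f \<in> bernstein_space pi" "real_sup_norm ?f \<le> C / (1 - r)"
    using poly_cos_bernstein_space[of P "pi / L" pi] P(2) L by auto
  moreover have "?f (of_real (arccos (x (g i)) * L / pi)) = of_real (v i)" if i: "i \<in> {1..k}" for i
  proof -
    have "pi / L * (arccos (x (g i)) * L / pi) = arccos (x (g i))" using L by simp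
    then have "of_real (pi / L) * complex_of_real (arccos (x (g i)) * L / pi) = of_real (arccos (x (g i)))"
      by (metis of_real_mult)
    then have "?f (of_real (arccos (x (g i)) * L / pi)) = poly P (of_real (x (g i)))"
      using x[OF gS[OF i]] by (simp add: cos_of_real cos_arccos del: of_real_mult of_real_divide)
    then show ?thesis using P(3) gS[OF i] v'g[OF i] by simp
  qed
  ultimately show False using none by blast
qed

section \<open>Maximal disjoint families of blocks\<close>

text \<open>In a family of greatest cardinality no further set can be inserted. Nonemptiness matters
  here: an empty set could be a member already and would still avoid the union.\<close>

lemma maximal_disjoint_family:
  assumes fin: "finite A" and ne: "\<And>S. Q S \<Longrightarrow> S \<noteq> {}"
  obtains \<F> where "finite \<F>" "\<And>S. S \<in> \<F> \<Longrightarrow> S \<subseteq> A \<and> Q S" "disjoint \<F>"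
    "\<And>S. S \<subseteq> A - \<Union>\<F> \<Longrightarrow> \<not> Q S"
proof -
  let ?good = "\<lambda>\<F>. \<F> \<subseteq> {S \<in> Pow A. Q S} \<and> disjoint \<F>"
  have "?good {}" by simp
  moreover have "\<forall>\<G>. ?good \<G> \<longrightarrow> card \<G> < Suc (card (Pow A))"
    using fin by (auto simp: less_Suc_eq_le intro!: card_mono)
  ultimately obtain \<F> where \<F>: "?good \<F>" and max: "\<And>\<G>. ?good \<G> \<Longrightarrow> card \<G> \<le> card \<F>"
    using ex_has_greatest_nat[of ?good "{}" card "Suc (card (Pow A))"] by blast
  have fF: "finite \<F>" using \<F> fin by (auto intro: finite_subset[of _ "Pow A"])
  show thesis
  proof
    fix S assume S: "S \<subseteq> A - \<Union>\<F>"
    show "\<not> Q S"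
    proof
      assume Q: "Q S"
      have "S \<notin> \<F>" using S ne[OF Q] by auto
      moreover have "?good (insert S \<F>)"
        using \<F> S Q by (auto simp: disjoint_def)
      ultimately show False using max[of "insert S \<F>"] fF by simp
    qed
  qed (use \<F> fF in auto)
qed

text \<open>For a maximal disjoint family of \<open>k\<close>-sets, each inside one fibre, every
  fibre keeps at most \<open>k - 1\<close> uncovered elements, since otherwise another block would
  fit.\<close>

lemma disjoint_blocks_in_fibres:
  fixes g :: "'a \<Rightarrow> 'b"
  assumes fin: "finite A" and J: "finite J" "g ` A \<subseteq> J" and k: "k > 0"
  obtains \<F> where "finite \<F>" "disjoint \<F>"
    "\<And>S. S \<in> \<F> \<Longrightarrow> S \<subseteq> A \<and> card S = k \<and> (\<exists>j\<in>J. \<forall>i\<in>S. g i = j)"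
    "card A \<le> k * card \<F> + (k - 1) * card J"
proof -
  let ?Q = "\<lambda>S. card S = k \<and> (\<exists>j\<in>J. \<forall>i\<in>S. g i = j)"
  have ne: "S \<noteq> {}" if "?Q S" for S using that k by auto
  obtain \<F> where \<F>: "finite \<F>" "\<And>S. S \<in> \<F> \<Longrightarrow> S \<subseteq> A \<and> ?Q S" "disjoint \<F>"
    "\<And>S. S \<subseteq> A - \<Union>\<F> \<Longrightarrow> \<not> ?Q S"
    by (rule maximal_disjoint_family[of A ?Q, OF fin]) (rule ne, assumption, rule that, assumption+)
  let ?R = "A - \<Union>\<F>"
  have small: "card {i \<in> ?R. g i = j} \<le> k - 1" if j: "j \<in> J" for j
  proof (rule ccontr)
    assume "\<not> ?thesis"
    then have "k \<le> card {i \<in> ?R. g i = j}" by linarith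
    then obtain S where "S \<subseteq> {i \<in> ?R. g i = j}" "card S = k"
      using obtain_subset_with_card_n by metis
    then have "S \<subseteq> A - \<Union>\<F>" "card S = k \<and> (\<exists>j\<in>J. \<forall>i\<in>S. g i = j)"
      using j by (blast, blast)
    then show False using \<F>(4) by blast
  qed
  have "?R = (\<Union>j\<in>J. {i \<in> ?R. g i = j})" using J(2) by auto
  then have "card ?R = card (\<Union>j\<in>J. {i \<in> ?R. g i = j})" by (rule arg_cong)
  also have "\<dots> \<le> (\<Sum>j\<in>J. card {i \<in> ?R. g i = j})" by (rule card_UN_le[OF J(1)])
  also have "\<dots> \<le> (\<Sum>j\<in>J. k - 1)" using small by (intro sum_mono)
  finally have R: "card ?R \<le> (k - 1) * card J" by (simp add: mult.commute)
  have "card (\<Union>\<F>) \<le> (\<Sum>S\<in>\<F>. card S)" by (rule card_Union_le_sum_card)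
  also have "\<dots> = k * card \<F>" using \<F>(2) by simp
  finally have "card (\<Union>\<F>) \<le> k * card \<F>" .
  moreover have "card A \<le> card ?R + card (\<Union>\<F>)"
  proof -
    have "card A \<le> card (?R \<union> \<Union>\<F>)"
    proof (rule card_mono)
      have "\<Union>\<F> \<subseteq> A" using \<F>(2) by (simp add: Union_least)
      then show "finite (?R \<union> \<Union>\<F>)" using fin by (simp add: finite_subset)
    qed auto
    then show ?thesis using card_Un_le[of ?R "\<Union>\<F>"] by linarith
  qed
  ultimately have bound: "card A \<le> k * card \<F> + (k - 1) * card J" using R by linarith
  show thesis by (rule that[OF \<F>(1,3) \<F>(2) bound])
qed

section \<open>Random signs and disjoint blocks\<close>

text \<open>Independence in the form used below: each \<open>w S\<close> sees only the coordinates
  in \<open>S\<close>, so splitting the product distribution into \<open>S\<close> and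
  \<open>A - S\<close> factors the integral, and induction does the rest.\<close>

lemma nn_integral_Pi_pmf_prod_blocks:
  fixes w :: "'a set \<Rightarrow> ('a \<Rightarrow> 'b) \<Rightarrow> ennreal"
  assumes "finite \<F>" and "finite A" and "disjoint \<F>" and "\<And>S. S \<in> \<F> \<Longrightarrow> S \<subseteq> A"
    and local: "\<And>S f g. S \<in> \<F> \<Longrightarrow> (\<And>i. i \<in> S \<Longrightarrow> f i = g i) \<Longrightarrow> w S f = w S g"
    and bound: "\<And>S. S \<in> \<F> \<Longrightarrow> (\<integral>\<^sup>+ f. w S f \<partial>measure_pmf (Pi_pmf S d q)) \<le> c"
  shows "(\<integral>\<^sup>+ f. (\<Prod>S\<in>\<F>. w S f) \<partial>measure_pmf (Pi_pmf A d q)) \<le> c ^ card \<F>"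
  using assms
proof (induction \<F> arbitrary: A rule: finite_induct)
  case empty
  show ?case by simp
next
  case (insert S \<F>)
  have S: "S \<subseteq> A" "finite S" using insert.prems(1) insert.prems(3)[of S] by (auto intro: finite_subset)
  have disj: "S \<inter> T = {}" if "T \<in> \<F>" for T
    using insert.prems(2) insert.hyps(2) that by (auto simp: disjoint_def)
  have "Pi_pmf A d q = Pi_pmf (S \<union> (A - S)) d q" using S by (simp add: Un_absorb1)
  also have "\<dots> = map_pmf (\<lambda>(f, g) x. if x \<in> S then f x else g x)
      (pair_pmf (Pi_pmf S d q) (Pi_pmf (A - S) d q))"
    using S insert.prems(1) by (intro Pi_pmf_union) auto
  finally have split: "Pi_pmf A d q = \<dots>" .
  have "(\<integral>\<^sup>+ f. (\<Prod>S\<in>insert S \<F>. w S f) \<partial>measure_pmf (Pi_pmf A d q))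
      = (\<integral>\<^sup>+ f. \<integral>\<^sup>+ g. (\<Prod>T\<in>insert S \<F>. w T (\<lambda>x. if x \<in> S then f x else g x))
           \<partial>measure_pmf (Pi_pmf (A - S) d q) \<partial>measure_pmf (Pi_pmf S d q))"
    unfolding split by (simp add: nn_integral_pair_pmf')
  also have "\<dots> = (\<integral>\<^sup>+ f. \<integral>\<^sup>+ g. w S f * (\<Prod>T\<in>\<F>. w T g)
           \<partial>measure_pmf (Pi_pmf (A - S) d q) \<partial>measure_pmf (Pi_pmf S d q))"
  proof (intro nn_integral_cong)
    fix f g :: "'a \<Rightarrow> 'b"
    have "w S (\<lambda>x. if x \<in> S then f x else g x) = w S f"
      by (rule insert.prems(4)) auto
    moreover have "w T (\<lambda>x. if x \<in> S then f x else g x) = w T g" if "T \<in> \<F>" for T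
      using that disj[OF that] by (intro insert.prems(4)) auto
    ultimately show "(\<Prod>T\<in>insert S \<F>. w T (\<lambda>x. if x \<in> S then f x else g x)) = w S f * (\<Prod>T\<in>\<F>. w T g)"
      using insert.hyps by simp
  qed
  also have "\<dots> = (\<integral>\<^sup>+ f. w S f \<partial>measure_pmf (Pi_pmf S d q))
      * (\<integral>\<^sup>+ g. (\<Prod>T\<in>\<F>. w T g) \<partial>measure_pmf (Pi_pmf (A - S) d q))"
    by (simp add: nn_integral_cmult nn_integral_multc)
  also have "\<dots> \<le> c * c ^ card \<F>"
  proof (intro mult_mono)
    show "(\<integral>\<^sup>+ g. (\<Prod>T\<in>\<F>. w T g) \<partial>measure_pmf (Pi_pmf (A - S) d q)) \<le> c ^ card \<F>"
    proof (rule insert.IH)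
      show "disjoint \<F>" using insert.prems(2) by (auto simp: disjoint_def)
      show "T \<subseteq> A - S" if "T \<in> \<F>" for T using insert.prems(3)[of T] disj[OF that] that by auto
      show "w T f = w T g" if "T \<in> \<F>" "\<And>i. i \<in> T \<Longrightarrow> f i = g i" for T f g
        using that by (intro insert.prems(4)) auto
    qed (use insert.prems(1,5) in auto)
  qed (use insert.prems(5) in auto)
  finally show ?case using insert.hyps by simp
qed

text \<open>Chernoff's method for the lower tail: Markov's inequality is applied to exp(-N), where N
  is the number of bad blocks. A block contributes at most 1 - p (1 - 1/e), hence at most 1 - p/2,
  hence at most exp(-p/2).\<close>

lemma few_bad_blocks_tail:
  fixes E :: "'a set \<Rightarrow> ('a \<Rightarrow> 'b) \<Rightarrow> bool" and p t :: real
  assumes fin: "finite A" and disj: "disjoint \<F>" and sub: "\<And>S. S \<in> \<F> \<Longrightarrow> S \<subseteq> A"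
    and local: "\<And>S f g. S \<in> \<F> \<Longrightarrow> (\<And>i. i \<in> S \<Longrightarrow> f i = g i) \<Longrightarrow> E S f = E S g"
    and p: "\<And>S. S \<in> \<F> \<Longrightarrow> p \<le> measure_pmf.prob (Pi_pmf S d q) {f. E S f}" and p1: "p \<le> 1"
  shows "measure_pmf.prob (Pi_pmf A d q) {f. real (card {S \<in> \<F>. E S f}) \<le> t} \<le> exp (t - p * real (card \<F>) / 2)"
proof -
  have finF: "finite \<F>" using sub fin by (auto intro: finite_subset[of _ "Pow A"])
  define w where "w = (\<lambda>S f. if E S f then ennreal (exp (-1)) else 1)"
  have "(\<integral>\<^sup>+ f. w S f \<partial>measure_pmf (Pi_pmf S d q)) \<le> ennreal (1 - p / 2)" if S: "S \<in> \<F>" for S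
  proof -
    let ?M = "measure_pmf (Pi_pmf S d q)" and ?P = "measure_pmf.prob (Pi_pmf S d q) {f. E S f}"
    have "(\<integral>\<^sup>+ f. w S f \<partial>?M) = (\<integral>\<^sup>+ f. ennreal (exp (-1)) * indicator {f. E S f} f
        + indicator (- {f. E S f}) f \<partial>?M)"
      by (intro nn_integral_cong) (auto simp: w_def)
    also have "\<dots> = ennreal (exp (-1)) * emeasure ?M {f. E S f} + emeasure ?M (- {f. E S f})"
      by (simp add: nn_integral_add nn_integral_cmult_indicator)
    also have "\<dots> = ennreal (exp (-1) * ?P + (1 - ?P))"
    proof -
      have "measure_pmf.prob (Pi_pmf S d q) (- {f. E S f}) = 1 - ?P"
        using measure_pmf.prob_compl[of "{f. E S f}" "Pi_pmf S d q"] by (simp add: Compl_eq_Diff_UNIV)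
      then show ?thesis
        by (simp only: measure_pmf.emeasure_eq_measure) (simp add: ennreal_plus ennreal_mult)
    qed
    also have "\<dots> \<le> ennreal (1 - p / 2)"
    proof (intro ennreal_leI)
      have "exp (-1::real) \<le> 1 / 2"
        using exp_ge_add_one_self[of "1::real"] by (simp add: exp_minus field_simps)
      then have "exp (-1) * ?P \<le> 1 / 2 * ?P" by (intro mult_right_mono) auto
      then show "exp (-1) * ?P + (1 - ?P) \<le> 1 - p / 2" using p[OF S] by linarith
    qed
    finally show ?thesis .
  qed
  then have int: "(\<integral>\<^sup>+ f. (\<Prod>S\<in>\<F>. w S f) \<partial>measure_pmf (Pi_pmf A d q)) \<le> ennreal (1 - p / 2) ^ card \<F>"
  proof (intro nn_integral_Pi_pmf_prod_blocks[OF finF fin disj sub])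
    show "w S f = w S g" if S: "S \<in> \<F>" and eq: "\<And>i. i \<in> S \<Longrightarrow> f i = g i" for S f g
      using local[of S f g, OF S eq] by (simp add: w_def)
  qed
  have w_prod: "(\<Prod>S\<in>\<F>. w S f) = ennreal (exp (- real (card {S \<in> \<F>. E S f})))" for f
  proof -
    have "(\<Prod>S\<in>\<F>. w S f) = (\<Prod>S\<in>{S \<in> \<F>. E S f}. ennreal (exp (-1)))"
      using finF by (intro prod.mono_neutral_cong_right) (auto simp: w_def)
    also have "\<dots> = ennreal (exp (-1) ^ card {S \<in> \<F>. E S f})" by (simp add: ennreal_power)
    also have "exp (-1) ^ card {S \<in> \<F>. E S f} = exp (- real (card {S \<in> \<F>. E S f}))"
      by (simp flip: exp_of_nat_mult)
    finally show ?thesis .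
  qed
  have "emeasure (measure_pmf (Pi_pmf A d q)) {f. real (card {S \<in> \<F>. E S f}) \<le> t}
      = (\<integral>\<^sup>+ f. indicator {f. real (card {S \<in> \<F>. E S f}) \<le> t} f \<partial>measure_pmf (Pi_pmf A d q))"
    by simp
  also have "\<dots> \<le> (\<integral>\<^sup>+ f. ennreal (exp t) * (\<Prod>S\<in>\<F>. w S f) \<partial>measure_pmf (Pi_pmf A d q))"
  proof (intro nn_integral_mono)
    fix f
    have "ennreal (exp t) * (\<Prod>S\<in>\<F>. w S f) = ennreal (exp (t - real (card {S \<in> \<F>. E S f})))"
      unfolding w_prod by (simp add: exp_diff exp_minus divide_inverse flip: ennreal_mult)
    moreover have "1 \<le> exp (t - real (card {S \<in> \<F>. E S f}))" if "real (card {S \<in> \<F>. E S f}) \<le> t"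
      using that by simp
    ultimately show "indicator {f. real (card {S \<in> \<F>. E S f}) \<le> t} f \<le> ennreal (exp t) * (\<Prod>S\<in>\<F>. w S f)"
      by (auto simp: indicator_def simp flip: ennreal_1 intro!: ennreal_leI)
  qed
  also have "\<dots> = ennreal (exp t) * (\<integral>\<^sup>+ f. (\<Prod>S\<in>\<F>. w S f) \<partial>measure_pmf (Pi_pmf A d q))"
    by (simp add: nn_integral_cmult)
  also have "\<dots> \<le> ennreal (exp t) * ennreal (1 - p / 2) ^ card \<F>"
    using int by (intro mult_left_mono) auto
  also have "\<dots> \<le> ennreal (exp t) * ennreal (exp (- p / 2)) ^ card \<F>"
    using exp_ge_add_one_self[of "- p / 2"]
    by (intro mult_left_mono power_mono ennreal_leI) auto
  also have "\<dots> = ennreal (exp t * exp (- p / 2) ^ card \<F>)"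
    by (simp add: ennreal_power flip: ennreal_mult)
  also have "exp t * exp (- p / 2) ^ card \<F> = exp (t - p * real (card \<F>) / 2)"
    by (simp flip: exp_of_nat_mult exp_add)
  finally show ?thesis
    by (simp add: measure_pmf.emeasure_eq_measure)
qed

definition block_failure :: "(nat \<Rightarrow> real) \<Rightarrow> real \<Rightarrow> real \<Rightarrow> real \<Rightarrow> nat set \<Rightarrow> (nat \<Rightarrow> real) \<Rightarrow> bool" where
  "block_failure x \<sigma> C r S Y \<longleftrightarrow>
     (\<forall>P. real (degree P) \<le> \<sigma> \<longrightarrow> unit_norm P \<le> C \<longrightarrow>
        (\<exists>i\<in>S. cmod (poly P (of_real (x i)) - of_real (Y i)) > r))"

lemma block_failure_uminus:
  assumes "block_failure x \<sigma> C r S e"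
  shows "block_failure x \<sigma> C r S (\<lambda>i. - e i)"
  unfolding block_failure_def
proof (intro allI impI)
  fix P assume "real (degree P) \<le> \<sigma>" "unit_norm P \<le> C"
  then have "real (degree (- P)) \<le> \<sigma>" "unit_norm (- P) \<le> C"
    by (simp_all add: unit_norm_def)
  then obtain i where i: "i \<in> S" "cmod (poly (- P) (of_real (x i)) - of_real (e i)) > r"
    using assms unfolding block_failure_def by blast
  have "poly (- P) (of_real (x i)) - of_real (e i) = - (poly P (of_real (x i)) - of_real (- e i))" by simp
  then have "cmod (poly (- P) (of_real (x i)) - of_real (e i)) = cmod (poly P (of_real (x i)) - of_real (- e i))"
    by (metis norm_minus_cancel)
  then show "\<exists>i\<in>S. cmod (poly P (of_real (x i)) - of_real (- e i)) > r" using i by metis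
qed

text \<open>Replacing \<open>P\<close> by \<open>- P\<close> shows that with a missed sign pattern
  its negative is missed too. Two patterns of probability at least 2^(-k) each explain the exponent
  \<open>1 - k\<close>.\<close>

lemma prob_block_failure:
  assumes fin: "finite S" and ne: "S \<noteq> {}" and k: "card S \<le> k"
    and bad: "\<not> sign_approximable x \<sigma> C r S"
  shows "2 powr (1 - real k) \<le> measure_pmf.prob (Pi_pmf S 0 (\<lambda>_. pmf_of_set {-1, 1})) {Y. block_failure x \<sigma> C r S Y}"
proof -
  let ?M = "Pi_pmf S 0 (\<lambda>_. pmf_of_set {-1, 1::real})"
  obtain e where e: "\<And>i. i \<in> S \<Longrightarrow> e i \<in> {-1, 1::real}" and fail: "block_failure x \<sigma> C r S e"
    using bad unfolding sign_approximable_def block_failure_def by (metis not_le)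
  \<comment> \<open>Outside \<open>S\<close> the product distribution takes the default value 0, so
    only a pattern vanishing there has positive mass.\<close>
  define e1 where "e1 = (\<lambda>i. if i \<in> S then e i else 0)"
  define e2 where "e2 = (\<lambda>i. - e1 i)"
  have f1: "block_failure x \<sigma> C r S e1"
    using fail by (simp add: block_failure_def e1_def cong: bex_cong)
  have f2: "block_failure x \<sigma> C r S e2" unfolding e2_def by (rule block_failure_uminus[OF f1])
  have "e1 \<noteq> e2"
  proof
    obtain i where "i \<in> S" using ne by blast
    moreover assume "e1 = e2"
    ultimately show False using e[of i] by (auto simp: e1_def e2_def fun_eq_iff split: if_splits)
  qed
  have pmf: "pmf ?M f = (1 / 2) ^ card S" if f: "\<And>i. i \<in> S \<Longrightarrow> f i \<in> {-1, 1}" "\<And>i. i \<notin> S \<Longrightarrow> f i = 0" for f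
  proof -
    have "pmf ?M f = (\<Prod>i\<in>S. pmf (pmf_of_set {-1, 1}) (f i))"
      using fin f by (simp add: pmf_Pi)
    also have "\<dots> = (\<Prod>i\<in>S. 1 / 2)"
      using f by (intro prod.cong refl) (auto simp: pmf_of_set indicator_def)
    finally show ?thesis by simp
  qed
  have e1s: "e1 i \<in> {-1, 1}" if "i \<in> S" for i using e[OF that] that by (simp add: e1_def)
  have e2s: "e2 i \<in> {-1, 1}" if "i \<in> S" for i using e1s[OF that] by (auto simp: e2_def)
  have "2 powr (1 - real k) \<le> 2 powr (1 - real (card S))" using k by simp
  also have "\<dots> = pmf ?M e1 + pmf ?M e2"
    using pmf[OF e1s] pmf[OF e2s]
    by (simp add: e1_def e2_def powr_diff powr_realpow power_divide)
  also have "\<dots> = measure_pmf.prob ?M {e1, e2}"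
    using \<open>e1 \<noteq> e2\<close> by (simp add: measure_measure_pmf_finite)
  also have "\<dots> \<le> measure_pmf.prob ?M {Y. block_failure x \<sigma> C r S Y}"
    using f1 f2 by (intro measure_pmf.finite_measure_mono) auto
  finally show ?thesis .
qed

text \<open>On a missed block some index has error above \<open>(1 + \<rho>) / 2\<close> at
  \<open>x\<close>. By the choice of \<open>h\<close>, passing to \<open>z\<close> changes the value
  by at most \<open>(1 - \<rho>) / 2\<close>, which leaves an error above \<open>\<rho>\<close>;
  disjoint blocks yield distinct indices. The tail exponent contains
  \<open>2 powr (1 - k) * b * n / 2\<close>, which is shared between \<open>\<beta>\<close> and
  \<open>\<gamma>\<close>; hence the quarters.\<close>

lemma robust_failure_probability:
  fixes C \<rho> \<alpha> \<beta> \<gamma> h b :: real and n k :: nat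
  assumes C: "C > 0" and \<rho>: "\<rho> < 1" and \<alpha>: "\<alpha> > 0" and n: "n > 0" and k: "k > 0"
    and x: "\<And>i. i \<in> {1..n} \<Longrightarrow> x i \<in> {-1..1}"
    and h: "h = (1 - \<rho>) / (2 * exp 1 * C * (1 + \<alpha>))"
    and disj: "disjoint \<F>"
    and blocks: "\<And>S. S \<in> \<F> \<Longrightarrow> S \<subseteq> {1..n} \<and> S \<noteq> {} \<and> card S \<le> k
      \<and> \<not> sign_approximable x ((1 + \<alpha>) * real n) C ((1 + \<rho>) / 2) S"
    and many: "b * real n \<le> real (card \<F>)"
    and \<beta>: "\<beta> \<le> 2 powr (1 - real k) * b / 4" and \<gamma>: "\<gamma> \<le> 2 powr (1 - real k) * b / 4"
  shows "1 - exp (- \<gamma> * real n) \<le> measure_pmf.prob (random_signs n) (robust_failure_event C \<rho> \<alpha> \<beta> h n x)"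
proof -
  define p where "p = 2 powr (1 - real k)"
  define E where "E = block_failure x ((1 + \<alpha>) * real n) C ((1 + \<rho>) / 2)"
  define few where "few = {Y. real (card {S \<in> \<F>. E S Y}) \<le> \<beta> * real n}"
  have p: "0 < p" "p \<le> 1"
    using k powr_mono[of "1 - real k" 0 2] by (auto simp: p_def)
  have "measure_pmf.prob (random_signs n) few \<le> exp (\<beta> * real n - p * real (card \<F>) / 2)"
    unfolding random_signs_def few_def
  proof (rule few_bad_blocks_tail[OF _ disj _ _ _ p(2)])
    fix S assume S: "S \<in> \<F>"
    show "S \<subseteq> {1..n}" using blocks[OF S] by blast
    show "p \<le> measure_pmf.prob (Pi_pmf S 0 (\<lambda>_. pmf_of_set {-1, 1})) {f. E S f}"
      unfolding p_def E_def using blocks[OF S] by (intro prob_block_failure) (auto intro: finite_subset)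
    show "E S f = E S g" if "\<And>i. i \<in> S \<Longrightarrow> f i = g i" for f g
      using that by (simp add: E_def block_failure_def cong: bex_cong)
  qed simp
  also have "\<beta> * real n - p * real (card \<F>) / 2 \<le> - \<gamma> * real n"
  proof -
    have "p * (b * real n) \<le> p * real (card \<F>)" using many p by (intro mult_left_mono) auto
    moreover have "\<beta> * real n \<le> p * b / 4 * real n" "\<gamma> * real n \<le> p * b / 4 * real n"
      by (intro mult_right_mono; use \<beta> \<gamma> in \<open>simp add: p_def\<close>)+
    ultimately show ?thesis by (simp add: algebra_simps)
  qed
  finally have few: "measure_pmf.prob (random_signs n) few \<le> exp (- \<gamma> * real n)" by simp
  have "- few \<subseteq> robust_failure_event C \<rho> \<alpha> \<beta> h n x"
  proof
    fix Y assume "Y \<in> - few"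
    then have Y: "\<beta> * real n < real (card {S \<in> \<F>. E S Y})" by (simp add: few_def)
    show "Y \<in> robust_failure_event C \<rho> \<alpha> \<beta> h n x"
      unfolding robust_failure_event_def
    proof (intro CollectI allI impI)
      fix P z
      assume z: "\<forall>i\<in>{1..n}. z i \<in> {-1..1::real}" and deg: "real (degree P) \<le> (1 + \<alpha>) * real n"
        and norm: "unit_norm P \<le> C" and close: "\<forall>i\<in>{1..n}. dang (x i) (z i) \<le> h / real n"
      have perturb: "cmod (poly P (of_real (x i)) - poly P (of_real (z i))) \<le> (1 - \<rho>) / 2" if i: "i \<in> {1..n}" for i
      proof -
        have "cmod (poly P (of_real (x i)) - poly P (of_real (z i)))
            \<le> exp 1 * ((1 + \<alpha>) * real n) * C * dang (x i) (z i)"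
          using \<alpha> n z x i by (intro poly_arccos_lipschitz[OF deg _ norm]) auto
        also have "\<dots> \<le> exp 1 * ((1 + \<alpha>) * real n) * C * (h / real n)"
          using close i \<alpha> C by (intro mult_left_mono) auto
        also have "\<dots> = (exp 1 * C * (1 + \<alpha>)) * h" using n by simp
        also have "\<dots> = (1 - \<rho>) / 2"
        proof -
          define D where "D = exp 1 * C * (1 + \<alpha>)"
          have "D \<noteq> 0" "h = (1 - \<rho>) / (2 * D)" using \<alpha> C by (simp_all add: D_def h mult.assoc)
          then have "D * h = (1 - \<rho>) / 2" by simp
          then show ?thesis by (simp only: D_def)
        qed
        finally show ?thesis .
      qed
      have "\<exists>i\<in>S. cmod (poly P (of_real (z i)) - of_real (Y i)) > \<rho>" if S: "S \<in> \<F>" "E S Y" for S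
      proof -
        obtain i where i: "i \<in> S" "cmod (poly P (of_real (x i)) - of_real (Y i)) > (1 + \<rho>) / 2"
          using S deg norm unfolding E_def block_failure_def by blast
        have "i \<in> {1..n}" using i(1) blocks[OF S(1)] by blast
        from perturb[OF this] i(2)
          norm_triangle_ineq[of "poly P (of_real (x i)) - poly P (of_real (z i))" "poly P (of_real (z i)) - of_real (Y i)"]
        show ?thesis using i(1) by (intro bexI[of _ i]) (auto simp: field_simps)
      qed
      then obtain s where s: "\<And>S. S \<in> \<F> \<Longrightarrow> E S Y \<Longrightarrow> s S \<in> S \<and> cmod (poly P (of_real (z (s S))) - of_real (Y (s S))) > \<rho>"
        by metis
      have "inj_on s {S \<in> \<F>. E S Y}"
      proof (rule inj_onI)
        fix S T assume "S \<in> {S \<in> \<F>. E S Y}" "T \<in> {S \<in> \<F>. E S Y}" and eq: "s S = s T"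
        then have ST: "S \<in> \<F>" "T \<in> \<F>" "s S \<in> S" "s S \<in> T" using s[of S] s[of T] by auto
        show "S = T"
        proof (rule ccontr)
          assume "S \<noteq> T"
          then have "S \<inter> T = {}" by (rule disjointD[OF disj ST(1,2)])
          then show False using ST by blast
        qed
      qed
      moreover have "s ` {S \<in> \<F>. E S Y} \<subseteq> {i \<in> {1..n}. cmod (poly P (of_real (z i)) - of_real (Y i)) > \<rho>}"
      proof
        fix i assume "i \<in> s ` {S \<in> \<F>. E S Y}"
        then obtain S where "S \<in> \<F>" "E S Y" "i = s S" by blast
        then show "i \<in> {i \<in> {1..n}. cmod (poly P (of_real (z i)) - of_real (Y i)) > \<rho>}"
          using s[of S] blocks[of S] by blast
      qed
      ultimately have "card {S \<in> \<F>. E S Y} \<le> error_count n \<rho> P z Y"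
        unfolding error_count_def by (intro card_inj_on_le[of s]) auto
      then show "\<beta> * real n < real (error_count n \<rho> P z Y)" using Y by linarith
    qed
  qed
  then have "measure_pmf.prob (random_signs n) (- few) \<le> measure_pmf.prob (random_signs n) (robust_failure_event C \<rho> \<alpha> \<beta> h n x)"
    by (intro measure_pmf.finite_measure_mono) auto
  moreover have "measure_pmf.prob (random_signs n) (- few) = 1 - measure_pmf.prob (random_signs n) few"
    using measure_pmf.prob_compl[of few "random_signs n"] by (simp add: Compl_eq_Diff_UNIV)
  ultimately show ?thesis using few by linarith
qed

section \<open>Blocks from the finite obstruction\<close>

text \<open>At most \<open>L / (k + 1) + 1\<close> intervals of length \<open>k + 1\<close> are
  needed, each wasting at most \<open>k - 1\<close> indices. As \<open>(k - 1) * L = k * n\<close>,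
  at least n/(k+1) - (k-1) indices lie in blocks, and \<open>n \<ge> 2 * (k^2 - 1)\<close> makes
  this at least half of n/(k+1). So \<open>\<alpha> = 1 / (k - 1)\<close> is a degree excess that
  length \<open>k + 1\<close> can still absorb.\<close>

lemma many_dense_blocks:
  fixes n k :: nat and L :: real
  assumes k: "k \<ge> 2" and n: "n \<ge> 2 * (k\<^sup>2 - 1)" and L: "L = (1 + 1 / (real k - 1)) * real n"
    and \<theta>: "\<And>i. i \<in> {1..n} \<Longrightarrow> 0 \<le> \<theta> i \<and> \<theta> i \<le> L"
  obtains \<F> where "disjoint \<F>"
    "\<And>S. S \<in> \<F> \<Longrightarrow> S \<subseteq> {1..n} \<and> card S = k \<and> (\<exists>a. \<forall>i\<in>S. \<theta> i \<in> {a..a + real k + 1})"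
    "1 / (2 * real k * (real k + 1)) * real n \<le> real (card \<F>)"
proof -
  define g where "g = (\<lambda>i. nat \<lfloor>\<theta> i / (real k + 1)\<rfloor>)"
  define J where "J = {..nat \<lfloor>L / (real k + 1)\<rfloor>}"
  have L0: "0 \<le> L" using L k by simp
  have gJ: "g ` {1..n} \<subseteq> J"
    using \<theta> by (auto simp: g_def J_def intro!: nat_mono floor_mono divide_right_mono)
  obtain \<F> where \<F>: "finite \<F>" "disjoint \<F>"
    "\<And>S. S \<in> \<F> \<Longrightarrow> S \<subseteq> {1..n} \<and> card S = k \<and> (\<exists>j\<in>J. \<forall>i\<in>S. g i = j)"
    "card {1..n} \<le> k * card \<F> + (k - 1) * card J"
    by (rule disjoint_blocks_in_fibres[OF finite_atLeastAtMost _ gJ, of k])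
      (use k in \<open>simp_all add: J_def\<close>)
  show thesis
  proof
    show "disjoint \<F>" by (rule \<F>(2))
    fix S assume S: "S \<in> \<F>"
    then obtain j where j: "\<And>i. i \<in> S \<Longrightarrow> g i = j" using \<F>(3) by blast
    have "\<theta> i \<in> {real j * (real k + 1)..real j * (real k + 1) + real k + 1}" if i: "i \<in> S" for i
    proof -
      have "0 \<le> \<theta> i / (real k + 1)" using \<theta>[of i] \<F>(3)[OF S] i by auto
      then have "real j \<le> \<theta> i / (real k + 1)" "\<theta> i / (real k + 1) \<le> real j + 1"
        using j[OF i] unfolding g_def by linarith+
      then show ?thesis by (simp add: field_simps)
    qed
    then show "S \<subseteq> {1..n} \<and> card S = k \<and> (\<exists>a. \<forall>i\<in>S. \<theta> i \<in> {a..a + real k + 1})"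
      using \<F>(3)[OF S] by blast
  next
    have k1: "real k - 1 > 0" using k by simp
    have "real (card J) \<le> L / (real k + 1) + 1"
      using L0 by (simp add: J_def)
    also have "L = real k * real n / (real k - 1)"
      using k1 by (simp add: L field_simps)
    finally have J: "(real k - 1) * real (card J) \<le> (real k - 1) * (real k * real n / (real k - 1) / (real k + 1) + 1)"
      using k1 by (intro mult_left_mono) auto
    also have "\<dots> = real k * real n / (real k + 1) + (real k - 1)"
    proof -
      have "d * (X / d / Y + 1) = X / Y + d" if "d > 0" for d X Y :: real
        using that by (simp add: distrib_left)
      from this[OF k1] show ?thesis .
    qed
    finally have J': "(real k - 1) * real (card J) \<le> real k * real n / (real k + 1) + (real k - 1)" .
    have "real n \<le> real (k * card \<F> + (k - 1) * card J)" using \<F>(4) by (simp only: card_atLeastAtMost of_nat_le_iff diff_Suc_1 Suc_eq_plus1 add_diff_cancel_right')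
    also have "\<dots> = real k * real (card \<F>) + (real k - 1) * real (card J)"
      using k by (simp add: of_nat_diff)
    finally have "real n \<le> real k * real (card \<F>) + (real k * real n / (real k + 1) + (real k - 1))"
      using J' by linarith
    moreover have "real k * real n / (real k + 1) + real n / (real k + 1) = (real k + 1) * real n / (real k + 1)"
      by (simp only: add_divide_distrib[symmetric] distrib_right mult_1)
    moreover have "(real k + 1) * real n / (real k + 1) = real n" by simp
    ultimately have 1: "real n / (real k + 1) - (real k - 1) \<le> real k * real (card \<F>)" by linarith
    have "1 \<le> k\<^sup>2" using k by simp
    then have "2 * ((real k)\<^sup>2 - 1) \<le> real n"
      using of_nat_mono[OF n, where 'a = real] by (simp add: of_nat_diff)
    then have "2 * (real k - 1) \<le> real n / (real k + 1)"
      by (simp add: field_simps power2_eq_square)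
    moreover define q where "q = real n / (real k + 1)"
    ultimately have "q \<le> 2 * (real k * real (card \<F>))" using 1 by (simp add: algebra_simps)
    then have "q / (2 * real k) \<le> real (card \<F>)" using k by (simp add: divide_le_eq mult_ac)
    then show "1 / (2 * real k * (real k + 1)) * real n \<le> real (card \<F>)"
      by (simp add: q_def mult_ac)
  qed
qed

lemma admissible_of_obstruction:
  fixes C \<rho> \<rho>' A \<alpha> \<beta> \<gamma> h :: real and k n\<^sub>1 :: nat
  assumes C: "C > 0" and \<rho>: "\<rho> < 1" and \<rho>': "\<rho>' = (1 + \<rho>) / 2"
    and supplies: "obstruction_supplies A (C / (1 - \<rho>')) k"
    and \<alpha>: "\<alpha> = 1 / (real k - 1)"
    and \<beta>: "\<beta> = 2 powr (1 - real k) / (8 * real k * (real k + 1))"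
    and \<gamma>: "\<gamma> = 2 powr (1 - real k) / (16 * real k * (real k + 1))"
    and n\<^sub>1: "n\<^sub>1 = 2 * (k\<^sup>2 - 1)" and h: "h = (1 - \<rho>) / (2 * exp 1 * C * (1 + \<alpha>))"
  shows "admissible_constants C \<rho> \<alpha> \<beta> \<gamma> h n\<^sub>1"
proof -
  have k: "k \<ge> 2" using supplies by (simp add: obstruction_supplies_def)
  have \<alpha>0: "\<alpha> > 0" using k by (simp add: \<alpha>)
  define b where "b = 1 / (2 * real k * (real k + 1))"
  have \<beta>b: "\<beta> = 2 powr (1 - real k) * b / 4" and \<gamma>b: "\<gamma> \<le> 2 powr (1 - real k) * b / 4"
    using k by (simp_all add: \<beta> \<gamma> b_def frac_le)
  have "1 - exp (- \<gamma> * real n) \<le> measure_pmf.prob (random_signs n) (robust_failure_event C \<rho> \<alpha> \<beta> h n x)"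
    if n: "n \<ge> n\<^sub>1" and x: "\<forall>i\<in>{1..n}. x i \<in> {-1..1}" for n and x :: "nat \<Rightarrow> real"
  proof -
    have "2\<^sup>2 \<le> k\<^sup>2" using k by (rule power_mono) simp
    then have n0: "n > 0" using n by (simp add: n\<^sub>1)
    define L where "L = (1 + \<alpha>) * real n"
    have L0: "L > 0" using \<alpha>0 n0 by (simp add: L_def)
    have range: "0 \<le> arccos (x i) * L / pi \<and> arccos (x i) * L / pi \<le> L" if i: "i \<in> {1..n}" for i
    proof -
      have "0 \<le> arccos (x i)" "arccos (x i) \<le> pi" using arccos_bounded[of "x i"] x i by auto
      then show ?thesis using L0 by (simp add: field_simps)
    qed
    obtain \<F> where \<F>: "disjoint \<F>"
      "\<And>S. S \<in> \<F> \<Longrightarrow> S \<subseteq> {1..n} \<and> card S = k \<and> (\<exists>a. \<forall>i\<in>S. arccos (x i) * L / pi \<in> {a..a + real k + 1})"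
      "b * real n \<le> real (card \<F>)"
      by (rule many_dense_blocks[OF k n[unfolded n\<^sub>1], of L "\<lambda>i. arccos (x i) * L / pi"])
        (use range in \<open>auto simp: L_def \<alpha> b_def\<close>)
    show ?thesis
    proof (rule robust_failure_probability[OF C \<rho> \<alpha>0 n0 _ _ h \<F>(1) _ \<F>(3) eq_refl[OF \<beta>b] \<gamma>b])
      show "k > 0" using k by simp
      show "x i \<in> {-1..1}" if "i \<in> {1..n}" for i using x that by blast
      fix S assume S: "S \<in> \<F>"
      obtain a where a: "\<And>i. i \<in> S \<Longrightarrow> arccos (x i) * L / pi \<in> {a..a + real k + 1}"
        using \<F>(2)[OF S] by blast
      have "\<not> sign_approximable x L C \<rho>' S"
      proof (rule obstruction_not_sign_approximable[OF supplies _ _ L0 _ a])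
        show "\<rho>' < 1" using \<rho> by (simp add: \<rho>')
        show "card S = k" using \<F>(2)[OF S] by blast
        show "x i \<in> {-1..1}" if "i \<in> S" for i using x \<F>(2)[OF S] that by blast
      qed
      then show "S \<subseteq> {1..n} \<and> S \<noteq> {} \<and> card S \<le> k
          \<and> \<not> sign_approximable x ((1 + \<alpha>) * real n) C ((1 + \<rho>) / 2) S"
        using \<F>(2)[OF S] k unfolding L_def \<rho>' by auto
    qed
  qed
  then show ?thesis unfolding admissible_constants_def
    using \<alpha>0 k C \<rho> by (simp add: \<beta> \<gamma> h)
qed

section \<open>Lagrange bases, near-Fekete points and localizers on the circle\<close>

definition lagrange_basis :: "complex set \<Rightarrow> complex \<Rightarrow> complex poly" where
  "lagrange_basis Z z = (\<Prod>u\<in>Z - {z}. smult (inverse (z - u)) [:- u, 1:])"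

lemma poly_lagrange_basis:
  "poly (lagrange_basis Z z) y = (\<Prod>u\<in>Z - {z}. (y - u) / (z - u))"
  by (simp add: lagrange_basis_def poly_prod divide_inverse algebra_simps)

lemma degree_lagrange_basis:
  assumes "finite Z" "z \<in> Z"
  shows "degree (lagrange_basis Z z) \<le> card Z - 1"
proof -
  have "degree (lagrange_basis Z z) \<le> (\<Sum>u\<in>Z - {z}. degree (smult (inverse (z - u)) [:- u, 1:]))"
    unfolding lagrange_basis_def
    using degree_prod_sum_le[of "Z - {z}" "\<lambda>u. smult (inverse (z - u)) [:- u, 1:]"] assms by (simp add: o_def)
  also have "\<dots> \<le> (\<Sum>u\<in>Z - {z}. 1)" by (intro sum_mono order_trans[OF degree_smult_le]) simp
  finally show ?thesis using assms by simp
qed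

lemma lagrange_basis_self: "poly (lagrange_basis Z z) z = 1"
  unfolding poly_lagrange_basis by (intro prod.neutral) auto

lemma lagrange_basis_other:
  assumes "finite Z" "u \<in> Z" "u \<noteq> z"
  shows "poly (lagrange_basis Z z) u = 0"
  unfolding poly_lagrange_basis using assms by (intro prod_zero) auto

lemma lagrange_interpolation:
  assumes fin: "finite Z" and deg: "degree F < card Z"
  shows "poly F y = (\<Sum>z\<in>Z. poly F z * poly (lagrange_basis Z z) y)"
proof -
  let ?G = "\<Sum>z\<in>Z. smult (poly F z) (lagrange_basis Z z)"
  have "F = ?G"
  proof (rule poly_eqI_degree[of Z])
    fix x assume x: "x \<in> Z"
    have "poly ?G x = (\<Sum>z\<in>Z. if z = x then poly F x else 0)"
      unfolding poly_sum using x fin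
      by (intro sum.cong refl) (auto simp: lagrange_basis_self lagrange_basis_other)
    then show "poly F x = poly ?G x" using x fin by simp
  next
    have "degree ?G \<le> card Z - 1"
      by (intro degree_sum_le fin order_trans[OF degree_smult_le] degree_lagrange_basis) auto
    then show "degree ?G < card Z" using deg by linarith
  qed (rule deg)
  then have "poly F y = poly ?G y" by simp
  then show ?thesis by (simp add: poly_sum)
qed

text \<open>The product runs over ordered pairs, so this is the squared modulus of the Vandermonde
  determinant. That is why squares appear in the next lemmas.\<close>

definition vandermonde :: "complex set \<Rightarrow> real" where
  "vandermonde Z = (\<Prod>z\<in>Z. \<Prod>u\<in>Z - {z}. cmod (z - u))"

lemma vandermonde_insert:
  assumes "finite Z" "z \<notin> Z"
  shows "vandermonde (insert z Z) = vandermonde Z * (\<Prod>u\<in>Z. cmod (z - u))\<^sup>2"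
proof -
  have "(\<Prod>u\<in>insert z Z - {w}. cmod (w - u)) = cmod (z - w) * (\<Prod>u\<in>Z - {w}. cmod (w - u))" if "w \<in> Z" for w
  proof -
    have "insert z Z - {w} = insert z (Z - {w})" using that assms by auto
    then show ?thesis using assms by (simp add: norm_minus_commute)
  qed
  then have "(\<Prod>w\<in>Z. \<Prod>u\<in>insert z Z - {w}. cmod (w - u)) = (\<Prod>w\<in>Z. cmod (z - w)) * vandermonde Z"
    by (simp add: vandermonde_def prod.distrib)
  moreover have "insert z Z - {z} = Z" using assms by auto
  ultimately show ?thesis
    unfolding vandermonde_def[of "insert z Z"] using assms by (simp add: power2_eq_square)
qed

text \<open>The factor gained by replacing a node is the squared Lagrange polynomial of that node,
  so near-maximality of the product turns into bounds for the Lagrange polynomials.\<close>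

lemma vandermonde_exchange:
  assumes fin: "finite Z" and z: "z \<in> Z" and y: "y \<notin> Z"
  shows "vandermonde (insert y (Z - {z})) = vandermonde Z * (cmod (poly (lagrange_basis Z z) y))\<^sup>2"
proof -
  have "vandermonde Z = vandermonde (insert z (Z - {z}))" using z by (simp add: insert_absorb)
  also have "\<dots> = vandermonde (Z - {z}) * (\<Prod>u\<in>Z - {z}. cmod (z - u))\<^sup>2"
    using fin by (intro vandermonde_insert) auto
  finally have 1: "vandermonde Z = vandermonde (Z - {z}) * (\<Prod>u\<in>Z - {z}. cmod (z - u))\<^sup>2" .
  have 2: "vandermonde (insert y (Z - {z})) = vandermonde (Z - {z}) * (\<Prod>u\<in>Z - {z}. cmod (y - u))\<^sup>2"
    using fin y by (intro vandermonde_insert) auto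
  have "(\<Prod>u\<in>Z - {z}. cmod (z - u)) * cmod (poly (lagrange_basis Z z) y) = (\<Prod>u\<in>Z - {z}. cmod (y - u))"
    unfolding poly_lagrange_basis prod_norm[symmetric] prod.distrib[symmetric] norm_divide
    by (intro prod.cong refl) auto
  then show ?thesis unfolding 1 2 by (simp add: mult.assoc flip: power_mult_distrib)
qed

lemma vandermonde_pos: "finite Z \<Longrightarrow> vandermonde Z > 0"
  unfolding vandermonde_def by (intro prod_pos) auto

lemma vandermonde_le:
  assumes "finite Z" and "\<And>z. z \<in> Z \<Longrightarrow> cmod z = 1"
  shows "vandermonde Z \<le> 2 ^ (card Z * card Z)"
proof -
  have "vandermonde Z \<le> (\<Prod>z\<in>Z. 2 ^ card Z)"
    unfolding vandermonde_def
  proof (intro prod_mono conjI prod_nonneg)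
    fix z assume z: "z \<in> Z"
    have "(\<Prod>u\<in>Z - {z}. cmod (z - u)) \<le> (\<Prod>u\<in>Z - {z}. 2)"
      using assms(2) z by (intro prod_mono) (auto intro: order_trans[OF norm_triangle_ineq4])
    also have "\<dots> = 2 ^ card (Z - {z})" by simp
    also have "\<dots> \<le> 2 ^ card Z" by (intro power_increasing card_mono assms(1)) auto
    finally show "(\<Prod>u\<in>Z - {z}. cmod (z - u)) \<le> 2 ^ card Z" .
  qed auto
  then show ?thesis by (simp add: power_mult)
qed

lemma infinite_unit_circle: "infinite {z::complex. cmod z = 1}"
proof -
  have "inj_on cis {0..<2*pi}"
  proof (rule inj_onI)
    fix x y assume "x \<in> {0..<2*pi}" "y \<in> {0..<2*pi}" "cis x = cis y"
    then show "x = y" by (metis Arg2pi_unique atLeastLessThan_iff cis_conv_exp mult_1 of_real_1 zero_less_one)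
  qed
  moreover have "infinite {0..<2*pi}" by (simp add: infinite_Ico)
  moreover have "cis ` {0..<2*pi} \<subseteq> {z. cmod z = 1}" by auto
  ultimately show ?thesis using finite_imageD finite_subset by blast
qed

text \<open>Each bound is twice the ratio of the weight of the node to the weight of
  \<open>y\<close>, where points of \<open>T\<close> weigh \<open>A\<close> and others 1. The gain
  \<open>2 / A\<close> at a point of \<open>T\<close> missing from \<open>Z\<close> is what limits
  the number of such points; the price is the factor \<open>A\<close> for nodes in
  \<open>T\<close>.\<close>

definition fekete :: "real \<Rightarrow> complex set \<Rightarrow> complex set \<Rightarrow> bool" where
  "fekete A T Z \<longleftrightarrow> finite Z \<and> (\<forall>z\<in>Z. cmod z = 1) \<and>
     (\<forall>y. cmod y = 1 \<longrightarrow>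
        (\<forall>z\<in>Z. cmod (poly (lagrange_basis Z z) y) \<le> 2 * A) \<and>
        (\<forall>z\<in>Z - T. cmod (poly (lagrange_basis Z z) y) \<le> 2) \<and>
        (y \<in> T - Z \<longrightarrow>
           (\<forall>z\<in>Z - T. cmod (poly (lagrange_basis Z z) y) \<le> 2 / A) \<and>
           (\<forall>z\<in>Z \<inter> T. cmod (poly (lagrange_basis Z z) y) \<le> 2)))"

text \<open>A near-maximiser of \<open>vandermonde Z * A ^ (2 * card (Z \<inter> T))\<close> works; the weight makes it
  expensive to leave out a point of \<open>T\<close>.\<close>

lemma fekete_exists:
  fixes A :: real
  assumes A: "A \<ge> 1" and m: "m > 0"
  obtains Z where "fekete A T Z" "card Z = m"
proof -
  define \<Z> where "\<Z> = {Z. finite Z \<and> card Z = m \<and> Z \<subseteq> {z::complex. cmod z = 1}}"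
  define W where "W = (\<lambda>Z. vandermonde Z * (A ^ card (Z \<inter> T))\<^sup>2)"
  have W_le: "W Z \<le> 2 ^ (m * m) * (A ^ m)\<^sup>2" if Z: "Z \<in> \<Z>" for Z
  proof -
    have "card (Z \<inter> T) \<le> m" using Z card_mono[of Z "Z \<inter> T"] by (auto simp: \<Z>_def)
    then have "(A ^ card (Z \<inter> T))\<^sup>2 \<le> (A ^ m)\<^sup>2" using A by (intro power_mono power_increasing) auto
    moreover have "vandermonde Z \<le> 2 ^ (m * m)" using vandermonde_le[of Z] Z by (auto simp: \<Z>_def)
    ultimately show ?thesis unfolding W_def using vandermonde_pos[of Z] Z
      by (intro mult_mono) (auto simp: \<Z>_def)
  qed
  then have bdd: "bdd_above (W ` \<Z>)" by (auto simp: bdd_above_def)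
  have W_pos: "W Z > 0" if "Z \<in> \<Z>" for Z
    using that vandermonde_pos[of Z] A by (simp add: W_def \<Z>_def)
  obtain Z0 where "Z0 \<in> \<Z>"
    using infinite_arbitrarily_large[OF infinite_unit_circle, of m] by (auto simp: \<Z>_def)
  then have ne: "W ` \<Z> \<noteq> {}" and "Sup (W ` \<Z>) > 0"
    using W_pos[of Z0] cSUP_upper[OF _ bdd, of Z0] by auto
  then have "Sup (W ` \<Z>) / 4 < Sup (W ` \<Z>)" by simp
  then obtain Z where Z: "Z \<in> \<Z>" and "Sup (W ` \<Z>) / 4 < W Z"
    using less_cSup_iff[OF ne bdd] by auto
  \<comment> \<open>A factor 4 below the supremum suffices, so no maximiser has to exist. Taking
    square roots turns it into the 2 in the bounds.\<close>
  then have max: "W Z' \<le> 4 * W Z" if "Z' \<in> \<Z>" for Z'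
    using cSUP_upper[OF that bdd] by linarith
  have fin: "finite Z" and card: "card Z = m" and unit: "\<And>z. z \<in> Z \<Longrightarrow> cmod z = 1"
    using Z by (auto simp: \<Z>_def)
  have key: "cmod (poly (lagrange_basis Z z) y) * (if y \<in> T then A else 1) \<le> 2 * (if z \<in> T then A else 1)"
    if z: "z \<in> Z" and y: "cmod y = 1" "y \<notin> Z" for z y
  proof -
    let ?Z' = "insert y (Z - {z})" and ?l = "cmod (poly (lagrange_basis Z z) y)"
    let ?R = "(Z - {z}) \<inter> T" and ?y = "if y \<in> T then A else 1" and ?z = "if z \<in> T then A else 1"
    have "card (Z - {z}) = m - 1" using z fin card by simp
    then have "?Z' \<in> \<Z>" using Z z y fin m by (auto simp: \<Z>_def)
    then have "W ?Z' \<le> 4 * W Z" by (rule max)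
    moreover have "A ^ card (?Z' \<inter> T) = A ^ card ?R * ?y"
      using fin y by (auto simp: Int_insert_left)
    moreover have "A ^ card (Z \<inter> T) = A ^ card ?R * ?z"
    proof -
      have "Z \<inter> T = (if z \<in> T then insert z ?R else ?R)" using z by auto
      then show ?thesis using fin by auto
    qed
    ultimately have "vandermonde Z * ?l\<^sup>2 * (A ^ card ?R * ?y)\<^sup>2 \<le> 4 * (vandermonde Z * (A ^ card ?R * ?z)\<^sup>2)"
      unfolding W_def vandermonde_exchange[OF fin z y(2)] by simp
    then have "(vandermonde Z * (A ^ card ?R)\<^sup>2) * (?l * ?y)\<^sup>2 \<le> (vandermonde Z * (A ^ card ?R)\<^sup>2) * (2 * ?z)\<^sup>2"
      by (simp only: power_mult_distrib mult_ac) simp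
    moreover have "vandermonde Z * (A ^ card ?R)\<^sup>2 > 0" using vandermonde_pos[OF fin] A by simp
    ultimately have "(?l * ?y)\<^sup>2 \<le> (2 * ?z)\<^sup>2" by (simp only: mult_le_cancel_left_pos)
    moreover have "0 \<le> 2 * ?z" using A by simp
    ultimately show ?thesis by (rule power2_le_imp_le)
  qed
  have at_node: "cmod (poly (lagrange_basis Z z) y) \<le> 1" if "y \<in> Z" for z y
    using that fin by (cases "y = z") (auto simp: lagrange_basis_self lagrange_basis_other)
  have b1: "cmod (poly (lagrange_basis Z z) y) \<le> 2 * A" if "z \<in> Z" "cmod y = 1" for z y
  proof (cases "y \<in> Z")
    case True
    then show ?thesis using at_node[of y z] A by linarith
  next
    case False
    have "cmod (poly (lagrange_basis Z z) y) * 1 \<le> cmod (poly (lagrange_basis Z z) y) * (if y \<in> T then A else 1)"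
      using A by (intro mult_left_mono) auto
    also have "\<dots> \<le> 2 * (if z \<in> T then A else 1)" by (rule key[OF that False])
    also have "\<dots> \<le> 2 * A" using A by auto
    finally show ?thesis by simp
  qed
  have b2: "cmod (poly (lagrange_basis Z z) y) \<le> 2" if "z \<in> Z - T" "cmod y = 1" for z y
  proof (cases "y \<in> Z")
    case True
    then show ?thesis using at_node[of y z] by linarith
  next
    case False
    have "cmod (poly (lagrange_basis Z z) y) * 1 \<le> cmod (poly (lagrange_basis Z z) y) * (if y \<in> T then A else 1)"
      using A by (intro mult_left_mono) auto
    also have "\<dots> \<le> 2 * (if z \<in> T then A else 1)" using that by (intro key[OF _ _ False]) auto
    finally show ?thesis using that by simp
  qed
  have b3: "cmod (poly (lagrange_basis Z z) y) \<le> 2 / A" if "z \<in> Z - T" "cmod y = 1" "y \<in> T - Z" for z y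
    using key[of z y] that A by (simp add: pos_le_divide_eq)
  have b4: "cmod (poly (lagrange_basis Z z) y) \<le> 2" if "z \<in> Z \<inter> T" "cmod y = 1" "y \<in> T - Z" for z y
    using key[of z y] that A by simp
  have "fekete A T Z" unfolding fekete_def using fin unit b1 b2 b3 b4 by blast
  then show thesis using card that by blast
qed

text \<open>On the unit circle this is the normalised one-sided Dirichlet kernel centred at
  \<open>\<tau>\<close>; one-sided so that it is a polynomial in z.\<close>

definition localizer :: "nat \<Rightarrow> complex \<Rightarrow> complex poly" where
  "localizer q \<tau> = (\<Sum>m<q. monom (cnj \<tau> ^ m / of_nat q) m)"

lemma poly_localizer: "poly (localizer q \<tau>) z = (\<Sum>m<q. (z * cnj \<tau>) ^ m) / of_nat q"
  by (simp add: localizer_def poly_sum poly_monom power_mult_distrib sum_divide_distrib mult.commute)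

lemma degree_localizer: "degree (localizer q \<tau>) \<le> q - 1"
  unfolding localizer_def by (intro degree_sum_le order_trans[OF degree_monom_le]) auto

lemma localizer_le_1:
  assumes "cmod \<tau> = 1" "cmod z = 1"
  shows "cmod (poly (localizer q \<tau>) z) \<le> 1"
proof (cases "q = 0")
  case False
  have "cmod (\<Sum>m<q. (z * cnj \<tau>) ^ m) \<le> (\<Sum>m<q. 1)"
    using assms by (intro sum_norm_le) (simp add: norm_power norm_mult)
  then show ?thesis using False by (simp add: poly_localizer norm_divide)
qed (simp add: poly_localizer)

lemma dist_unit_circle:
  assumes "cmod \<tau> = 1"
  shows "cmod (z * cnj \<tau> - 1) = cmod (z - \<tau>)"
proof -
  have "\<tau> * cnj \<tau> = 1" using assms complex_norm_square[of \<tau>] by simp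
  then have "z * cnj \<tau> - 1 = (z - \<tau>) * cnj \<tau>" by (simp add: algebra_simps)
  then show ?thesis using assms by (simp add: norm_mult)
qed

lemma localizer_decay:
  assumes "cmod \<tau> = 1" "cmod z = 1" "z \<noteq> \<tau>" "q > 0"
  shows "cmod (poly (localizer q \<tau>) z) \<le> 2 / (real q * cmod (z - \<tau>))"
proof -
  let ?w = "z * cnj \<tau>"
  have d: "cmod (?w - 1) = cmod (z - \<tau>)" by (rule dist_unit_circle[OF assms(1)])
  then have w: "?w \<noteq> 1" using assms(3) by auto
  have "(\<Sum>m<q. ?w ^ m) = (?w ^ q - 1) / (?w - 1)" by (rule geometric_sum[OF w])
  then have "cmod (\<Sum>m<q. ?w ^ m) = cmod (?w ^ q - 1) / cmod (z - \<tau>)" by (simp add: norm_divide d)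
  moreover have "cmod (?w ^ q - 1) \<le> 2"
    using norm_triangle_ineq4[of "?w ^ q" 1] assms by (simp add: norm_power norm_mult)
  ultimately have "cmod (\<Sum>m<q. ?w ^ m) \<le> 2 / cmod (z - \<tau>)" by (simp add: divide_right_mono)
  then have "cmod (\<Sum>m<q. ?w ^ m) / real q \<le> 2 / cmod (z - \<tau>) / real q" by (rule divide_right_mono) simp
  then show ?thesis by (simp add: poly_localizer norm_divide mult.commute)
qed

lemma localizer_near:
  assumes "cmod \<tau> = 1" "cmod z = 1" "q > 0"
  shows "1 - real q * cmod (z - \<tau>) \<le> cmod (poly (localizer q \<tau>) z)"
proof -
  let ?w = "z * cnj \<tau>"
  have nw: "cmod ?w = 1" using assms by (simp add: norm_mult)
  have pow: "cmod (?w ^ m - 1) \<le> real m * cmod (z - \<tau>)" for m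
  proof -
    have "cmod (?w ^ m - 1 ^ m) \<le> real m * cmod (?w - 1)"
      by (rule norm_power_diff) (use nw in auto)
    then show ?thesis by (simp add: dist_unit_circle[OF assms(1)])
  qed
  have "cmod (\<Sum>m<q. (?w ^ m - 1)) \<le> (\<Sum>m<q. real q * cmod (z - \<tau>))"
  proof (rule sum_norm_le)
    fix m assume "m \<in> {..<q}"
    then show "cmod (?w ^ m - 1) \<le> real q * cmod (z - \<tau>)"
      by (intro order_trans[OF pow] mult_right_mono) auto
  qed
  then have "cmod ((\<Sum>m<q. ?w ^ m) - of_nat q) \<le> real q * (real q * cmod (z - \<tau>))"
    by (simp add: sum_subtractf)
  moreover have "(\<Sum>m<q. ?w ^ m) - of_nat q = of_nat q * (poly (localizer q \<tau>) z - 1)"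
    using assms(3) by (simp add: poly_localizer algebra_simps)
  ultimately have "real q * cmod (poly (localizer q \<tau>) z - 1) \<le> real q * (real q * cmod (z - \<tau>))"
    by (simp add: norm_mult)
  then have "cmod (poly (localizer q \<tau>) z - 1) \<le> real q * cmod (z - \<tau>)" using assms(3) by simp
  then show ?thesis using norm_triangle_ineq3[of 1 "poly (localizer q \<tau>) z"]
    by (simp add: norm_minus_commute)
qed

definition grid :: "nat \<Rightarrow> nat \<Rightarrow> complex" where
  "grid K b = cis (2 * pi * real b / real K)"

lemma norm_grid [simp]: "cmod (grid K b) = 1"
  by (simp add: grid_def)

lemma sum_roots_of_unity:
  assumes "m < K" "m' < K" "m \<noteq> m'"
  shows "(\<Sum>b<K. (cnj (grid K b) ^ m) * (grid K b ^ m')) = 0"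
proof -
  let ?\<zeta> = "cnj (grid K m) * grid K m'"
  have "cnj (grid K b) ^ m * grid K b ^ m' = ?\<zeta> ^ b" for b
  proof -
    have "grid K b ^ j = grid K j ^ b" for j
      unfolding grid_def Complex.DeMoivre by (rule arg_cong[of _ _ cis]) (simp add: field_simps)
    then show ?thesis by (simp add: power_mult_distrib flip: complex_cnj_power)
  qed
  then have eq: "(\<Sum>b<K. (cnj (grid K b) ^ m) * (grid K b ^ m')) = (\<Sum>b<K. ?\<zeta> ^ b)" by simp
  have "grid K m \<noteq> grid K m'"
    using Complex.bij_betw_roots_unity[of K] assms by (auto simp: bij_betw_def inj_on_def grid_def)
  moreover have "grid K m * cnj (grid K m) = 1" by (simp add: grid_def cis_cnj cis_mult)
  ultimately have ne: "?\<zeta> \<noteq> 1"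
    by (metis mult.assoc mult.commute mult.left_neutral)
  have "grid K j ^ K = 1" for j
  proof -
    have "grid K j ^ K = cis (2 * pi * real j)" using assms by (simp add: grid_def Complex.DeMoivre)
    then show ?thesis by (simp add: cis_multiple_2pi Ints_of_nat)
  qed
  then have "?\<zeta> ^ K = 1" by (simp add: power_mult_distrib flip: complex_cnj_power)
  then show ?thesis unfolding eq using geometric_sum[OF ne, of K] by simp
qed

text \<open>Parseval on the grid: all exponents are below \<open>q \<le> K\<close>, so distinct ones
  are orthogonal over the \<open>K\<close>-th roots of unity and only the \<open>q\<close> diagonal
  terms survive.\<close>

lemma sum_localizer_grid:
  assumes q: "q > 0" "q \<le> K" and z: "cmod z = 1"
  shows "(\<Sum>b<K. (cmod (poly (localizer q (grid K b)) z))\<^sup>2) = real K / real q"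
proof -
  have zz: "z * cnj z = 1" using z complex_norm_square[of z] by simp
  have sq: "complex_of_real ((cmod (poly (localizer q (grid K b)) z))\<^sup>2)
      = (\<Sum>m<q. \<Sum>m'<q. z ^ m * cnj z ^ m' * (cnj (grid K b) ^ m * grid K b ^ m')) / (of_nat q)\<^sup>2" for b
  proof -
    let ?w = "z * cnj (grid K b)"
    have "complex_of_real ((cmod (poly (localizer q (grid K b)) z))\<^sup>2)
        = (\<Sum>m<q. ?w ^ m) / of_nat q * cnj ((\<Sum>m<q. ?w ^ m) / of_nat q)"
      by (simp only: complex_norm_square poly_localizer)
    also have "\<dots> = (\<Sum>m<q. ?w ^ m) * (\<Sum>m'<q. cnj ?w ^ m') / (of_nat q)\<^sup>2"
      by (simp add: power2_eq_square)
    also have "(\<Sum>m<q. ?w ^ m) * (\<Sum>m'<q. cnj ?w ^ m') = (\<Sum>m<q. \<Sum>m'<q. ?w ^ m * cnj ?w ^ m')"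
      by (rule sum_product)
    finally show ?thesis by (simp add: power_mult_distrib mult_ac)
  qed
  have inner: "(\<Sum>b<K. z ^ m * cnj z ^ m' * (cnj (grid K b) ^ m * grid K b ^ m')) = (if m = m' then of_nat K else 0)"
    if "m < q" "m' < q" for m m'
  proof (cases "m = m'")
    case True
    have "cnj (grid K b) * grid K b = 1" for b by (simp add: grid_def cis_cnj cis_mult)
    then have "z ^ m * cnj z ^ m * (cnj (grid K b) ^ m * grid K b ^ m) = 1" for b
      using zz by (simp flip: power_mult_distrib)
    then show ?thesis using True by simp
  next
    case False
    then show ?thesis using sum_roots_of_unity[of m K m'] that q by (simp flip: sum_distrib_left)
  qed
  have "complex_of_real (\<Sum>b<K. (cmod (poly (localizer q (grid K b)) z))\<^sup>2)
      = (\<Sum>b<K. \<Sum>m<q. \<Sum>m'<q. z ^ m * cnj z ^ m' * (cnj (grid K b) ^ m * grid K b ^ m')) / (of_nat q)\<^sup>2"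
    by (simp only: of_real_sum sq sum_divide_distrib)
  also have "(\<Sum>b<K. \<Sum>m<q. \<Sum>m'<q. z ^ m * cnj z ^ m' * (cnj (grid K b) ^ m * grid K b ^ m'))
      = (\<Sum>m<q. \<Sum>m'<q. \<Sum>b<K. z ^ m * cnj z ^ m' * (cnj (grid K b) ^ m * grid K b ^ m'))"
    by (subst sum.swap) (intro sum.cong refl sum.swap)
  also have "\<dots> = (\<Sum>m<q. \<Sum>m'<q. if m = m' then of_nat K else 0)"
    by (intro sum.cong refl inner) auto
  also have "\<dots> = of_nat q * of_nat K" by simp
  also have "\<dots> / (of_nat q)\<^sup>2 = complex_of_real (real K / real q)"
    using q by (simp add: power2_eq_square)
  finally show ?thesis by (simp only: of_real_eq_iff)
qed

section \<open>A logarithmic lower bound\<close>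

lemma sum_powers_of_two_le:
  fixes X :: real
  assumes "finite S" and "\<And>l. l \<in> S \<Longrightarrow> 2 ^ l \<le> X" and "X \<ge> 0"
  shows "(\<Sum>l\<in>S. 2 ^ l) \<le> 2 * X"
proof (cases "S = {}")
  case False
  have "(\<Sum>l\<in>S. (2::real) ^ l) \<le> (\<Sum>l\<in>{..<Suc (Max S)}. 2 ^ l)"
    using assms(1) by (intro sum_mono2) (auto simp: less_Suc_eq_le)
  also have "\<dots> = 2 ^ Suc (Max S) - 1" by (simp add: geometric_sum)
  also have "\<dots> \<le> 2 * X" using assms(2)[of "Max S"] Max_in[OF assms(1) False] by simp
  finally show ?thesis .
qed (use assms in auto)

text \<open>Cauchy-Schwarz for the numbers of elements in the \<open>m\<close> cells.\<close>

lemma card_pairs_same_cell: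
  assumes fin: "finite U" and f: "\<And>i. i \<in> U \<Longrightarrow> f i < m"
  shows "(real (card U))\<^sup>2 \<le> real m * (\<Sum>i\<in>U. \<Sum>j\<in>U. if f i = f j then 1 else 0)"
proof -
  let ?n = "\<lambda>c. real (card {i \<in> U. f i = c})"
  have sumf: "(\<Sum>i\<in>U. g (f i)) = (\<Sum>c<m. ?n c * g c)" for g :: "nat \<Rightarrow> real"
  proof -
    have "(\<Sum>c<m. ?n c * g c) = (\<Sum>c<m. \<Sum>i\<in>{i \<in> U. f i = c}. g (f i))" by simp
    also have "\<dots> = (\<Sum>i\<in>U. g (f i))" using f fin by (intro sum.group) auto
    finally show ?thesis ..
  qed
  have "real (card U) = (\<Sum>c<m. ?n c)" using sumf[of "\<lambda>_. 1"] by simp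
  then have "(real (card U))\<^sup>2 \<le> (\<Sum>c<m. (?n c)\<^sup>2) * real m"
    using sum_squared_le_sum_of_squares[of ?n "{..<m}"] by simp
  also have "(\<Sum>c<m. (?n c)\<^sup>2) = (\<Sum>i\<in>U. ?n (f i))"
    using sumf[of ?n] by (simp add: power2_eq_square)
  also have "\<dots> = (\<Sum>i\<in>U. \<Sum>j\<in>U. if f i = f j then 1 else 0)"
    using fin by (intro sum.cong refl) (simp add: sum.If_cases Int_def eq_commute)
  finally show ?thesis by (simp add: mult.commute)
qed

text \<open>The kernel dominates a sum over \<open>L + 1\<close> dyadic scales: the numbers
  \<open>2 ^ l\<close> over the scales with \<open>|u i - u j| < \<Delta> / 2 ^ l\<close> add up to
  at most \<open>4 * M * \<Delta>\<close> times the kernel. The assumption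
  \<open>2 ^ L \<le> M * \<Delta>\<close> keeps the finest scale above \<open>1 / M\<close>. At each
  scale, cutting the interval into \<open>2 ^ l\<close> pieces and Cauchy-Schwarz give many close
  pairs, and every scale contributes about the same amount; this is the logarithm.\<close>

lemma log_energy:
  fixes u :: "'a \<Rightarrow> real" and M \<Delta> a :: real
  assumes fin: "finite U" and u: "\<And>i. i \<in> U \<Longrightarrow> a \<le> u i \<and> u i < a + \<Delta>"
    and M: "M > 0" and \<Delta>: "\<Delta> > 0" and L: "2 ^ L \<le> M * \<Delta>"
  shows "((real L + 1) * (real (card U))\<^sup>2 - real (card U) * 2 ^ (L + 1)) / (4 * M * \<Delta>)
    \<le> (\<Sum>i\<in>U. \<Sum>j\<in>U - {i}. 1 / (1 + M * \<bar>u i - u j\<bar>))"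
proof -
  define g where "g = real (card U)"
  define near where "near = (\<lambda>l i j. if \<bar>u i - u j\<bar> < \<Delta> / 2 ^ l then 1 else 0 :: real)"
  have pointwise: "(\<Sum>l\<le>L. 2 ^ l * near l i j) \<le> (4 * M * \<Delta>) * (1 / (1 + M * \<bar>u i - u j\<bar>))" for i j
  proof -
    let ?d = "\<bar>u i - u j\<bar>" and ?S = "{l \<in> {..L}. \<bar>u i - u j\<bar> < \<Delta> / 2 ^ l}"
    have pos: "1 + M * ?d > 0" using M by (simp add: add_pos_nonneg)
    have "(\<Sum>l\<le>L. 2 ^ l * near l i j) = (\<Sum>l\<in>?S. 2 ^ l)"
      unfolding near_def by (intro sum.mono_neutral_cong_right) auto
    also have "\<dots> \<le> 2 * (2 * M * \<Delta> / (1 + M * ?d))"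
    proof (rule sum_powers_of_two_le)
      fix l assume l: "l \<in> ?S"
      have "(2::real) ^ l \<le> 2 ^ L" using l by (intro power_increasing) auto
      then have "(2::real) ^ l \<le> M * \<Delta>" using L by linarith
      moreover have "2 ^ l * ?d \<le> \<Delta>" using l by (simp add: field_simps)
      then have "M * (2 ^ l * ?d) \<le> M * \<Delta>" using M by (intro mult_left_mono) auto
      moreover have "2 ^ l * (1 + M * ?d) = 2 ^ l + M * (2 ^ l * ?d)" by (simp add: algebra_simps)
      ultimately have "2 ^ l * (1 + M * ?d) \<le> 2 * M * \<Delta>" by linarith
      then show "2 ^ l \<le> 2 * M * \<Delta> / (1 + M * ?d)" using pos by (simp add: pos_le_divide_eq)
    qed (use M \<Delta> pos in auto)
    finally show ?thesis by simp
  qed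
  have count: "g\<^sup>2 - 2 ^ l * g \<le> 2 ^ l * (\<Sum>i\<in>U. \<Sum>j\<in>U - {i}. near l i j)" for l
  proof -
    define f where "f = (\<lambda>i. nat \<lfloor>(u i - a) * 2 ^ l / \<Delta>\<rfloor>)"
    have f: "real (f i) \<le> (u i - a) * 2 ^ l / \<Delta> \<and> (u i - a) * 2 ^ l / \<Delta> < real (f i) + 1" if "i \<in> U" for i
    proof -
      have "0 \<le> (u i - a) * 2 ^ l / \<Delta>" using u[OF that] \<Delta> by simp
      then show ?thesis unfolding f_def by linarith
    qed
    have "f i < 2 ^ l" if i: "i \<in> U" for i
    proof -
      have "(u i - a) * 2 ^ l < \<Delta> * 2 ^ l" using u[OF i] by (intro mult_strict_right_mono) auto
      then have "(u i - a) * 2 ^ l / \<Delta> < 2 ^ l" using \<Delta> by (simp add: divide_less_eq mult.commute)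
      then have "real (f i) < 2 ^ l" using f[OF i] by linarith
      then show ?thesis by (metis of_nat_less_iff of_nat_numeral of_nat_power)
    qed
    then have "g\<^sup>2 \<le> real (2 ^ l) * (\<Sum>i\<in>U. \<Sum>j\<in>U. if f i = f j then 1 else 0)"
      unfolding g_def by (intro card_pairs_same_cell fin)
    also have "\<dots> \<le> real (2 ^ l) * (\<Sum>i\<in>U. \<Sum>j\<in>U. near l i j)"
    proof (intro mult_left_mono sum_mono)
      fix i j assume ij: "i \<in> U" "j \<in> U"
      have "\<bar>u i - u j\<bar> < \<Delta> / 2 ^ l" if "f i = f j"
      proof -
        have "\<bar>(u i - a) * 2 ^ l / \<Delta> - (u j - a) * 2 ^ l / \<Delta>\<bar> < 1"
          using f[OF ij(1)] f[OF ij(2)] that by linarith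
        moreover have "(u i - a) * 2 ^ l / \<Delta> - (u j - a) * 2 ^ l / \<Delta> = (u i - u j) * (2 ^ l / \<Delta>)"
          by (simp add: diff_divide_distrib left_diff_distrib)
        ultimately have "\<bar>u i - u j\<bar> * (2 ^ l / \<Delta>) < 1" using \<Delta> by (simp add: abs_mult)
        then show ?thesis using \<Delta> by (simp add: field_simps)
      qed
      then show "(if f i = f j then 1 else 0) \<le> near l i j" by (auto simp: near_def)
    qed simp
    also have "(\<Sum>i\<in>U. \<Sum>j\<in>U. near l i j) = (\<Sum>i\<in>U. 1 + (\<Sum>j\<in>U - {i}. near l i j))"
      using fin \<Delta> by (intro sum.cong refl) (simp add: sum.remove near_def)
    also have "\<dots> = g + (\<Sum>i\<in>U. \<Sum>j\<in>U - {i}. near l i j)" by (simp add: sum.distrib g_def)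
    finally show ?thesis by (simp add: algebra_simps)
  qed
  have "(real L + 1) * g\<^sup>2 - g * 2 ^ (L + 1) \<le> (real L + 1) * g\<^sup>2 - g * (2 ^ Suc L - 1)"
    by (simp add: g_def algebra_simps)
  also have "\<dots> = (\<Sum>l\<le>L. g\<^sup>2 - 2 ^ l * g)"
  proof -
    have "(\<Sum>l\<le>L. (2::real) ^ l) = 2 ^ Suc L - 1"
      by (simp add: geometric_sum flip: lessThan_Suc_atMost)
    then show ?thesis by (simp add: sum_subtractf mult.commute flip: sum_distrib_left)
  qed
  also have "\<dots> \<le> (\<Sum>l\<le>L. 2 ^ l * (\<Sum>i\<in>U. \<Sum>j\<in>U - {i}. near l i j))"
    by (intro sum_mono count)
  also have "\<dots> = (\<Sum>i\<in>U. \<Sum>j\<in>U - {i}. \<Sum>l\<le>L. 2 ^ l * near l i j)"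
    unfolding sum_distrib_left by (subst sum.swap) (intro sum.cong refl sum.swap)
  also have "\<dots> \<le> (\<Sum>i\<in>U. \<Sum>j\<in>U - {i}. (4 * M * \<Delta>) * (1 / (1 + M * \<bar>u i - u j\<bar>)))"
    by (intro sum_mono pointwise)
  also have "\<dots> = (4 * M * \<Delta>) * (\<Sum>i\<in>U. \<Sum>j\<in>U - {i}. 1 / (1 + M * \<bar>u i - u j\<bar>))"
    by (simp only: sum_distrib_left)
  finally show ?thesis using M \<Delta> unfolding g_def by (simp add: pos_divide_le_eq mult.commute)
qed

section \<open>Lagrange polynomials of the nodes in one cell\<close>

lemma norm_cis_diff_le: "cmod (cis a - cis b) \<le> \<bar>a - b\<bar>"
proof -
  have "cis a - cis b = cis b * (cis (a - b) - 1)" by (simp add: cis_mult right_diff_distrib)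
  then have "cmod (cis a - cis b) = cmod (exp (\<i> * of_real (a - b)) - 1)"
    by (simp add: norm_mult cis_conv_exp)
  also have "\<dots> = 2 * \<bar>sin ((a - b) / 2)\<bar>" by (rule dist_exp_i_1)
  also have "\<dots> \<le> \<bar>a - b\<bar>" using abs_sin_x_le_abs_x[of "(a - b) / 2"] by simp
  finally show ?thesis .
qed

lemma sgn_cnj_mult: "sgn (cnj w) * w = complex_of_real (cmod w)"
proof (cases "w = 0")
  case False
  have "sgn (cnj w) * w = (w * cnj w) / of_real (cmod w)"
    by (simp add: sgn_div_norm scaleR_conv_of_real divide_inverse mult_ac)
  also have "\<dots> = of_real ((cmod w)\<^sup>2) / of_real (cmod w)" by (simp only: complex_norm_square)
  finally show ?thesis using False by (simp add: power2_eq_square)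
qed simp

text \<open>The data are complex here, unlike in \<open>interpolable\<close>, since phases of
  Lagrange polynomials will be prescribed.\<close>

definition circle_interpolable :: "nat \<Rightarrow> real \<Rightarrow> complex set \<Rightarrow> bool" where
  "circle_interpolable M0 H S \<longleftrightarrow>
     (\<forall>v. (\<forall>z\<in>S. cmod (v z) \<le> 1) \<longrightarrow>
        (\<exists>F. degree F \<le> M0 \<and> (\<forall>w. cmod w = 1 \<longrightarrow> cmod (poly F w) \<le> H) \<and> (\<forall>z\<in>S. poly F z = v z)))"

lemma degree_localized:
  assumes "degree F \<le> M0" "M0 + 4 * (q - 1) \<le> M"
  shows "degree (F * localizer q \<tau> ^ 4) \<le> M"
proof -
  have "degree (localizer q \<tau> ^ 4) \<le> (q - 1) * 4"
    by (intro order_trans[OF degree_power_le] mult_right_mono degree_localizer) auto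
  then show ?thesis using degree_mult_le[of F "localizer q \<tau> ^ 4"] assms by linarith
qed

lemma localizer_near_quarter:
  assumes "cmod \<tau> = 1" "cmod z = 1" "q > 0" "cmod (z - \<tau>) \<le> 1 / (4 * real q)"
  shows "1 / 4 \<le> cmod (poly (localizer q \<tau>) z) ^ 4"
proof -
  have "real q * cmod (z - \<tau>) \<le> 1 / 4" using assms(3,4) by (simp add: field_simps)
  then have "3 / 4 \<le> cmod (poly (localizer q \<tau>) z)" using localizer_near[OF assms(1,2,3)] by linarith
  then have "(3 / 4) ^ 4 \<le> cmod (poly (localizer q \<tau>) z) ^ 4" by (intro power_mono) auto
  then show ?thesis by (simp add: power_divide)
qed

text \<open>Interpolate 1 at \<open>t\<close> and 0 on the rest of \<open>S\<close>, localize at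
  \<open>\<tau>\<close>, and expand the value at \<open>t\<close> in the basis of \<open>Z\<close>.
  The nodes in \<open>S\<close> drop out because \<open>t\<close> is not one of them, so a value of
  at least 1/4 must come from points outside \<open>T\<close>, damped by \<open>A\<close>, or from
  nodes of \<open>T\<close> outside \<open>S\<close>, where the localizer has to be small. Hence few
  cells can lose a node.\<close>

lemma missing_node:
  assumes fek: "fekete A T Z" and card: "card Z = M + 1" and A: "A \<ge> 1" and H: "H \<ge> 0"
    and q: "q > 0" and M: "M0 + 4 * (q - 1) \<le> M" and \<tau>: "cmod \<tau> = 1"
    and S: "S \<subseteq> T" and interp: "circle_interpolable M0 H S"
    and t: "t \<in> S" "t \<notin> Z" "cmod t = 1" and near: "cmod (t - \<tau>) \<le> 1 / (4 * real q)"
  shows "1 / 4 \<le> 2 * H / A * (\<Sum>z\<in>Z - T. cmod (poly (localizer q \<tau>) z) ^ 2)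
    + 2 * H * (\<Sum>z\<in>Z \<inter> T - S. cmod (poly (localizer q \<tau>) z) ^ 4)"
proof -
  have fin: "finite Z" and unit: "\<And>z. z \<in> Z \<Longrightarrow> cmod z = 1" using fek by (auto simp: fekete_def)
  let ?\<phi> = "\<lambda>z. cmod (poly (localizer q \<tau>) z)" and ?l = "\<lambda>z. poly (lagrange_basis Z z) t"
  have tT: "t \<in> T - Z" using t S by auto
  obtain F where F: "degree F \<le> M0" "\<And>w. cmod w = 1 \<Longrightarrow> cmod (poly F w) \<le> H"
    "\<And>z. z \<in> S \<Longrightarrow> poly F z = (if z = t then 1 else 0)"
    using interp unfolding circle_interpolable_def by (elim allE[of _ "\<lambda>z. if z = t then 1 else 0"]) auto
  let ?G = "F * localizer q \<tau> ^ 4"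
  have Gle: "cmod (poly ?G z) \<le> H * ?\<phi> z ^ 4" if "cmod z = 1" for z
    using F(2)[OF that] by (simp add: norm_mult norm_power mult_right_mono)
  have "degree ?G < card Z" using degree_localized[OF F(1) M] card by (simp add: le_imp_less_Suc)
  then have "poly ?G t = (\<Sum>z\<in>Z. poly ?G z * ?l z)" by (rule lagrange_interpolation[OF fin])
  also have "\<dots> = (\<Sum>z\<in>(Z - T) \<union> (Z \<inter> T - S). poly ?G z * ?l z)"
    using fin F(3) t S by (intro sum.mono_neutral_right) auto
  also have "\<dots> = (\<Sum>z\<in>Z - T. poly ?G z * ?l z) + (\<Sum>z\<in>Z \<inter> T - S. poly ?G z * ?l z)"
    using fin by (intro sum.union_disjoint) auto
  finally have "cmod (poly ?G t) \<le> cmod (\<Sum>z\<in>Z - T. poly ?G z * ?l z) + cmod (\<Sum>z\<in>Z \<inter> T - S. poly ?G z * ?l z)"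
    by (simp only: norm_triangle_ineq)
  moreover have "cmod (\<Sum>z\<in>Z - T. poly ?G z * ?l z) \<le> (\<Sum>z\<in>Z - T. 2 * H / A * ?\<phi> z ^ 2)"
  proof (rule sum_norm_le)
    fix z assume z: "z \<in> Z - T"
    then have "?\<phi> z ^ 4 \<le> ?\<phi> z ^ 2" using unit \<tau> by (intro power_decreasing localizer_le_1) auto
    then have "cmod (poly ?G z) \<le> H * ?\<phi> z ^ 2"
      using Gle[of z] unit[of z] z H by (meson DiffD1 mult_left_mono order_trans)
    moreover have "cmod (?l z) \<le> 2 / A" using fek z tT t by (auto simp: fekete_def)
    ultimately have "cmod (poly ?G z) * cmod (?l z) \<le> (H * ?\<phi> z ^ 2) * (2 / A)"
      using H by (intro mult_mono) auto
    then show "cmod (poly ?G z * ?l z) \<le> 2 * H / A * ?\<phi> z ^ 2" by (simp add: norm_mult mult_ac)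
  qed
  moreover have "cmod (\<Sum>z\<in>Z \<inter> T - S. poly ?G z * ?l z) \<le> (\<Sum>z\<in>Z \<inter> T - S. 2 * H * ?\<phi> z ^ 4)"
  proof (rule sum_norm_le)
    fix z assume z: "z \<in> Z \<inter> T - S"
    have "cmod (?l z) \<le> 2" using fek z tT t by (auto simp: fekete_def)
    then have "cmod (poly ?G z) * cmod (?l z) \<le> (H * ?\<phi> z ^ 4) * 2"
      using H Gle[of z] unit[of z] z by (intro mult_mono) auto
    then show "cmod (poly ?G z * ?l z) \<le> 2 * H * ?\<phi> z ^ 4" by (simp add: norm_mult mult_ac)
  qed
  moreover have "1 / 4 \<le> cmod (poly ?G t)"
    using localizer_near_quarter[OF \<tau> t(3) q near] F(3)[OF t(1)] by (simp add: norm_power)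
  ultimately show ?thesis by (simp add: sum_distrib_left)
qed

text \<open>Prescribing on \<open>S\<close> the phases that make all terms of the Lagrange expansion
  at \<open>y\<close> nonnegative turns the expansion into the sum of absolute values. It equals the
  value at \<open>y\<close>, at most e \<open>H\<close>, minus the terms of nodes outside
  \<open>S\<close>. On \<open>D\<close> the localizer's fourth power is at least 1/4.\<close>

lemma cell_lagrange_sum:
  assumes fek: "fekete A T Z" and card: "card Z = M + 1" and A: "A \<ge> 1" and H: "H \<ge> 0" and M0: "M > 0"
    and q: "q > 0" and M: "M0 + 4 * (q - 1) \<le> M" and \<tau>: "cmod \<tau> = 1"
    and S: "S \<subseteq> T" and interp: "circle_interpolable M0 H S"
    and D: "D \<subseteq> Z \<inter> S" and near: "\<And>z. z \<in> D \<Longrightarrow> cmod (z - \<tau>) \<le> 1 / (4 * real q)"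
    and y: "cmod y \<le> 1 + 1 / real M"
  shows "(\<Sum>z\<in>D. cmod (poly (lagrange_basis Z z) y)) / 4
    \<le> exp 1 * H * (1 + 2 * (\<Sum>z\<in>Z - T. cmod (poly (localizer q \<tau>) z) ^ 2)
      + 2 * A * (\<Sum>z\<in>Z \<inter> T - S. cmod (poly (localizer q \<tau>) z) ^ 4))"
proof -
  have fin: "finite Z" and unit: "\<And>z. z \<in> Z \<Longrightarrow> cmod z = 1" using fek by (auto simp: fekete_def)
  let ?\<phi> = "\<lambda>z. cmod (poly (localizer q \<tau>) z)" and ?l = "\<lambda>z. poly (lagrange_basis Z z) y"
  let ?w = "\<lambda>z. poly (localizer q \<tau>) z ^ 4 * ?l z"
  define v where "v = (\<lambda>z. if z \<in> Z then sgn (cnj (?w z)) else 0)"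
  have "\<forall>z\<in>S. cmod (v z) \<le> 1" by (simp add: v_def norm_sgn)
  then obtain F where F: "degree F \<le> M0" "\<And>w. cmod w = 1 \<Longrightarrow> cmod (poly F w) \<le> H"
    "\<And>z. z \<in> S \<Longrightarrow> poly F z = v z"
    using interp unfolding circle_interpolable_def by blast
  let ?G = "F * localizer q \<tau> ^ 4"
  have Gle: "cmod (poly ?G z) \<le> H * ?\<phi> z ^ 4" if "cmod z = 1" for z
    using F(2)[OF that] by (simp add: norm_mult norm_power mult_right_mono)
  have deg: "degree ?G \<le> M" by (rule degree_localized[OF F(1) M])
  have Gy: "cmod (poly ?G y) \<le> exp 1 * H"
  proof (rule poly_growth_near_disc[OF _ deg M0 y])
    fix w :: complex assume w: "cmod w = 1"
    have "H * ?\<phi> w ^ 4 \<le> H * 1" using H localizer_le_1[OF \<tau> w] by (intro mult_left_mono power_le_one) auto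
    then show "cmod (poly ?G w) \<le> H" using Gle[OF w] by simp
  qed
  have l_growth: "cmod (?l z) \<le> exp 1 * B"
    if "z \<in> Z" "\<And>u. cmod u = 1 \<Longrightarrow> cmod (poly (lagrange_basis Z z) u) \<le> B" for z B
    using poly_growth_near_disc[OF that(2) _ M0 y] degree_lagrange_basis[OF fin that(1)] card by simp
  have "degree ?G < card Z" using deg card by simp
  then have "poly ?G y = (\<Sum>z\<in>Z. poly ?G z * ?l z)" by (rule lagrange_interpolation[OF fin])
  also have "\<dots> = (\<Sum>z\<in>(Z \<inter> S) \<union> ((Z - T) \<union> (Z \<inter> T - S)). poly ?G z * ?l z)"
    using S by (intro sum.cong) auto
  also have "\<dots>
      = (\<Sum>z\<in>Z \<inter> S. poly ?G z * ?l z) + ((\<Sum>z\<in>Z - T. poly ?G z * ?l z) + (\<Sum>z\<in>Z \<inter> T - S. poly ?G z * ?l z))"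
    using fin S by (subst sum.union_disjoint) (auto intro!: sum.union_disjoint)
  finally have split: "(\<Sum>z\<in>Z \<inter> S. poly ?G z * ?l z) = poly ?G y
      - ((\<Sum>z\<in>Z - T. poly ?G z * ?l z) + (\<Sum>z\<in>Z \<inter> T - S. poly ?G z * ?l z))" by simp
  have "(\<Sum>z\<in>Z \<inter> S. poly ?G z * ?l z) = (\<Sum>z\<in>Z \<inter> S. of_real (cmod (?w z)))"
  proof (intro sum.cong refl)
    fix z assume z: "z \<in> Z \<inter> S"
    have "poly ?G z * ?l z = v z * ?w z" using F(3) z by (simp add: mult_ac)
    also have "v z * ?w z = sgn (cnj (?w z)) * ?w z" using z by (simp add: v_def)
    also have "\<dots> = of_real (cmod (?w z))" by (rule sgn_cnj_mult)
    finally show "poly ?G z * ?l z = of_real (cmod (?w z))" .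
  qed
  then have eq: "cmod (\<Sum>z\<in>Z \<inter> S. poly ?G z * ?l z) = (\<Sum>z\<in>Z \<inter> S. cmod (?w z))"
    by (simp add: sum_nonneg flip: of_real_sum)
  have "(\<Sum>z\<in>D. cmod (?l z)) / 4 = (\<Sum>z\<in>D. 1 / 4 * cmod (?l z))"
    by (simp add: sum_divide_distrib)
  also have "\<dots> \<le> (\<Sum>z\<in>D. cmod (?w z))"
  proof (rule sum_mono)
    fix z assume z: "z \<in> D"
    have "1 / 4 \<le> ?\<phi> z ^ 4" using unit D z near q \<tau> by (intro localizer_near_quarter) auto
    then show "1 / 4 * cmod (?l z) \<le> cmod (?w z)" unfolding norm_mult norm_power by (rule mult_right_mono) simp
  qed
  also have "\<dots> \<le> (\<Sum>z\<in>Z \<inter> S. cmod (?w z))" using fin D by (intro sum_mono2) auto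
  also have "\<dots> \<le> exp 1 * H + (cmod (\<Sum>z\<in>Z - T. poly ?G z * ?l z) + cmod (\<Sum>z\<in>Z \<inter> T - S. poly ?G z * ?l z))"
    unfolding eq[symmetric] split
    by (intro order_trans[OF norm_triangle_ineq4] add_mono Gy norm_triangle_ineq)
  also have "cmod (\<Sum>z\<in>Z - T. poly ?G z * ?l z) \<le> (\<Sum>z\<in>Z - T. exp 1 * H * (2 * ?\<phi> z ^ 2))"
  proof (rule sum_norm_le)
    fix z assume z: "z \<in> Z - T"
    then have "?\<phi> z ^ 4 \<le> ?\<phi> z ^ 2" using unit \<tau> by (intro power_decreasing localizer_le_1) auto
    then have "cmod (poly ?G z) \<le> H * ?\<phi> z ^ 2"
      using Gle[of z] unit[of z] z H by (meson DiffD1 mult_left_mono order_trans)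
    moreover have "cmod (?l z) \<le> exp 1 * 2" using fek z by (intro l_growth) (auto simp: fekete_def)
    ultimately have "cmod (poly ?G z) * cmod (?l z) \<le> (H * ?\<phi> z ^ 2) * (exp 1 * 2)"
      using H by (intro mult_mono) auto
    then show "cmod (poly ?G z * ?l z) \<le> exp 1 * H * (2 * ?\<phi> z ^ 2)" by (simp add: norm_mult mult_ac)
  qed
  also have "cmod (\<Sum>z\<in>Z \<inter> T - S. poly ?G z * ?l z) \<le> (\<Sum>z\<in>Z \<inter> T - S. exp 1 * H * (2 * A * ?\<phi> z ^ 4))"
  proof (rule sum_norm_le)
    fix z assume z: "z \<in> Z \<inter> T - S"
    have "cmod (?l z) \<le> exp 1 * (2 * A)" using fek z by (intro l_growth) (auto simp: fekete_def)
    then have "cmod (poly ?G z) * cmod (?l z) \<le> (H * ?\<phi> z ^ 4) * (exp 1 * (2 * A))"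
      using H Gle[of z] unit[of z] z by (intro mult_mono) auto
    then show "cmod (poly ?G z * ?l z) \<le> exp 1 * H * (2 * A * ?\<phi> z ^ 4)" by (simp add: norm_mult mult_ac)
  qed
  finally show ?thesis by (simp add: distrib_left add.assoc flip: sum_distrib_left)
qed

text \<open>Erdos' trick: the unknown derivatives of the node polynomial at \<open>i\<close> and \<open>j\<close> cancel in the
  product of the two values on the right, which AM-GM turns into a bound for their sum.\<close>

lemma lagrange_basis_pair:
  assumes fin: "finite Z" and ij: "i \<in> Z" "j \<in> Z" "i \<noteq> j" and M: "M > 0"
    and yi: "cmod (yi - i) = 1 / M" "1 \<le> cmod (poly (lagrange_basis Z i) yi)"
    and yj: "cmod (yj - j) = 1 / M" "1 \<le> cmod (poly (lagrange_basis Z j) yj)"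
  shows "2 / (1 + M * cmod (i - j)) \<le> cmod (poly (lagrange_basis Z i) yj) + cmod (poly (lagrange_basis Z j) yi)"
proof -
  let ?l = "\<lambda>i y. cmod (poly (lagrange_basis Z i) y)"
  \<comment> \<open>For a node \<open>z\<close>, \<open>d z\<close> is the modulus of the derivative
    of the node polynomial at \<open>z\<close>, and \<open>s y\<close> is the modulus of the node
    polynomial at \<open>y\<close>.\<close>
  define d where "d = (\<lambda>z. \<Prod>u\<in>Z - {z}. cmod (z - u))"
  define s where "s = (\<lambda>y. \<Prod>u\<in>Z. cmod (y - u))"
  have d0: "d z > 0" for z unfolding d_def by (intro prod_pos) auto
  have rel: "?l z y * cmod (y - z) * d z = s y" if "z \<in> Z" for z y
  proof -
    have "?l z y * d z = (\<Prod>u\<in>Z - {z}. cmod (y - u))"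
      unfolding poly_lagrange_basis d_def prod_norm[symmetric] prod.distrib[symmetric] norm_divide
      by (intro prod.cong refl) auto
    then show ?thesis unfolding s_def using that fin by (simp add: prod.remove mult_ac)
  qed
  define r where "r = cmod (i - j) + 1 / M"
  have r: "r > 0" using M by (simp add: r_def add_nonneg_pos)
  have dist: "cmod (yj - i) \<le> r" "cmod (yi - j) \<le> r"
    using norm_triangle_ineq[of "yj - j" "j - i"] norm_triangle_ineq[of "yi - i" "i - j"] yi(1) yj(1)
    by (simp_all add: r_def norm_minus_commute)
  have "?l i yj * cmod (yj - i) * d i = ?l j yj * (1 / M) * d j"
    using rel[OF ij(1), of yj] rel[OF ij(2), of yj] yj(1) by simp
  moreover have "1 * (1 / M) * d j \<le> ?l j yj * (1 / M) * d j"
    using yj(2) M d0[of j] by (intro mult_right_mono) auto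
  moreover have "?l i yj * cmod (yj - i) * d i \<le> ?l i yj * r * d i"
    using dist d0[of i] by (intro mult_right_mono mult_left_mono) auto
  ultimately have 1: "1 / M * d j \<le> ?l i yj * r * d i" by linarith
  have "?l j yi * cmod (yi - j) * d j = ?l i yi * (1 / M) * d i"
    using rel[OF ij(1), of yi] rel[OF ij(2), of yi] yi(1) by simp
  moreover have "1 * (1 / M) * d i \<le> ?l i yi * (1 / M) * d i"
    using yi(2) M d0[of i] by (intro mult_right_mono) auto
  moreover have "?l j yi * cmod (yi - j) * d j \<le> ?l j yi * r * d j"
    using dist d0[of j] by (intro mult_right_mono mult_left_mono) auto
  ultimately have 2: "1 / M * d i \<le> ?l j yi * r * d j" by linarith
  define c where "c = d i / d j"
  define p where "p = 1 / (1 + M * cmod (i - j))"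
  have c0: "c > 0" using d0 by (simp add: c_def)
  have Mr: "1 / M / r = p" using M r by (simp add: r_def p_def field_simps)
  have p0: "p > 0" using M r Mr by (metis divide_pos_pos zero_less_one)
  have "1 / M \<le> ?l i yj * r * c" using 1 d0[of j] by (simp add: c_def field_simps)
  then have "1 / M / r \<le> ?l i yj * r * c / r" using r by (intro divide_right_mono) auto
  then have "p \<le> ?l i yj * r * c / r" by (simp only: Mr)
  then have "p \<le> ?l i yj * c" using r by simp
  then have x: "p / c \<le> ?l i yj" using c0 by (simp add: divide_le_eq)
  have "1 / M * d i / d j \<le> ?l j yi * r * d j / d j" using 2 d0[of j] by (intro divide_right_mono) auto
  then have "1 / M * c \<le> ?l j yi * r" using d0[of j] by (simp add: c_def)
  then have "1 / M * c / r \<le> ?l j yi * r / r" using r by (intro divide_right_mono) auto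
  moreover have "1 / M * c / r = p * c" by (simp flip: Mr)
  ultimately have y: "p * c \<le> ?l j yi" using r by simp
  have "2 \<le> 1 / c + c"
  proof -
    have "0 \<le> (c - 1)\<^sup>2 / c" using c0 by simp
    also have "\<dots> = 1 / c + c - 2" using c0 by (simp add: power2_eq_square field_simps)
    finally show ?thesis by simp
  qed
  then have "p * 2 \<le> p * (1 / c + c)" using p0 by (intro mult_left_mono) auto
  then have "2 * p \<le> p / c + p * c" by (simp add: algebra_simps)
  then show ?thesis using x y by (simp add: p_def)
qed

lemma lagrange_double_sum:
  assumes fin: "finite Z" and D: "D \<subseteq> Z" and M: "M > 0"
    and y: "\<And>z. z \<in> D \<Longrightarrow> cmod (y z - z) = 1 / M \<and> 1 \<le> cmod (poly (lagrange_basis Z z) (y z))"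
  shows "(\<Sum>i\<in>D. \<Sum>j\<in>D - {i}. 1 / (1 + M * cmod (i - j)))
    \<le> (\<Sum>j\<in>D. \<Sum>i\<in>D. cmod (poly (lagrange_basis Z i) (y j)))"
proof -
  let ?l = "\<lambda>i j. cmod (poly (lagrange_basis Z i) (y j))"
  have finD: "finite D" using D fin finite_subset by blast
  have "2 * (\<Sum>i\<in>D. \<Sum>j\<in>D - {i}. 1 / (1 + M * cmod (i - j)))
      = (\<Sum>i\<in>D. \<Sum>j\<in>D - {i}. 2 / (1 + M * cmod (i - j)))" by (simp add: sum_distrib_left)
  also have "\<dots> \<le> (\<Sum>i\<in>D. \<Sum>j\<in>D - {i}. ?l i j + ?l j i)"
    using y D by (intro sum_mono lagrange_basis_pair[OF fin _ _ _ M]) auto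
  also have "\<dots> \<le> (\<Sum>i\<in>D. \<Sum>j\<in>D. ?l i j + ?l j i)"
    using finD by (intro sum_mono sum_mono2) auto
  also have "\<dots> = (\<Sum>i\<in>D. \<Sum>j\<in>D. ?l i j) + (\<Sum>i\<in>D. \<Sum>j\<in>D. ?l j i)" by (simp add: sum.distrib)
  also have "(\<Sum>i\<in>D. \<Sum>j\<in>D. ?l i j) = (\<Sum>j\<in>D. \<Sum>i\<in>D. ?l i j)" by (rule sum.swap)
  finally show ?thesis by simp
qed

text \<open>Double counting of \<open>|l_i(y_j)|\<close> over pairs in \<open>D\<close>: the
  logarithmic energy bounds the sum from below, and \<open>cell_lagrange_sum\<close> bounds it from
  above for each fixed \<open>y_j\<close>. Dividing by the size of \<open>D\<close> gives the
  claim.\<close>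

lemma cell_density_bound:
  assumes fek: "fekete A T Z" and card: "card Z = M + 1" and A: "A \<ge> 1" and H: "H \<ge> 0" and M0: "M > 0"
    and q: "q > 0" and M: "M0 + 4 * (q - 1) \<le> M" and \<tau>: "cmod \<tau> = 1"
    and S: "S \<subseteq> T" and interp: "circle_interpolable M0 H S"
    and D: "D \<subseteq> Z \<inter> S" "D \<noteq> {}" and near: "\<And>z. z \<in> D \<Longrightarrow> cmod (z - \<tau>) \<le> 1 / (4 * real q)"
    and u: "\<And>z. z \<in> D \<Longrightarrow> z = cis (u z) \<and> a \<le> u z \<and> u z < a + \<Delta>"
    and \<Delta>: "\<Delta> > 0" and L: "2 ^ L \<le> real M * \<Delta>"
  shows "((real L + 1) * real (card D) - 2 ^ (L + 1)) / (16 * real M * \<Delta>)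
    \<le> exp 1 * H * (1 + 2 * (\<Sum>z\<in>Z - T. cmod (poly (localizer q \<tau>) z) ^ 2)
      + 2 * A * (\<Sum>z\<in>Z \<inter> T - S. cmod (poly (localizer q \<tau>) z) ^ 4))" (is "_ \<le> ?R")
proof -
  have fin: "finite Z" and unit: "\<And>z. z \<in> Z \<Longrightarrow> cmod z = 1" using fek by (auto simp: fekete_def)
  have finD: "finite D" using D fin finite_subset by blast
  define g where "g = real (card D)"
  have g: "g > 0" using finD D(2) by (simp add: g_def card_gt_0_iff)
  \<comment> \<open>The Lagrange polynomial equals 1 at its own node, so by the maximum principle it
    is at least 1 somewhere on the sphere around it.\<close>
  have "\<exists>y. cmod (y - z) = 1 / real M \<and> 1 \<le> cmod (poly (lagrange_basis Z z) y)" for z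
    using exists_large_on_sphere[of "1 / real M" z "lagrange_basis Z z"] M0
    by (simp add: lagrange_basis_self) metis
  then obtain y where y: "\<And>z. cmod (y z - z) = 1 / real M \<and> 1 \<le> cmod (poly (lagrange_basis Z z) (y z))"
    by metis
  have "((real L + 1) * g\<^sup>2 - g * 2 ^ (L + 1)) / (4 * real M * \<Delta>)
      \<le> (\<Sum>i\<in>D. \<Sum>j\<in>D - {i}. 1 / (1 + real M * \<bar>u i - u j\<bar>))"
    unfolding g_def using u M0 by (intro log_energy[OF finD _ _ \<Delta> L]) auto
  also have "\<dots> \<le> (\<Sum>i\<in>D. \<Sum>j\<in>D - {i}. 1 / (1 + real M * cmod (i - j)))"
  proof (intro sum_mono divide_left_mono)
    fix i j assume ij: "i \<in> D" "j \<in> D - {i}"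
    have "cmod (cis (u i) - cis (u j)) \<le> \<bar>u i - u j\<bar>"
      by (rule norm_cis_diff_le)
    then have "cmod (i - j) \<le> \<bar>u i - u j\<bar>" using u[of i] u[of j] ij by auto
    then show "1 + real M * cmod (i - j) \<le> 1 + real M * \<bar>u i - u j\<bar>"
      by (intro add_left_mono mult_left_mono) auto
    show "0 < (1 + real M * \<bar>u i - u j\<bar>) * (1 + real M * cmod (i - j))"
      by (intro mult_pos_pos add_pos_nonneg) auto
  qed auto
  also have "\<dots> \<le> (\<Sum>j\<in>D. \<Sum>i\<in>D. cmod (poly (lagrange_basis Z i) (y j)))"
    using y D M0 by (intro lagrange_double_sum[OF fin]) auto
  also have "\<dots> \<le> (\<Sum>j\<in>D. 4 * ?R)"
  proof (rule sum_mono)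
    fix j assume j: "j \<in> D"
    have "cmod (y j) \<le> cmod (y j - j) + cmod j" using norm_triangle_ineq[of "y j - j" j] by simp
    then have "cmod (y j) \<le> 1 + 1 / real M" using y[of j] unit[of j] j D by auto
    from cell_lagrange_sum[OF fek card A H M0 q M \<tau> S interp D(1) near this]
    show "(\<Sum>i\<in>D. cmod (poly (lagrange_basis Z i) (y j))) \<le> 4 * ?R" by simp
  qed
  also have "\<dots> = g * (4 * ?R)" by (simp add: g_def)
  finally have "((real L + 1) * g\<^sup>2 - g * 2 ^ (L + 1)) / (4 * real M * \<Delta>) \<le> g * (4 * ?R)" .
  moreover have "((real L + 1) * g\<^sup>2 - g * 2 ^ (L + 1)) / (4 * real M * \<Delta>)
      = g * (4 * (((real L + 1) * g - 2 ^ (L + 1)) / (16 * real M * \<Delta>)))"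
  proof -
    have "g * (4 * (Y / (16 * real M * \<Delta>))) = (g * Y) / (4 * real M * \<Delta>)" for Y by simp
    moreover have "(real L + 1) * g\<^sup>2 - g * 2 ^ (L + 1) = g * ((real L + 1) * g - 2 ^ (L + 1))"
      by (simp add: power2_eq_square algebra_simps)
    ultimately show ?thesis by (simp only:)
  qed
  ultimately have "g * (4 * (((real L + 1) * g - 2 ^ (L + 1)) / (16 * real M * \<Delta>))) \<le> g * (4 * ?R)"
    by (simp only:)
  then have "4 * (((real L + 1) * g - 2 ^ (L + 1)) / (16 * real M * \<Delta>)) \<le> 4 * ?R"
    using g by (simp only: mult_le_cancel_left_pos)
  then show ?thesis unfolding g_def by linarith
qed

section \<open>Density of locally interpolable sets\<close>

definition cell :: "nat \<Rightarrow> complex \<Rightarrow> nat" where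
  "cell K z = nat \<lfloor>real K * Arg2pi z / (2 * pi)\<rfloor>"

lemma cell_bounds:
  assumes z: "cmod z = 1" and K: "K > 0"
  shows "z = cis (Arg2pi z)" "2 * pi * real (cell K z) / real K \<le> Arg2pi z"
    "Arg2pi z < 2 * pi * real (cell K z) / real K + 2 * pi / real K" "cell K z < K"
proof -
  show "z = cis (Arg2pi z)" using Arg2pi_eq[of z] z by (simp add: cis_conv_exp)
  have a: "0 \<le> Arg2pi z" "Arg2pi z < 2 * pi" by (simp_all add: Arg2pi_ge_0 Arg2pi_lt_2pi)
  let ?x = "real K * Arg2pi z / (2 * pi)"
  have x0: "0 \<le> ?x" using a by simp
  then have x: "real (cell K z) \<le> ?x" "?x < real (cell K z) + 1" unfolding cell_def by linarith+
  show "2 * pi * real (cell K z) / real K \<le> Arg2pi z" using x(1) K by (simp add: field_simps)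
  show "Arg2pi z < 2 * pi * real (cell K z) / real K + 2 * pi / real K"
    using x(2) K by (simp add: field_simps)
  have "?x < real K" using a K by (simp add: field_simps)
  then show "cell K z < K" using x(1) by linarith
qed

text \<open>The number 32 of cells per unit of \<open>q\<close> comes from here: an arc of length 2
  pi / (32 q) is short enough for the localizer to stay near 1 on it.\<close>

lemma dist_grid_cell:
  assumes z: "cmod z = 1" and q: "q > 0"
  shows "cmod (z - grid (32 * q) (cell (32 * q) z)) \<le> 1 / (4 * real q)"
proof -
  let ?K = "32 * q"
  note c = cell_bounds[OF z, of ?K]
  have "cmod (z - grid ?K (cell ?K z)) = cmod (cis (Arg2pi z) - cis (2 * pi * real (cell ?K z) / real ?K))"
    using c(1) q by (simp add: grid_def)
  also have "\<dots> \<le> \<bar>Arg2pi z - 2 * pi * real (cell ?K z) / real ?K\<bar>" by (rule norm_cis_diff_le)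
  also have "\<dots> \<le> 2 * pi / real ?K" using c q by simp
  also have "\<dots> \<le> 1 / (4 * real q)" using q pi_less_4 by (simp add: field_simps)
  finally show ?thesis .
qed

lemma card_le_by_fibres:
  assumes fin: "finite X" and J: "finite J" "f ` X \<subseteq> J" and k: "\<And>j. j \<in> J \<Longrightarrow> real (card {x \<in> X. f x = j}) \<le> k"
  shows "real (card X) \<le> k * real (card J)"
proof -
  have "X = (\<Union>j\<in>J. {x \<in> X. f x = j})" using J by auto
  then have "card X = card (\<Union>j\<in>J. {x \<in> X. f x = j})" by (rule arg_cong)
  also have "\<dots> \<le> (\<Sum>j\<in>J. card {x \<in> X. f x = j})" by (rule card_UN_le[OF J(1)])
  finally have "real (card X) \<le> (\<Sum>j\<in>J. real (card {x \<in> X. f x = j}))"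
    by (simp only: of_nat_le_iff flip: of_nat_sum)
  also have "\<dots> \<le> (\<Sum>j\<in>J. k)" by (rule sum_mono) (rule k)
  finally show ?thesis by (simp add: mult.commute)
qed

lemma markov_card:
  fixes f :: "'a \<Rightarrow> real"
  assumes fin: "finite B" and pos: "\<And>b. b \<in> B \<Longrightarrow> 0 \<le> f b" and sum: "sum f B \<le> s"
    and t: "t > 0" and J: "J \<subseteq> B" "\<And>b. b \<in> J \<Longrightarrow> t \<le> f b"
  shows "real (card J) \<le> s / t"
proof -
  have "real (card J) * t = (\<Sum>b\<in>J. t)" by simp
  also have "\<dots> \<le> sum f J" by (rule sum_mono) (rule J(2))
  also have "\<dots> \<le> sum f B" using fin J pos by (intro sum_mono2) auto
  finally show ?thesis using sum t by (simp add: le_divide_eq)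
qed

text \<open>The sum \<open>X\<close> of the disturbance from points outside \<open>T\<close> is
  bounded only on average over cells, while the disturbance \<open>Y\<close> from nodes outside the
  window is small. Averaging yields one cell that has bounded \<open>X\<close>, small
  \<open>A * Y\<close> and its fair share of nodes; there the upper bound depends on
  \<open>H\<close> alone and contradicts the size of \<open>L\<close>.\<close>

lemma no_dense_interpolable_circle_set:
  fixes n q L M M0 :: nat and H A \<rho> \<kappa> \<eta> :: real and T :: "complex set" and S :: "nat \<Rightarrow> complex set"
  assumes H: "H \<ge> 1" and A: "A \<ge> 1" and q: "q > 0" "4 * q \<le> n"
    and M: "M = 2 * n + 6 * q" and M0: "M0 \<le> 2 * n + 2 * q"
    and T: "finite T" "\<And>z. z \<in> T \<Longrightarrow> cmod z = 1"
    and B: "B \<subseteq> {..<32 * q}" and S: "\<And>b. b \<in> B \<Longrightarrow> S b \<subseteq> T"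
    and interp: "\<And>b. b \<in> B \<Longrightarrow> circle_interpolable M0 H (S b)"
    and \<rho>: "\<rho> > 1 / (4 * real q)"
    and far: "\<And>b z. b \<in> B \<Longrightarrow> z \<in> T - S b \<Longrightarrow> \<rho> \<le> cmod (z - grid (32 * q) b)"
    and cellcard: "\<And>b. b \<in> B \<Longrightarrow> real (card {z \<in> T. cell (32 * q) z = b}) \<le> \<kappa>"
    and \<kappa>: "\<kappa> = 2 * H * real n / real q"
    and cardT: "2 * real n - real q \<le> real (card T)"
    and outside: "real (card {z \<in> T. cell (32 * q) z \<notin> B}) \<le> real q / 2"
    and \<eta>: "\<eta> = (2 / (real q * \<rho>))\<^sup>2"
    and P1: "\<kappa> * (256 * H * (real M + 1) * (1 / A + \<eta>)) \<le> real q / 2"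
    and P2: "\<kappa> * (A * (32 * \<eta> * (real M + 1))) \<le> real n / 4"
    and L: "2 ^ L \<le> real M * (2 * pi / real (32 * q))"
    and big: "2048 * (13833 * H\<^sup>2 + 1 / 8) < real L + 1"
  shows False
proof -
  define K where "K = 32 * q"
  have K: "K > 0" using q by (simp add: K_def)
  have \<rho>0: "\<rho> > 0" using \<rho> q by (intro less_trans[OF _ \<rho>]) simp
  have n: "n > 0" using q by simp
  have \<kappa>0: "\<kappa> \<ge> 0" using H by (simp add: \<kappa>)
  have \<eta>0: "\<eta> \<ge> 0" by (simp add: \<eta>)
  have M00: "M > 0" using q by (simp add: M)
  obtain Z where fek: "fekete A T Z" and cardZ: "card Z = M + 1"
    using fekete_exists[OF A, of "M + 1" T] by auto
  have finZ: "finite Z" and unitZ: "\<And>z. z \<in> Z \<Longrightarrow> cmod z = 1" using fek by (auto simp: fekete_def)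
  have deg: "M0 + 4 * (q - 1) \<le> M" using M M0 q by linarith
  let ?\<phi> = "\<lambda>b z. cmod (poly (localizer q (grid K b)) z)"
  define X where "X = (\<lambda>b. \<Sum>z\<in>Z - T. ?\<phi> b z ^ 2)"
  define Y where "Y = (\<lambda>b. \<Sum>z\<in>Z \<inter> T - S b. ?\<phi> b z ^ 4)"
  have X0: "0 \<le> X b" and Y0: "0 \<le> Y b" for b by (simp_all add: X_def Y_def sum_nonneg)
  have finB: "finite B" using B finite_subset by blast
  have BK: "B \<subseteq> {..<K}" using B by (simp add: K_def)
  have parseval: "(\<Sum>b<K. (?\<phi> b z)\<^sup>2) = 32" if "cmod z = 1" for z
    using sum_localizer_grid[OF q(1) _ that, of K] q by (simp add: K_def)
  have sumX: "sum X B \<le> 32 * real (card (Z - T))"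
  proof -
    have "sum X B \<le> (\<Sum>b<K. X b)" using BK X0 by (intro sum_mono2) auto
    also have "\<dots> = (\<Sum>z\<in>Z - T. \<Sum>b<K. ?\<phi> b z ^ 2)" unfolding X_def by (rule sum.swap)
    also have "\<dots> = (\<Sum>z\<in>Z - T. 32)" using unitZ by (intro sum.cong refl parseval) auto
    finally show ?thesis by simp
  qed
  have sumY: "sum Y B \<le> 32 * \<eta> * (real M + 1)"
  proof -
    have "sum Y B \<le> (\<Sum>b\<in>B. \<Sum>z\<in>Z. \<eta> * ?\<phi> b z ^ 2)"
    proof (rule sum_mono)
      fix b assume b: "b \<in> B"
      have "Y b \<le> (\<Sum>z\<in>Z \<inter> T - S b. \<eta> * ?\<phi> b z ^ 2)"
        unfolding Y_def
      proof (rule sum_mono)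
        fix z assume z: "z \<in> Z \<inter> T - S b"
        have d: "\<rho> \<le> cmod (z - grid K b)" using far[OF b, of z] z by (simp add: K_def)
        then have "z \<noteq> grid K b" using \<rho>0 by auto
        then have "?\<phi> b z \<le> 2 / (real q * cmod (z - grid K b))"
          using unitZ z q by (intro localizer_decay) auto
        also have "\<dots> \<le> 2 / (real q * \<rho>)"
          using d \<rho>0 q by (intro divide_left_mono mult_left_mono mult_pos_pos) auto
        \<comment> \<open>Of the four localizer factors, two are spent on the decay at distance
          \<open>\<rho>\<close>; the other two remain for Parseval.\<close>
        finally have "?\<phi> b z ^ 2 \<le> \<eta>" unfolding \<eta> by (intro power_mono) auto
        then have "?\<phi> b z ^ 2 * ?\<phi> b z ^ 2 \<le> \<eta> * ?\<phi> b z ^ 2" by (rule mult_right_mono) simp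
        then show "?\<phi> b z ^ 4 \<le> \<eta> * ?\<phi> b z ^ 2" by (simp flip: power_add)
      qed
      also have "\<dots> \<le> (\<Sum>z\<in>Z. \<eta> * ?\<phi> b z ^ 2)" using finZ \<eta>0 by (intro sum_mono2) auto
      finally show "Y b \<le> (\<Sum>z\<in>Z. \<eta> * ?\<phi> b z ^ 2)" .
    qed
    also have "\<dots> \<le> (\<Sum>b<K. \<Sum>z\<in>Z. \<eta> * ?\<phi> b z ^ 2)"
      using BK \<eta>0 by (intro sum_mono2 sum_nonneg mult_nonneg_nonneg) auto
    also have "\<dots> = (\<Sum>z\<in>Z. \<Sum>b<K. \<eta> * ?\<phi> b z ^ 2)" by (rule sum.swap)
    also have "\<dots> = (\<Sum>z\<in>Z. \<eta> * 32)"
      using unitZ parseval by (intro sum.cong refl) (simp flip: sum_distrib_left)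
    finally show ?thesis by (simp add: cardZ algebra_simps)
  qed
  have near: "cmod (z - grid K b) \<le> 1 / (4 * real q)" if "cmod z = 1" "cell K z = b" for z b
    using dist_grid_cell[OF that(1) q(1)] that(2) by (simp add: K_def)
  have inS: "z \<in> S b" if "z \<in> T" "b \<in> B" "cell K z = b" for z b
    using near[OF T(2)[OF that(1)] that(3)] far[OF that(2), of z] \<rho> that(1) unfolding K_def by force
  define B1 where "B1 = {b \<in> B. \<exists>t\<in>T - Z. cell K t = b}"
  have B1_large: "1 / 4 \<le> 2 * H / A * X b + 2 * H * Y b" if b: "b \<in> B1" for b
  proof -
    obtain t where t: "t \<in> T" "t \<notin> Z" "cell K t = b" and bB: "b \<in> B" using b by (auto simp: B1_def)
    show ?thesis unfolding X_def Y_def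
      by (rule missing_node[OF fek cardZ A _ q(1) deg norm_grid S[OF bB] interp[OF bB] inS[OF t(1) bB t(3)]
            t(2) T(2)[OF t(1)] near[OF T(2)[OF t(1)] t(3)]]) (use H in simp)
  qed
  have sumXY: "(\<Sum>b\<in>B. 2 * H / A * X b + 2 * H * Y b) \<le> 64 * H * (real M + 1) * (1 / A + \<eta>)"
  proof -
    have "card (Z - T) \<le> M + 1" using finZ cardZ card_mono[of Z "Z - T"] by auto
    then have "real (card (Z - T)) \<le> real (M + 1)" by (simp only: of_nat_le_iff)
    then have "sum X B \<le> 32 * (real M + 1)" using sumX by simp
    then have "2 * H / A * sum X B \<le> 2 * H / A * (32 * (real M + 1))" using H A by (intro mult_left_mono) auto
    moreover have "2 * H * sum Y B \<le> 2 * H * (32 * \<eta> * (real M + 1))" using H sumY by (intro mult_left_mono) auto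
    ultimately have "2 * H / A * sum X B + 2 * H * sum Y B
        \<le> 2 * H / A * (32 * (real M + 1)) + 2 * H * (32 * \<eta> * (real M + 1))" by linarith
    also have "\<dots> = 64 * H * (real M + 1) * (1 / A + \<eta>)" by (simp add: algebra_simps)
    finally show ?thesis by (simp add: sum.distrib sum_distrib_left)
  qed
  have "real (card B1) \<le> 64 * H * (real M + 1) * (1 / A + \<eta>) / (1 / 4)"
  proof (rule markov_card[OF finB _ sumXY _ _ B1_large])
    show "0 \<le> 2 * H / A * X b + 2 * H * Y b" for b using X0[of b] Y0[of b] H A by simp
  qed (auto simp: B1_def)
  then have cardB1: "real (card B1) \<le> 256 * H * (real M + 1) * (1 / A + \<eta>)" by simp
  have missing: "real (card (T - Z)) \<le> real q"
  proof -
    have "T - Z \<subseteq> {z \<in> T - Z. cell K z \<in> B} \<union> {z \<in> T. cell K z \<notin> B}" by auto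
    then have "card (T - Z) \<le> card ({z \<in> T - Z. cell K z \<in> B} \<union> {z \<in> T. cell K z \<notin> B})"
      using T by (intro card_mono) auto
    also have "\<dots> \<le> card {z \<in> T - Z. cell K z \<in> B} + card {z \<in> T. cell K z \<notin> B}" by (rule card_Un_le)
    finally have "real (card (T - Z)) \<le> real (card {z \<in> T - Z. cell K z \<in> B}) + real q / 2"
      using outside by (simp add: K_def)
    also have "real (card {z \<in> T - Z. cell K z \<in> B}) \<le> \<kappa> * real (card B1)"
    proof (rule card_le_by_fibres[where f = "cell K"])
      fix b assume b: "b \<in> B1"
      have "card {x \<in> {z \<in> T - Z. cell K z \<in> B}. cell K x = b} \<le> card {z \<in> T. cell K z = b}"
        using T by (intro card_mono) auto
      then show "real (card {x \<in> {z \<in> T - Z. cell K z \<in> B}. cell K x = b}) \<le> \<kappa>"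
        using cellcard[of b] b by (simp add: B1_def K_def)
    qed (use T finB in \<open>auto simp: B1_def\<close>)
    also have "\<dots> \<le> \<kappa> * (256 * H * (real M + 1) * (1 / A + \<eta>))" using cardB1 \<kappa>0 by (intro mult_left_mono)
    finally show ?thesis using P1 by simp
  qed
  have ZT: "2 * real n - 2 * real q \<le> real (card (Z \<inter> T))"
  proof -
    have "card T = card (T - Z) + card (Z \<inter> T)"
      using T by (subst card_Un_disjoint[symmetric]) (auto intro!: arg_cong[of _ _ card])
    then show ?thesis using missing cardT by simp
  qed
  have "card Z = card (Z - T) + card (Z \<inter> T)"
    using finZ by (subst card_Un_disjoint[symmetric]) (auto intro!: arg_cong[of _ _ card])
  \<comment> \<open>The count is (2n + 6q + 1) - (2n - 2q) = 8q + 1. It is proportional to the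
    number of cells whatever \<open>n / q\<close> is; this is where the density of the nodes
    enters.\<close>
  then have "real (card (Z - T)) \<le> 9 * real q" using ZT cardZ M q by simp
  then have sumX': "sum X B \<le> 288 * real q" using sumX by linarith
  \<comment> \<open>The threshold \<open>C0\<close> leaves at most q / (8 H) cells with large
    \<open>X\<close>, and these hold at most n/4 nodes; \<open>g0\<close> is chosen so that the
    sparse ones among all \<open>32 * q\<close> cells also hold at most n/4.\<close>
  define C0 where "C0 = 2304 * H"
  define g0 where "g0 = real n / (128 * real q)"
  define D where "D = (\<lambda>b. {z \<in> Z \<inter> T. cell K z = b})"
  have "\<exists>b\<in>B. X b \<le> C0 \<and> A * Y b \<le> 1 \<and> g0 \<le> real (card (D b))"
  proof (rule ccontr)
    assume contr: "\<not> ?thesis"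
    define B2 where "B2 = {b \<in> B. C0 \<le> X b}"
    define B3 where "B3 = {b \<in> B. 1 \<le> A * Y b}"
    define B4 where "B4 = {b \<in> B. real (card (D b)) \<le> g0}"
    let ?part = "\<lambda>J. {z \<in> Z \<inter> T. cell K z \<in> J}"
    have C0: "C0 > 0" using H by (simp add: C0_def)
    have cB2: "real (card B2) \<le> 288 * real q / C0"
      by (rule markov_card[OF finB X0 sumX' C0]) (auto simp: B2_def)
    have cB3: "real (card B3) \<le> A * (32 * \<eta> * (real M + 1)) / 1"
      by (rule markov_card[OF finB, of "\<lambda>b. A * Y b"])
        (use A Y0 sumY in \<open>auto simp: B3_def simp flip: sum_distrib_left\<close>)
    have part_le: "real (card (?part J)) \<le> k * real (card J)"
      if J: "J \<subseteq> B" and k: "\<And>b. b \<in> J \<Longrightarrow> real (card (D b)) \<le> k" for J k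
    proof (rule card_le_by_fibres[where f = "cell K"])
      fix b assume b: "b \<in> J"
      have "{x \<in> ?part J. cell K x = b} = D b" using b by (auto simp: D_def)
      then show "real (card {x \<in> ?part J. cell K x = b}) \<le> k" using k[OF b] by simp
    qed (use finZ finB J finite_subset in auto)
    have Dk: "real (card (D b)) \<le> \<kappa>" if b: "b \<in> B" for b
    proof -
      have "card (D b) \<le> card {z \<in> T. cell K z = b}" unfolding D_def using T by (intro card_mono) auto
      then show ?thesis using cellcard[OF b] by (simp add: K_def)
    qed
    have 2: "real (card (?part B2)) \<le> real n / 4"
    proof -
      have "real (card (?part B2)) \<le> \<kappa> * real (card B2)" by (rule part_le) (auto simp: B2_def Dk)
      also have "\<dots> \<le> \<kappa> * (288 * real q / C0)" using cB2 \<kappa>0 by (rule mult_left_mono)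
      also have "\<dots> = real n / 4" using H q by (simp add: \<kappa> C0_def field_simps)
      finally show ?thesis .
    qed
    have 3: "real (card (?part B3)) \<le> real n / 4"
    proof -
      have "real (card (?part B3)) \<le> \<kappa> * real (card B3)" by (rule part_le) (auto simp: B3_def Dk)
      also have "\<dots> \<le> \<kappa> * (A * (32 * \<eta> * (real M + 1)))" using cB3 \<kappa>0 by (intro mult_left_mono) auto
      finally show ?thesis using P2 by linarith
    qed
    have 4: "real (card (?part B4)) \<le> real n / 4"
    proof -
      have "card B4 \<le> K" using card_mono[of "{..<K}" B4] BK by (auto simp: B4_def)
      then have "real (card B4) \<le> real K" by simp
      moreover have "g0 \<ge> 0" by (simp add: g0_def)
      moreover have "real (card (?part B4)) \<le> g0 * real (card B4)" by (rule part_le) (auto simp: B4_def)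
      ultimately have "real (card (?part B4)) \<le> g0 * real K" by (meson mult_left_mono order_trans)
      also have "\<dots> = real n / 4" using q by (simp add: g0_def K_def)
      finally show ?thesis .
    qed
    have "Z \<inter> T \<subseteq> {z \<in> T. cell K z \<notin> B} \<union> (?part B2 \<union> (?part B3 \<union> ?part B4))"
    proof
      fix z assume z: "z \<in> Z \<inter> T"
      show "z \<in> {z \<in> T. cell K z \<notin> B} \<union> (?part B2 \<union> (?part B3 \<union> ?part B4))"
      proof (cases "cell K z \<in> B")
        case True
        then have "\<not> (X (cell K z) \<le> C0 \<and> A * Y (cell K z) \<le> 1 \<and> g0 \<le> real (card (D (cell K z))))"
          using contr by blast
        then show ?thesis using z True by (auto simp: B2_def B3_def B4_def)
      qed (use z in auto)
    qed
    then have "card (Z \<inter> T) \<le> card ({z \<in> T. cell K z \<notin> B} \<union> (?part B2 \<union> (?part B3 \<union> ?part B4)))"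
      using finZ T by (intro card_mono) auto
    also have "\<dots> \<le> card {z \<in> T. cell K z \<notin> B} + (card (?part B2) + (card (?part B3) + card (?part B4)))"
      by (intro order_trans[OF card_Un_le] add_left_mono card_Un_le order_refl)
    finally have "real (card (Z \<inter> T)) \<le> real (card {z \<in> T. cell K z \<notin> B})
        + (real (card (?part B2)) + (real (card (?part B3)) + real (card (?part B4))))"
      by (simp only: of_nat_le_iff flip: of_nat_add)
    moreover have "4 * real q \<le> real n" using of_nat_mono[OF q(2), where 'a = real] by simp
    moreover have "real (card {z \<in> T. cell K z \<notin> B}) \<le> real q / 2" using outside by (simp add: K_def)
    moreover have "0 < real n" using n by simp
    \<comment> \<open>The bad cells hold at most 3n/4 + q/2, hence at most 7n/8 points, but
      \<open>Z \<inter> T\<close> has at least 2n - 2q, hence at least 3n/2.\<close>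
    ultimately show False using ZT 2 3 4 by linarith
  qed
  then obtain b where b: "b \<in> B" "X b \<le> C0" "A * Y b \<le> 1" "g0 \<le> real (card (D b))" by blast
  have g0: "g0 > 0" using n q by (simp add: g0_def)
  define \<Delta> where "\<Delta> = 2 * pi / real K"
  have \<Delta>: "\<Delta> > 0" using K by (simp add: \<Delta>_def)
  have "((real L + 1) * real (card (D b)) - 2 ^ (L + 1)) / (16 * real M * \<Delta>) \<le> exp 1 * H * (1 + 2 * X b + 2 * A * Y b)"
    unfolding X_def Y_def
  proof (rule cell_density_bound[OF fek cardZ A _ M00 q(1) deg norm_grid S[OF b(1)] interp[OF b(1)]])
    show "D b \<subseteq> Z \<inter> S b" using inS b(1) by (auto simp: D_def)
    show "D b \<noteq> {}" using b(4) g0 by auto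
    show "2 ^ L \<le> real M * \<Delta>" using L by (simp add: \<Delta>_def K_def)
    fix z assume z: "z \<in> D b"
    then have uz: "cmod z = 1" and cz: "cell K z = b" using T by (auto simp: D_def)
    show "cmod (z - grid K b) \<le> 1 / (4 * real q)" by (rule near[OF uz cz])
    show "z = cis (Arg2pi z) \<and> 2 * pi * real b / real K \<le> Arg2pi z \<and> Arg2pi z < 2 * pi * real b / real K + \<Delta>"
      using cell_bounds[OF uz K] cz by (simp add: \<Delta>_def)
  qed (use H \<Delta> in auto)
  also have "\<dots> \<le> 3 * H * (1 + 2 * C0 + 2)"
    using b exp_le H Y0[of b] X0[of b] A by (intro mult_mono) auto
  also have "\<dots> \<le> 13833 * H\<^sup>2"
  proof -
    have "3 * H * (1 + 2 * C0 + 2) = 9 * H + 13824 * H\<^sup>2" by (simp add: C0_def power2_eq_square algebra_simps)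
    moreover have "H \<le> H\<^sup>2" using H by (simp add: power2_eq_square)
    ultimately show ?thesis by linarith
  qed
  finally have upper: "((real L + 1) * real (card (D b)) - 2 ^ (L + 1)) / (16 * real M * \<Delta>) \<le> 13833 * H\<^sup>2" .
  define c where "c = real M * \<Delta>"
  have c0: "c > 0" using M00 \<Delta> by (simp add: c_def)
  have cL: "2 ^ L \<le> c" using L by (simp add: c_def \<Delta>_def K_def)
  \<comment> \<open>The chosen cell thus has a number of nodes comparable to \<open>c\<close>, so
    that \<open>c\<close> cancels from the density bound and only \<open>L\<close> remains.\<close>
  have "c \<le> 128 * g0"
  proof -
    have "real M \<le> 4 * real n" using q(2) by (simp add: M)
    moreover have "pi \<le> 4" using pi_less_4 by simp
    ultimately have "real M * pi \<le> (4 * real n) * 4" by (intro mult_mono) auto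
    then have "real M * pi / (16 * real q) \<le> (4 * real n) * 4 / (16 * real q)" by (rule divide_right_mono) simp
    then show ?thesis by (simp add: c_def \<Delta>_def K_def g0_def)
  qed
  then have "c / 128 \<le> real (card (D b))" using b(4) by simp
  then have "(real L + 1) * (c / 128) \<le> (real L + 1) * real (card (D b))" by (rule mult_left_mono) simp
  moreover have "2 ^ (L + 1) \<le> 2 * c" using cL by simp
  ultimately have "(real L + 1) * (c / 128) - 2 * c \<le> (real L + 1) * real (card (D b)) - 2 ^ (L + 1)"
    by (rule diff_mono)
  then have "((real L + 1) * (c / 128) - 2 * c) / (16 * c) \<le> 13833 * H\<^sup>2"
    using upper c0 by (intro order_trans[OF divide_right_mono upper[unfolded mult.assoc, folded c_def]]) auto
  moreover have "((real L + 1) * (c / 128) - 2 * c) / (16 * c) = (real L + 1) / 2048 - 1 / 8"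
    using c0 by (simp add: diff_divide_distrib)
  ultimately have "(real L + 1) / 2048 - 1 / 8 \<le> 13833 * H\<^sup>2" by (simp only:)
  then show False using big by (simp add: field_simps)
qed

section \<open>Angles, chords and windows of cells\<close>

lemma sin_ge_half:
  assumes "0 \<le> a" "a \<le> pi / 3"
  shows "a / 2 \<le> sin a"
proof -
  have "sin 0 - 0 / 2 \<le> sin a - a / 2"
  proof (rule DERIV_nonneg_imp_nondecreasing[OF assms(1)])
    fix x assume x: "0 \<le> x" "x \<le> a"
    have "cos (pi / 3) \<le> cos x" using x assms(2) by (intro cos_monotone_0_pi_le) auto
    then have "0 \<le> cos x - 1 / 2" by (simp add: cos_60)
    moreover have "((\<lambda>x. sin x - x / 2) has_real_derivative cos x - 1 / 2) (at x)"
      by (auto intro!: derivative_eq_intros)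
    ultimately show "\<exists>y. ((\<lambda>x. sin x - x / 2) has_real_derivative y) (at x) \<and> 0 \<le> y" by blast
  qed
  then show ?thesis by simp
qed

lemma sin_ge_of_between:
  assumes a: "0 \<le> a" "a \<le> pi / 3" and x: "a \<le> x" "x \<le> pi - a"
  shows "a / 2 \<le> sin x"
proof -
  have "sin a \<le> sin x"
  proof (cases "x \<le> pi / 2")
    case True
    then show ?thesis using a x by (intro sin_monotone_2pi_le) auto
  next
    case False
    have "sin a \<le> sin (pi - x)" using a x False by (intro sin_monotone_2pi_le) auto
    then show ?thesis by simp
  qed
  then show ?thesis using sin_ge_half[OF a] by linarith
qed

lemma chord_lower_bound:
  assumes \<delta>: "0 \<le> \<delta>" "\<delta> \<le> 2 * pi / 3" and d: "\<delta> \<le> \<bar>u - v\<bar>" "\<bar>u - v\<bar> \<le> 2 * pi - \<delta>"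
  shows "\<delta> / 2 \<le> cmod (cis u - cis v)"
proof -
  have "cis u - cis v = cis v * (cis (u - v) - 1)" by (simp add: cis_mult right_diff_distrib)
  then have "cmod (cis u - cis v) = cmod (exp (\<i> * of_real (u - v)) - 1)"
    by (simp add: norm_mult cis_conv_exp)
  also have "\<dots> = 2 * \<bar>sin ((u - v) / 2)\<bar>" by (rule dist_exp_i_1)
  also have "\<bar>sin ((u - v) / 2)\<bar> = \<bar>sin (\<bar>u - v\<bar> / 2)\<bar>" 
  proof (cases "v \<le> u")
    case False
    then have "\<bar>u - v\<bar> / 2 = - ((u - v) / 2)" by (simp add: field_simps)
    then have "sin (\<bar>u - v\<bar> / 2) = sin (- ((u - v) / 2))" by (rule arg_cong)
    then show ?thesis by (simp only: sin_minus abs_minus_cancel)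
  qed simp
  finally have "cmod (cis u - cis v) = 2 * \<bar>sin (\<bar>u - v\<bar> / 2)\<bar>" .
  moreover have "\<delta> / 2 / 2 \<le> sin (\<bar>u - v\<bar> / 2)"
    using \<delta> d by (intro sin_ge_of_between) auto
  ultimately show ?thesis by linarith
qed

text \<open>Windows are runs of \<open>r\<close> consecutive cells. A grid point at least
  \<open>m\<close> cells away from both ends of its window is at angle at least m 2 pi / (32 q), in
  either direction around the circle, from every point of another window; a chord is at least half
  of such an angle.\<close>

lemma dist_deep_cell:
  fixes q r m b :: nat
  assumes z: "cmod z = 1" and r: "r dvd 32 * q" "r \<le> q" and q: "q > 0" and m: "m \<le> r"
    and b: "b < 32 * q" "m \<le> b mod r" "b mod r < r - m"
    and window: "cell (32 * q) z div r \<noteq> b div r"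
  shows "real m / (16 * real q) \<le> cmod (z - grid (32 * q) b)"
proof -
  define K where "K = 32 * q"
  have K: "K > 0" using q by (simp add: K_def)
  define c where "c = cell K z"
  define d where "d = 2 * pi / real K"
  have d: "d > 0" using K by (simp add: d_def)
  have c: "z = cis (Arg2pi z)" "real c * d \<le> Arg2pi z" "Arg2pi z < (real c + 1) * d" "c < K"
    using cell_bounds[OF z K] by (simp_all add: c_def d_def algebra_simps add_divide_distrib)
  have g: "grid K b = cis (real b * d)" by (simp add: grid_def d_def mult_ac)
  have dK: "real K * d = 2 * pi" using K by (simp add: d_def)
  have r0: "r > 0" using b by (cases r) auto
  have bdecomp: "b = r * (b div r) + b mod r" by simp
  have next_window: "r * (b div r) + r \<le> K"
  proof -
    have "b div r < K div r" using r(1) b(1) by (simp add: K_def less_mult_imp_div_less div_less_iff_less_mult r0)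
    then have "Suc (b div r) * r \<le> K div r * r" by (intro mult_right_mono) auto
    also have "\<dots> = K" using r(1) by (simp add: K_def)
    finally show ?thesis by (simp add: mult.commute)
  qed
  have dm: "real m * d \<le> 2 * pi / 3"
  proof -
    have "3 * m \<le> K" using m r by (simp add: K_def)
    then have "real (3 * m) * d \<le> real K * d" using d by (intro mult_right_mono) (simp_all only: of_nat_le_iff less_imp_le)
    then show ?thesis using dK by simp
  qed
  have bounds: "real m * d \<le> \<bar>Arg2pi z - real b * d\<bar> \<and> \<bar>Arg2pi z - real b * d\<bar> \<le> 2 * pi - real m * d"
  proof (cases "c div r < b div r")
    case True
    then have "r * Suc (c div r) \<le> r * (b div r)" by (intro mult_left_mono) auto
    moreover have "c < r * Suc (c div r)" using r0 dividend_less_times_div[of r c] by simp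
    ultimately have "c + 1 + m \<le> b" using bdecomp b(2) by linarith
    then have "(real c + 1 + real m) * d \<le> real b * d"
      using d by (intro mult_right_mono) (simp_all flip: of_nat_add of_nat_Suc add: algebra_simps)
    then have 1: "real m * d \<le> real b * d - Arg2pi z" using c(3) by (simp add: algebra_simps)
    have "b + m \<le> K" using bdecomp next_window b(3) by linarith
    then have "real (b + m) * d \<le> real K * d" using d by (intro mult_right_mono) (simp_all only: of_nat_le_iff less_imp_le)
    then have 2: "real b * d \<le> 2 * pi - real m * d" using dK by (simp add: algebra_simps)
    have "0 \<le> real m * d" using d by simp
    then show ?thesis using 1 2 Arg2pi_ge_0[of z] by auto
  next
    case False
    then have "b div r < c div r" using window by (simp add: c_def K_def)
    then have "r * Suc (b div r) \<le> r * (c div r)" by (intro mult_left_mono) auto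
    moreover have "r * (c div r) \<le> c" by simp
    ultimately have "b + m \<le> c" using bdecomp b(3) unfolding mult_Suc_right by linarith
    then have "real (b + m) * d \<le> real c * d" using d by (intro mult_right_mono) (simp_all only: of_nat_le_iff less_imp_le)
    then have 1: "real m * d \<le> Arg2pi z - real b * d" using c(2) by (simp add: algebra_simps)
    have "m \<le> b" using b(2) mod_less_eq_dividend[of b r] by linarith
    then have "real m * d \<le> real b * d" using d by (intro mult_right_mono) auto
    then have 2: "Arg2pi z - real b * d \<le> 2 * pi - real m * d" using Arg2pi_lt_2pi[of z] by linarith
    have "0 \<le> real m * d" using d by simp
    then show ?thesis using 1 2 by auto
  qed
  have "real m * d / 2 \<le> cmod (z - grid K b)"
    using chord_lower_bound[of "real m * d" "Arg2pi z" "real b * d"] bounds dm d c(1) g by simp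
  moreover have "real m / (16 * real q) \<le> real m * d / 2"
  proof -
    have "2 / real K \<le> d / 2" unfolding d_def using pi_ge_two K by (simp add: divide_right_mono)
    then have "real m * (2 / real K) \<le> real m * (d / 2)" by (rule mult_left_mono) simp
    then show ?thesis by (simp add: K_def)
  qed
  ultimately show ?thesis by (simp add: K_def)
qed

lemma Arg2pi_arccos:
  assumes z: "cmod z = 1" and q: "q > 0"
  shows "if cell (32 * q) z < 16 * q then Arg2pi z = arccos (Re z) else Arg2pi z = 2 * pi - arccos (Re z)"
proof -
  note c = cell_bounds[OF z, of "32 * q"]
  have Re: "Re z = cos (Arg2pi z)" using c(1) q by (metis cis.sel(1) mult_pos_pos zero_less_numeral)
  show ?thesis
  proof (cases "cell (32 * q) z < 16 * q")
    case True
    then have "real (cell (32 * q) z) + 1 \<le> 16 * real q" by linarith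
    then have "2 * pi * (real (cell (32 * q) z) + 1) / real (32 * q) \<le> 2 * pi * (16 * real q) / real (32 * q)"
      by (intro divide_right_mono mult_left_mono) auto
    also have "\<dots> = pi" using q by simp
    finally have "Arg2pi z \<le> pi" using c(3) q by (simp add: algebra_simps add_divide_distrib)
    then show ?thesis using True Re by (simp add: arccos_cos Arg2pi_ge_0)
  next
    case False
    then have "2 * pi * (16 * real q) / real (32 * q) \<le> 2 * pi * real (cell (32 * q) z) / real (32 * q)"
      by (intro divide_right_mono mult_left_mono) auto
    then have "pi \<le> Arg2pi z" using c(2) q by simp
    have "Re z = cos (2 * pi - Arg2pi z)" using Re by (simp only: cos_2pi_minus)
    moreover have "arccos (cos (2 * pi - Arg2pi z)) = 2 * pi - Arg2pi z"
      using \<open>pi \<le> Arg2pi z\<close> Arg2pi_lt_2pi[of z] by (intro arccos_cos) auto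
    ultimately show ?thesis using False by simp
  qed
qed

text \<open>As \<open>r\<close> divides \<open>16 * q\<close>, no window straddles the point -1.
  Each lies in one half of the circle, where the argument is the arccosine up to reflection.\<close>

lemma same_window_Arg2pi_diff:
  assumes z: "cmod z = 1" "cmod w = 1" and q: "q > 0" and r: "r dvd 16 * q" "r > 0"
    and same: "cell (32 * q) z div r = cell (32 * q) w div r"
  shows "\<bar>Arg2pi z - Arg2pi w\<bar> = \<bar>arccos (Re z) - arccos (Re w)\<bar>"
proof -
  have iff: "cell (32 * q) y < 16 * q \<longleftrightarrow> cell (32 * q) y div r < 16 * q div r" for y
    using r by (metis div_less_iff_less_mult dvd_div_mult_self)
  have "cell (32 * q) z < 16 * q \<longleftrightarrow> cell (32 * q) w < 16 * q" unfolding iff same ..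
  then show ?thesis using Arg2pi_arccos[OF z(1) q] Arg2pi_arccos[OF z(2) q] by (auto split: if_splits)
qed

lemma card_separated_le:
  fixes u :: "'a \<Rightarrow> real"
  assumes fin: "finite U" and s: "s > 0" and u: "\<And>z. z \<in> U \<Longrightarrow> a \<le> u z \<and> u z < a + \<Delta>"
    and sep: "\<And>z w. z \<in> U \<Longrightarrow> w \<in> U \<Longrightarrow> z \<noteq> w \<Longrightarrow> s \<le> \<bar>u z - u w\<bar>" and \<Delta>: "\<Delta> \<ge> 0"
  shows "real (card U) \<le> \<Delta> / s + 1"
proof -
  define f where "f = (\<lambda>z. nat \<lfloor>(u z - a) / s\<rfloor>)"
  have f: "real (f z) \<le> (u z - a) / s \<and> (u z - a) / s < real (f z) + 1" if "z \<in> U" for z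
  proof -
    have "0 \<le> (u z - a) / s" using u[OF that] s by simp
    then show ?thesis unfolding f_def by linarith
  qed
  have "inj_on f U"
  proof (rule inj_onI, rule ccontr)
    fix z w assume zw: "z \<in> U" "w \<in> U" "f z = f w" "z \<noteq> w"
    have "\<bar>(u z - a) / s - (u w - a) / s\<bar> < 1" using f[OF zw(1)] f[OF zw(2)] zw(3) by linarith
    moreover have "(u z - a) / s - (u w - a) / s = (u z - u w) / s" by (simp add: diff_divide_distrib)
    ultimately have "\<bar>u z - u w\<bar> / s < 1" using s by simp
    then show False using sep[OF zw(1,2,4)] s by simp
  qed
  moreover have "f ` U \<subseteq> {..nat \<lfloor>\<Delta> / s\<rfloor>}"
  proof
    fix x assume "x \<in> f ` U"
    then obtain z where z: "z \<in> U" "x = f z" by blast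
    have "(u z - a) / s \<le> \<Delta> / s" using u[OF z(1)] s by (intro divide_right_mono) auto
    then show "x \<in> {..nat \<lfloor>\<Delta> / s\<rfloor>}" unfolding z(2) f_def by (simp add: nat_mono floor_mono)
  qed
  ultimately have "card U \<le> card {..nat \<lfloor>\<Delta> / s\<rfloor>}" by (intro card_inj_on_le) auto
  then have "real (card U) \<le> real (nat \<lfloor>\<Delta> / s\<rfloor>) + 1" by simp
  moreover have "0 \<le> \<Delta> / s" using \<Delta> s by simp
  ultimately show ?thesis by linarith
qed

text \<open>An admissible polynomial with values 1 and -1 at the two nodes varies by 2, so the
  Lipschitz bound forces the nodes apart; the 3 stands for e. This caps the number of nodes in a
  cell.\<close>

lemma interpolable_pair_separation:
  assumes interp: "interpolable x \<sigma> H {i, j}" and ij: "i \<noteq> j" and \<sigma>: "\<sigma> > 0" and H: "H > 0"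
    and x: "x i \<in> {-1..1}" "x j \<in> {-1..1}"
  shows "2 / (3 * \<sigma> * H) \<le> \<bar>arccos (x i) - arccos (x j)\<bar>"
proof -
  obtain P where P: "real (degree P) \<le> \<sigma>" "unit_norm P \<le> H"
    "poly P (of_real (x i)) = 1" "poly P (of_real (x j)) = -1"
  proof -
    have "\<forall>l\<in>{i, j}. \<bar>if l = i then 1 else - 1 :: real\<bar> \<le> 1" by simp
    from interp[unfolded interpolable_def, THEN spec, of "\<lambda>l. if l = i then 1 else - 1", THEN mp, OF this]
    obtain P where "real (degree P) \<le> \<sigma>" "unit_norm P \<le> H"
      "\<forall>l\<in>{i, j}. poly P (of_real (x l)) = of_real (if l = i then 1 else - 1)"
      by blast
    then show thesis using that[of P] ij by simp
  qed
  have "2 \<le> exp 1 * \<sigma> * H * dang (x i) (x j)"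
    using poly_arccos_lipschitz[OF P(1) \<sigma> P(2) x] P(3,4) by simp
  also have "\<dots> \<le> 3 * \<sigma> * H * dang (x i) (x j)"
    using \<sigma> H exp_le by (intro mult_right_mono) (auto simp: dang_def)
  finally have "2 / (3 * \<sigma> * H) \<le> dang (x i) (x j)" using \<sigma> H by (simp add: divide_le_eq mult_ac)
  then show ?thesis by (simp add: dang_def)
qed

text \<open>The lift multiplies values by z^N, so the data are divided by z^N beforehand. Their real
  and imaginary parts are interpolated separately, which doubles the norm; injectivity of
  \<open>Re\<close> makes the data well defined on the interval.\<close>

lemma interpolable_imp_circle_interpolable:
  assumes interp: "interpolable x \<sigma> H {i \<in> I. x i \<in> Re ` S}" and N: "\<sigma> < real N + 1"
    and S: "\<And>z. z \<in> S \<Longrightarrow> cmod z = 1 \<and> Re z \<in> x ` I" and inj: "inj_on Re S"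
  shows "circle_interpolable (2 * N) (2 * H) S"
  unfolding circle_interpolable_def
proof (intro allI impI)
  fix v assume v: "\<forall>z\<in>S. cmod (v z) \<le> 1"
  define a where "a = (\<lambda>z. v z * inverse z ^ N)"
  have a: "cmod (a z) \<le> 1" if "z \<in> S" for z
    using v S[OF that] that by (simp add: a_def norm_mult norm_power norm_inverse)
  define pre where "pre = the_inv_into S Re"
  have pre: "pre (Re z) = z" if "z \<in> S" for z using the_inv_into_f_f[OF inj that] by (simp add: pre_def)
  let ?I = "{i \<in> I. x i \<in> Re ` S}"
  have small: "\<bar>Re (a (pre (x i)))\<bar> \<le> 1" "\<bar>Im (a (pre (x i)))\<bar> \<le> 1" if i: "i \<in> ?I" for i
  proof -
    obtain z where "z \<in> S" "x i = Re z" using i by auto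
    then have "cmod (a (pre (x i))) \<le> 1" using a pre by simp
    then show "\<bar>Re (a (pre (x i)))\<bar> \<le> 1" "\<bar>Im (a (pre (x i)))\<bar> \<le> 1"
      using abs_Re_le_cmod abs_Im_le_cmod order_trans by blast+
  qed
  obtain P1 where P1: "real (degree P1) \<le> \<sigma>" "unit_norm P1 \<le> H"
    "\<And>i. i \<in> ?I \<Longrightarrow> poly P1 (of_real (x i)) = of_real (Re (a (pre (x i))))"
    using interp[unfolded interpolable_def, rule_format, of "\<lambda>i. Re (a (pre (x i)))"] small(1) by blast
  obtain P2 where P2: "real (degree P2) \<le> \<sigma>" "unit_norm P2 \<le> H"
    "\<And>i. i \<in> ?I \<Longrightarrow> poly P2 (of_real (x i)) = of_real (Im (a (pre (x i))))"
    using interp[unfolded interpolable_def, rule_format, of "\<lambda>i. Im (a (pre (x i)))"] small(2) by blast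
  define P where "P = P1 + smult \<i> P2"
  have norm: "unit_norm P \<le> 2 * H"
    using unit_norm_add[of P1 "smult \<i> P2"] unit_norm_smult[of \<i> P2] P1(2) P2(2) by (simp add: P_def)
  have "degree P \<le> max (degree P1) (degree P2)"
    unfolding P_def by (intro order_trans[OF degree_add_le_max] max.mono degree_smult_le order_refl)
  then have degP: "degree P \<le> N" using P1(1) P2(1) N by linarith
  have val: "poly P (of_real (Re z)) = a z" if z: "z \<in> S" for z
  proof -
    obtain i where i: "i \<in> I" "x i = Re z" using S[OF z] by (metis imageE)
    then have "i \<in> ?I" using z by auto
    from P1(3)[OF this] P2(3)[OF this] show ?thesis
      using i pre[OF z] by (simp add: P_def complex_eq[of "a z", symmetric] mult.commute)
  qed
  show "\<exists>F. degree F \<le> 2 * N \<and> (\<forall>w. cmod w = 1 \<longrightarrow> cmod (poly F w) \<le> 2 * H) \<and> (\<forall>z\<in>S. poly F z = v z)"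
  proof (intro exI conjI allI impI ballI)
    show "degree (joukowski_poly N P) \<le> 2 * N" by (rule degree_joukowski)
    fix w :: complex assume w: "cmod w = 1"
    have "\<bar>Re w\<bar> \<le> 1" using w abs_Re_le_cmod[of w] by simp
    then show "cmod (poly (joukowski_poly N P) w) \<le> 2 * H"
      unfolding norm_poly_joukowski_circle[OF degP w] by (intro order_trans[OF unit_norm_bound norm]) auto
  next
    fix z assume z: "z \<in> S"
    have z1: "cmod z = 1" and z0: "z \<noteq> 0" using S[OF z] by auto
    have "poly (joukowski_poly N P) z = z ^ N * a z"
      using poly_joukowski[OF degP z0] unit_circle_joukowski[OF z1] val[OF z] by simp
    also have "\<dots> = v z" using z0 by (simp add: a_def power_inverse)
    finally show "poly (joukowski_poly N P) z = v z" .
  qed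
qed

text \<open>Every point has two lifts, except that 1 and -1 have only one; hence the loss of
  2.\<close>

lemma card_circle_lift:
  assumes fin: "finite X" and X: "X \<subseteq> {-1..1::real}"
  shows "finite {z. cmod z = 1 \<and> Re z \<in> X}" "2 * card X \<le> card {z. cmod z = 1 \<and> Re z \<in> X} + 2"
proof -
  let ?T = "{z. cmod z = 1 \<and> Re z \<in> X}"
  define up where "up = (\<lambda>x::real. cis (arccos x))"
  define down where "down = (\<lambda>x::real. cis (- arccos x))"
  have Re: "Re (up x) = x" "Re (down x) = x" if "x \<in> X" for x
    using that X by (auto simp: up_def down_def cos_arccos subset_iff)
  have T: "?T = up ` X \<union> down ` X"
  proof (intro equalityI subsetI)
    fix z assume z: "z \<in> ?T"
    have c: "z = cis (Arg2pi z)" using Arg2pi_eq[of z] z by (simp add: cis_conv_exp)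
    show "z \<in> up ` X \<union> down ` X"
    proof (cases "cell 32 z < 16")
      case True
      then have "z = up (Re z)" using Arg2pi_arccos[of z 1] z c by (simp add: up_def)
      then show ?thesis using z by blast
    next
      case False
      then have "Arg2pi z = 2 * pi - arccos (Re z)" using Arg2pi_arccos[of z 1] z by simp
      then have "z = down (Re z)" using c by (simp add: down_def complex_eq_iff)
      then show ?thesis using z by blast
    qed
  qed (use Re in \<open>auto simp: up_def down_def\<close>)
  show finT: "finite ?T" unfolding T using fin by simp
  have cu: "card (up ` X) = card X" and cd: "card (down ` X) = card X"
    using Re by (auto intro!: card_image inj_on_inverseI[of _ Re])
  have "up ` X \<inter> down ` X \<subseteq> {1, -1}"
  proof
    fix z assume "z \<in> up ` X \<inter> down ` X"
    then obtain x y where "z = up x" "z = down y" "x \<in> X" "y \<in> X" by blast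
    then have "up x = down x" using Re by metis
    then have "sin (arccos x) = 0" by (auto simp: up_def down_def complex_eq_iff)
    then have "Im z = 0" using \<open>z = up x\<close> by (simp add: up_def)
    moreover have "cmod z = 1" using \<open>z = up x\<close> by (simp add: up_def)
    ultimately show "z \<in> {1, -1}" by (auto simp: complex_eq_iff cmod_def abs_if split: if_splits)
  qed
  then have "card (up ` X \<inter> down ` X) \<le> card {1, -1 :: complex}" by (intro card_mono) auto
  also have "\<dots> \<le> 2" by (simp add: card_insert_if)
  finally have "card (up ` X \<inter> down ` X) \<le> 2" .
  moreover have "card (up ` X) + card (down ` X) = card ?T + card (up ` X \<inter> down ` X)"
    unfolding T using fin by (intro card_Un_Int) auto
  ultimately show "2 * card X \<le> card ?T + 2" using cu cd by linarith
qed

text \<open>Each of the \<open>32 * q'\<close> windows has at most \<open>2 * m\<close> cells near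
  its ends.\<close>

lemma card_shallow_cells:
  fixes q' r m :: nat
  assumes r: "r > 0"
  shows "card {b \<in> {..<32 * (r * q')}. \<not> (m \<le> b mod r \<and> b mod r < r - m)} \<le> 64 * q' * m"
proof -
  have "{b \<in> {..<32 * (r * q')}. \<not> (m \<le> b mod r \<and> b mod r < r - m)}
      \<subseteq> (\<lambda>(a, j). r * a + j) ` ({..<32 * q'} \<times> ({..<m} \<union> {r - m..<r}))"
  proof
    fix b assume b: "b \<in> {b \<in> {..<32 * (r * q')}. \<not> (m \<le> b mod r \<and> b mod r < r - m)}"
    then have "b < 32 * q' * r" by (simp add: mult_ac)
    then have "b div r < 32 * q'" by (rule less_mult_imp_div_less)
    moreover have "b mod r \<in> {..<m} \<union> {r - m..<r}" using b r by auto
    moreover have "b = r * (b div r) + b mod r" by simp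
    ultimately show "b \<in> (\<lambda>(a, j). r * a + j) ` ({..<32 * q'} \<times> ({..<m} \<union> {r - m..<r}))"
      by (intro image_eqI[of _ _ "(b div r, b mod r)"]) auto
  qed
  then have "card {b \<in> {..<32 * (r * q')}. \<not> (m \<le> b mod r \<and> b mod r < r - m)}
      \<le> card ((\<lambda>(a, j). r * a + j) ` ({..<32 * q'} \<times> ({..<m} \<union> {r - m..<r})))"
    by (intro card_mono) auto
  also have "\<dots> \<le> card ({..<32 * q'} \<times> ({..<m} \<union> {r - m..<r}))" by (intro card_image_le) auto
  also have "\<dots> = 32 * q' * card ({..<m} \<union> {r - m..<r})" by (simp add: card_cartesian_product)
  also have "\<dots> \<le> 32 * q' * (card {..<m} + card {r - m..<r})" by (intro mult_left_mono card_Un_le) auto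
  also have "\<dots> \<le> 32 * q' * (m + m)" by (intro mult_left_mono) auto
  also have "\<dots> = 64 * q' * m" by (simp add: algebra_simps)
  finally show ?thesis .
qed

text \<open>Transfer to the circle: pairs are interpolable, so the nodes are separated and a cell
  has at most \<open>\<kappa>\<close> points; a window then has at most \<open>k\<close> points and
  is interpolable as a whole.\<close>

lemma no_dense_interpolable_nodes:
  fixes n q q' r m L k N :: nat and Hr \<sigma> A \<kappa> \<eta> :: real and x :: "nat \<Rightarrow> real" and I :: "nat set"
  assumes Hr: "Hr \<ge> 1" and A: "A \<ge> 1" and q: "q = r * q'" "q > 0" "4 * q \<le> n"
    and m: "m > 4" "m \<le> r"
    and \<sigma>: "\<sigma> > 0" "\<sigma> \<le> 2 * real n" "\<sigma> < real N + 1" "N \<le> n + q"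
    and I: "finite I" "\<And>i. i \<in> I \<Longrightarrow> x i \<in> {-1..1}" "2 * real n - real q + 2 \<le> 2 * real (card I)"
    and interp: "\<And>S. S \<subseteq> I \<Longrightarrow> card S \<le> k \<Longrightarrow> interpolable x \<sigma> Hr S"
    and \<kappa>: "\<kappa> = 2 * (2 * Hr) * real n / real q" and k: "k \<ge> 2" "real r * \<kappa> \<le> real k"
    and shallow: "\<kappa> * real (64 * q' * m) \<le> real q / 2"
    and \<eta>: "\<eta> = (32 / real m)\<^sup>2"
    and P1: "\<kappa> * (256 * (2 * Hr) * (real (2 * n + 6 * q) + 1) * (1 / A + \<eta>)) \<le> real q / 2"
    and P2: "\<kappa> * (A * (32 * \<eta> * (real (2 * n + 6 * q) + 1))) \<le> real n / 4"
    and L: "2 ^ L \<le> real (2 * n + 6 * q) * (2 * pi / real (32 * q))"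
    and big: "2048 * (13833 * (2 * Hr)\<^sup>2 + 1 / 8) < real L + 1"
  shows False
proof -
  define K where "K = 32 * q"
  have K: "K > 0" using q by (simp add: K_def)
  have r: "r > 0" "r dvd 16 * q" "r dvd 32 * q" "r \<le> q" using q by auto
  have n: "n > 0" using q(2,3) by linarith
  define T where "T = {z. cmod z = 1 \<and> Re z \<in> x ` I}"
  \<comment> \<open>Only cells deep inside their window serve as centres. For them the interpolated
    set is the whole window, so other nodes of \<open>T\<close> are at distance at least
    \<open>m / (16 * q)\<close>, which gives \<open>\<eta> = (32 / m)^2\<close>.\<close>
  define B where "B = {b \<in> {..<K}. m \<le> b mod r \<and> b mod r < r - m}"
  define S where "S = (\<lambda>b. {z \<in> T. cell K z div r = b div r})"
  have X: "finite (x ` I)" "x ` I \<subseteq> {-1..1}" using I by auto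
  have finT: "finite T" unfolding T_def by (rule card_circle_lift(1)[OF X])
  have unit: "cmod z = 1" if "z \<in> T" for z using that by (simp add: T_def)
  define s where "s = 2 / (3 * \<sigma> * Hr)"
  have s0: "s > 0" using \<sigma> Hr by (simp add: s_def)
  have sep: "s \<le> \<bar>arccos (x i) - arccos (x j)\<bar>" if ij: "i \<in> I" "j \<in> I" "i \<noteq> j" for i j
  proof -
    have "interpolable x \<sigma> Hr {i, j}" using ij k(1) by (intro interp) auto
    then show ?thesis unfolding s_def using ij I(2) \<sigma>(1) Hr by (intro interpolable_pair_separation) auto
  qed
  have inj: "inj_on x I"
    using sep s0 by (intro inj_onI) (metis abs_zero diff_self not_le)
  have sep_Arg: "s \<le> \<bar>Arg2pi z - Arg2pi w\<bar>" if zw: "z \<in> T" "w \<in> T" "z \<noteq> w" "cell K z div r = cell K w div r" for z w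
  proof -
    have eq: "\<bar>Arg2pi z - Arg2pi w\<bar> = \<bar>arccos (Re z) - arccos (Re w)\<bar>"
      using zw unit r q by (intro same_window_Arg2pi_diff) (auto simp: K_def)
    obtain i j where ij: "i \<in> I" "Re z = x i" "j \<in> I" "Re w = x j" using zw by (auto simp: T_def)
    have "i \<noteq> j"
    proof
      assume "i = j"
      then have "Arg2pi z = Arg2pi w" using eq ij by simp
      then have "z = w" using cell_bounds(1)[OF unit[OF zw(1)] K] cell_bounds(1)[OF unit[OF zw(2)] K] by metis
      then show False using zw by simp
    qed
    then show ?thesis using sep[of i j] ij eq by simp
  qed
  have \<kappa>0: "\<kappa> \<ge> 0" using Hr by (simp add: \<kappa>)
  have cellcard: "real (card {z \<in> T. cell K z = b}) \<le> \<kappa>" for b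
  proof -
    have "real (card {z \<in> T. cell K z = b}) \<le> (2 * pi / real K) / s + 1"
    proof (rule card_separated_le[where u = Arg2pi and a = "2 * pi * real b / real K"])
      show "s \<le> \<bar>Arg2pi z - Arg2pi w\<bar>"
        if "z \<in> {z \<in> T. cell K z = b}" "w \<in> {z \<in> T. cell K z = b}" "z \<noteq> w" for z w
        using that by (intro sep_Arg) auto
      show "2 * pi * real b / real K \<le> Arg2pi z \<and> Arg2pi z < 2 * pi * real b / real K + 2 * pi / real K"
        if "z \<in> {z \<in> T. cell K z = b}" for z
        using that cell_bounds[OF unit K, of z] by auto
    qed (use finT s0 in auto)
    also have "(2 * pi / real K) / s \<le> real n * Hr / real q"
    proof -
      have "(2 * pi / real K) / s = pi * 3 * (\<sigma> * Hr) / real K" by (simp add: s_def)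
      also have "\<dots> \<le> 4 * 3 * (2 * real n * Hr) / real K"
        using pi_less_4 \<sigma> Hr by (intro divide_right_mono mult_mono) auto
      also have "\<dots> \<le> real n * Hr / real q" using q n Hr by (simp add: K_def field_simps)
      finally show ?thesis .
    qed
    also have "1 \<le> real n * Hr / real q"
    proof -
      have "real q * 1 \<le> real n * Hr" using q(3) Hr by (intro mult_mono) auto
      then show ?thesis using q by (simp add: le_divide_eq)
    qed
    also have "real n * Hr / real q + real n * Hr / real q \<le> \<kappa>"
      using Hr by (simp add: \<kappa> add_divide_distrib[symmetric] divide_right_mono)
    finally show ?thesis by simp
  qed
  have cardS: "real (card (S b)) \<le> real k" for b
  proof -
    have "real (card (S b)) \<le> \<kappa> * real (card {r * (b div r)..<r * (b div r) + r})"
    proof (rule card_le_by_fibres[where f = "cell K"])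
      show "cell K ` S b \<subseteq> {r * (b div r)..<r * (b div r) + r}"
      proof (intro image_subsetI)
        fix z assume "z \<in> S b"
        then have "cell K z div r = b div r" by (simp add: S_def)
        moreover have "r * (cell K z div r) \<le> cell K z" by simp
        moreover have "cell K z < r + r * (cell K z div r)" by (rule dividend_less_times_div[OF r(1)])
        ultimately show "cell K z \<in> {r * (b div r)..<r * (b div r) + r}" by simp
      qed
      fix c
      have "card {z \<in> S b. cell K z = c} \<le> card {z \<in> T. cell K z = c}"
        using finT by (intro card_mono) (auto simp: S_def)
      then show "real (card {z \<in> S b. cell K z = c}) \<le> \<kappa>" using cellcard[of c] by linarith
    qed (use finT in \<open>auto simp: S_def\<close>)
    then show ?thesis using k(2) by (simp add: mult.commute)
  qed
  have circ: "circle_interpolable (2 * N) (2 * Hr) (S b)" for b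
  proof (rule interpolable_imp_circle_interpolable[OF _ \<sigma>(3), of x Hr I])
    let ?I = "{i \<in> I. x i \<in> Re ` S b}"
    have finS: "finite (S b)" using finT by (simp add: S_def)
    have "card ?I = card (x ` ?I)" using inj by (intro card_image[symmetric]) (auto intro: inj_on_subset)
    also have "\<dots> \<le> card (Re ` S b)" using finS by (intro card_mono) auto
    also have "\<dots> \<le> card (S b)" by (rule card_image_le[OF finS])
    also have "\<dots> \<le> k" using cardS[of b] by simp
    finally show "interpolable x \<sigma> Hr ?I" by (intro interp) auto
    show "cmod z = 1 \<and> Re z \<in> x ` I" if "z \<in> S b" for z using that by (simp add: S_def T_def)
    show "inj_on Re (S b)"
    proof (rule inj_onI, rule ccontr)
      fix z w assume zw: "z \<in> S b" "w \<in> S b" "Re z = Re w" "z \<noteq> w"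
      then have "\<bar>Arg2pi z - Arg2pi w\<bar> = \<bar>arccos (Re z) - arccos (Re w)\<bar>"
        using same_window_Arg2pi_diff[of z w q r] unit[of z] unit[of w] q(2) r by (simp add: K_def S_def)
      then show False using sep_Arg[of z w] zw s0 by (simp add: S_def)
    qed
  qed
  show False
  proof (rule no_dense_interpolable_circle_set[where H = "2 * Hr" and \<rho> = "real m / (16 * real q)" and S = S and T = T and B = B])
    show "2 * Hr \<ge> 1" using Hr by simp
    show "2 * N \<le> 2 * n + 2 * q" using \<sigma>(4) by simp
    show "B \<subseteq> {..<32 * q}" by (auto simp: B_def K_def)
    show "S b \<subseteq> T" for b by (auto simp: S_def)
    show "1 / (4 * real q) < real m / (16 * real q)" using m q by (simp add: field_simps)
    show "real m / (16 * real q) \<le> cmod (z - grid (32 * q) b)" if "b \<in> B" "z \<in> T - S b" for b z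
      using that r q m unit by (intro dist_deep_cell[where r = r]) (auto simp: B_def S_def K_def)
    show "real (card {z \<in> T. cell (32 * q) z = b}) \<le> \<kappa>" for b using cellcard[of b] by (simp add: K_def)
    show "2 * real n - real q \<le> real (card T)"
    proof -
      have "2 * card (x ` I) \<le> card T + 2" unfolding T_def by (rule card_circle_lift(2)[OF X])
      then have "2 * real (card I) \<le> real (card T) + 2" using inj by (simp add: card_image)
      then show ?thesis using I(3) by linarith
    qed
    show "real (card {z \<in> T. cell (32 * q) z \<notin> B}) \<le> real q / 2"
    proof -
      let ?J = "{b \<in> {..<32 * (r * q')}. \<not> (m \<le> b mod r \<and> b mod r < r - m)}"
      have "real (card {z \<in> T. cell K z \<notin> B}) \<le> \<kappa> * real (card ?J)"
      proof (rule card_le_by_fibres[where f = "cell K"])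
        show "cell K ` {z \<in> T. cell K z \<notin> B} \<subseteq> ?J"
          using cell_bounds(4)[OF unit K] q(1) by (auto simp: B_def K_def)
        fix c
        have "card {z \<in> {z \<in> T. cell K z \<notin> B}. cell K z = c} \<le> card {z \<in> T. cell K z = c}"
          using finT by (intro card_mono) auto
        then show "real (card {z \<in> {z \<in> T. cell K z \<notin> B}. cell K z = c}) \<le> \<kappa>" using cellcard[of c] by linarith
      qed (use finT in auto)
      also have "\<dots> \<le> \<kappa> * real (64 * q' * m)"
        using \<kappa>0 card_shallow_cells[OF r(1), of q' m] by (intro mult_left_mono) (simp_all only: of_nat_le_iff)
      finally show ?thesis using shallow by (simp add: K_def)
    qed
    have "real q * (real m / (16 * real q)) = real m / 16" using q by simp
    then show "\<eta> = (2 / (real q * (real m / (16 * real q))))\<^sup>2" by (simp only: \<eta>) simp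
    show "2 ^ L \<le> real (2 * n + 6 * q) * (2 * pi / real (32 * q))" by (rule L)
    show "circle_interpolable (2 * N) (2 * Hr) (S b)" for b by (rule circ)
  qed (use A q finT unit \<kappa> P1 P2 big in auto)
qed

lemma interpolable_mono:
  assumes "interpolable x \<sigma> H S" "H \<le> H'"
  shows "interpolable x \<sigma> H' S"
  using assms unfolding interpolable_def by (meson order_trans)

lemma local_interpolation_density:
  fixes H :: real
  obtains \<alpha> \<epsilon> :: real and k n0 :: nat where "\<alpha> > 0" "\<epsilon> > 0" "k > 0" "n0 > 0"
    "\<And>n (x :: nat \<Rightarrow> real) I. n \<ge> n0 \<Longrightarrow> finite I \<Longrightarrow> (\<And>i. i \<in> I \<Longrightarrow> x i \<in> {-1..1}) \<Longrightarrow>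
       (1 - \<epsilon>) * real n \<le> real (card I) \<Longrightarrow>
       \<exists>S\<subseteq>I. card S \<le> k \<and> \<not> interpolable x ((1 + \<alpha>) * real n) H S"
proof -
  define Hr where "Hr = max 1 H"
  have Hr: "Hr \<ge> 1" "H \<le> Hr" by (simp_all add: Hr_def)
  obtain L :: nat where L: "2048 * (13833 * (2 * Hr)\<^sup>2 + 1 / 8) < real L"
    using reals_Archimedean2 by blast
  \<comment> \<open>From \<open>n \<ge> R * q\<close> and 2 pi \<ge> 4, the quantity (2n + 6q) 2 pi
    / (32 q) is at least \<open>2 ^ L\<close>.\<close>
  define R :: nat where "R = 4 * 2 ^ L"
  have R: "R \<ge> 4" by (simp add: R_def)
  have R': "real R \<ge> 4" using R by simp
  \<comment> \<open>Chosen so that the cells that lose a node to the completion contain at most q/2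
    nodes in total, given \<open>\<kappa> \<le> 8 * Hr * R\<close>.\<close>
  define A where "A = 131072 * Hr\<^sup>2 * (real R)\<^sup>2"
  have one_le: "1 \<le> a * b" if "1 \<le> a" "1 \<le> b" for a b :: real
    using mult_mono[of 1 a 1 b] that by simp
  have A: "A \<ge> 1"
    unfolding A_def using Hr R' by (intro one_le one_le_power) auto
  \<comment> \<open>Makes \<open>4096 * Hr * R * A * \<eta> \<le> 1\<close>, so that
    \<open>\<eta>\<close> is below \<open>1 / A\<close> and the far nodes stay negligible even after
    multiplication by \<open>A\<close> and \<open>\<kappa>\<close>.\<close>
  define m where "m = nat \<lceil>4194304 * Hr * real R * A\<rceil> + 5"
  have m: "m > 4" "4194304 * Hr * real R * A \<le> real m" unfolding m_def by linarith+
  \<comment> \<open>Windows so long that the cells near their ends hold at most q/2 points.\<close>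
  define r where "r = nat \<lceil>1024 * Hr * real R * real m\<rceil> + m + 8"
  have r: "m \<le> r" "8 \<le> r" "1024 * Hr * real R * real m \<le> real r" unfolding r_def by linarith+
  define k where "k = nat \<lceil>real r * (8 * Hr * real R)\<rceil> + 2"
  have k: "k \<ge> 2" "real r * (8 * Hr * real R) \<le> real k" unfolding k_def by linarith+
  \<comment> \<open>As \<open>n \<le> 2 * R * q\<close>, the degree excess
    \<open>\<alpha> * n\<close> is at most q and the share \<open>\<epsilon> * n\<close> of absent
    nodes at most q/4.\<close>
  define \<alpha> where "\<alpha> = 1 / (2 * real R)"
  define \<epsilon> where "\<epsilon> = 1 / (8 * real R)"
  show thesis
  proof (rule that[of \<alpha> \<epsilon> k "R * r"])
    show "\<alpha> > 0" "\<epsilon> > 0" using R' by (simp_all add: \<alpha>_def \<epsilon>_def)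
    show "k > 0" "R * r > 0" using k(1) r(2) R by simp_all
    fix n and x :: "nat \<Rightarrow> real" and I
    assume n0: "n \<ge> R * r" and I: "finite I" "\<And>i. i \<in> I \<Longrightarrow> x i \<in> {-1..1}"
      and dense: "(1 - \<epsilon>) * real n \<le> real (card I)"
    show "\<exists>S\<subseteq>I. card S \<le> k \<and> \<not> interpolable x ((1 + \<alpha>) * real n) H S"
    proof (rule ccontr)
      assume contr: "\<not> ?thesis"
      \<comment> \<open>Rounding down makes \<open>q\<close> a multiple of \<open>r\<close>, so that
        windows tile each half of the circle; \<open>n \<ge> R * r\<close> gives
        \<open>q' \<ge> 1\<close>, hence \<open>n / q\<close> between \<open>R\<close> and
        \<open>2 * R\<close>.\<close>
      define q' where "q' = n div (R * r)"
      define q where "q = r * q'"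
      have Rr: "R * r > 0" using r(2) R by simp
      have q': "q' \<ge> 1" using n0 Rr by (simp add: q'_def Suc_le_eq div_greater_zero_iff)
      have "R * q \<le> n" unfolding q_def q'_def mult.assoc[symmetric] by simp
      moreover have "n \<le> 2 * (R * q)"
      proof -
        have "n < R * r + R * r * q'" unfolding q'_def using Rr by (rule dividend_less_times_div)
        moreover have "R * r * 1 \<le> R * r * q'" using q' by (rule mult_left_mono) simp
        ultimately have "n \<le> 2 * (R * r * q')" by linarith
        then show ?thesis by (simp only: q_def mult.assoc)
      qed
      ultimately have "real (R * q) \<le> real n" "real n \<le> real (2 * (R * q))" by (simp_all only: of_nat_le_iff)
      then have nq: "real R * real q \<le> real n" "real n \<le> 2 * real R * real q" by simp_all
      have "r * 1 \<le> q" unfolding q_def using q' by (rule mult_left_mono) simp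
      then have q8: "real q \<ge> 8" using r(2) by linarith
      have q0: "q > 0" using q8 by linarith
      have "4 * real q \<le> real R * real q" using R' by (intro mult_right_mono) auto
      then have "4 * real q \<le> real n" using nq by linarith
      then have q4: "4 * q \<le> n" by linarith
      have nq_ratio: "real n / real q \<le> 2 * real R" using nq q8 by (simp add: divide_le_eq)
      define \<kappa> where "\<kappa> = 2 * (2 * Hr) * real n / real q"
      have \<kappa>: "\<kappa> \<le> 8 * Hr * real R"
      proof -
        have "4 * Hr * (real n / real q) \<le> 4 * Hr * (2 * real R)" using Hr nq_ratio by (intro mult_left_mono) auto
        then show ?thesis by (simp add: \<kappa>_def)
      qed
      have \<kappa>0: "0 \<le> \<kappa>" using Hr by (simp add: \<kappa>_def)
      define \<eta> where "\<eta> = (32 / real m)\<^sup>2"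
      have m0: "real m > 0" using m by simp
      have HRA: "Hr * real R * A > 0" using Hr R' A by (intro mult_pos_pos) auto
      have \<eta>: "4096 * (Hr * real R * A) * \<eta> \<le> 1"
      proof -
        have "real m \<le> (real m)\<^sup>2" using m by (simp add: power2_eq_square)
        then have "4194304 * (Hr * real R * A) \<le> (real m)\<^sup>2" using m(2) unfolding mult.assoc by linarith
        moreover have "4096 * (Hr * real R * A) * \<eta> = 4194304 * (Hr * real R * A) / (real m)\<^sup>2"
          by (simp add: \<eta>_def power_divide)
        ultimately show ?thesis using m0 by (simp add: divide_le_eq)
      qed
      have \<eta>0: "\<eta> \<ge> 0" by (simp add: \<eta>_def)
      have M: "real (2 * n + 6 * q) + 1 \<le> 4 * real n"
      proof -
        have "6 * real q \<le> 3 / 2 * real n" using nq R' \<open>4 * real q \<le> real n\<close> by linarith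
        moreover have "real n \<ge> 2" using \<open>4 * real q \<le> real n\<close> q8 by linarith
        ultimately show ?thesis by (simp add: algebra_simps)
      qed
      define \<sigma> where "\<sigma> = (1 + \<alpha>) * real n"
      define N where "N = nat \<lfloor>\<sigma>\<rfloor>"
      have \<alpha>n: "0 \<le> \<alpha> * real n" "\<alpha> * real n \<le> real q"
        using nq R' by (simp_all add: \<alpha>_def divide_le_eq mult_ac)
      have \<sigma>: "\<sigma> = real n + \<alpha> * real n" by (simp add: \<sigma>_def algebra_simps)
      have n2: "real n \<ge> 2" using \<open>4 * real q \<le> real n\<close> q8 by linarith
      show False
      proof (rule no_dense_interpolable_nodes[OF Hr(1) A q_def q0 q4 m(1) r(1), of \<sigma> N I x k \<kappa> \<eta> L])
        show "\<sigma> > 0" "\<sigma> \<le> 2 * real n" using \<sigma> \<alpha>n n2 \<open>4 * real q \<le> real n\<close> q8 by linarith+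
        show "\<sigma> < real N + 1" unfolding N_def using \<sigma> \<alpha>n n2 by linarith
        show "N \<le> n + q" unfolding N_def using \<sigma> \<alpha>n by linarith
        show "2 * real n - real q + 2 \<le> 2 * real (card I)"
        proof -
          have "\<epsilon> * real n \<le> real q / 4" using nq R' by (simp add: \<epsilon>_def divide_le_eq mult_ac)
          moreover have "(1 - \<epsilon>) * real n = real n - \<epsilon> * real n" by (simp add: algebra_simps)
          ultimately have "real n - real q / 4 \<le> real (card I)" using dense by linarith
          then show ?thesis using q8 by (simp add: field_simps)
        qed
        show "interpolable x \<sigma> Hr S" if "S \<subseteq> I" "card S \<le> k" for S
          using contr that interpolable_mono[OF _ Hr(2)] by (auto simp: \<sigma>_def)
        show "\<kappa> = 2 * (2 * Hr) * real n / real q" by (simp add: \<kappa>_def)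
        have "real r * \<kappa> \<le> real r * (8 * Hr * real R)" using \<kappa> by (rule mult_left_mono) simp
        then show "real r * \<kappa> \<le> real k" using k(2) by linarith
        show "\<kappa> * real (64 * q' * m) \<le> real q / 2"
        proof -
          have "\<kappa> * real (64 * q' * m) \<le> 8 * Hr * real R * real (64 * q' * m)"
            using \<kappa> by (rule mult_right_mono) simp
          also have "\<dots> = 1024 * Hr * real R * real m * (real q' / 2)" by simp
          also have "\<dots> \<le> real r * (real q' / 2)" using r(3) by (rule mult_right_mono) simp
          finally show ?thesis by (simp add: q_def)
        qed
        show "\<eta> = (32 / real m)\<^sup>2" by (simp add: \<eta>_def)
        show "\<kappa> * (256 * (2 * Hr) * (real (2 * n + 6 * q) + 1) * (1 / A + \<eta>)) \<le> real q / 2"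
        proof -
          have "\<eta> \<le> 1 / A"
          proof -
            have "A \<le> 4096 * (Hr * real R * A)"
            proof -
              have "1 * A \<le> (Hr * real R) * A" using one_le[of Hr "real R"] Hr R' A by (intro mult_right_mono) auto
              then show ?thesis using HRA by linarith
            qed
            then have "A * \<eta> \<le> 4096 * (Hr * real R * A) * \<eta>" using \<eta>0 by (rule mult_right_mono)
            then have "A * \<eta> \<le> 1" using \<eta> by linarith
            then show ?thesis using A by (simp add: le_divide_eq mult.commute)
          qed
          then have "1 / A + \<eta> \<le> 2 / A" by simp
          moreover have "real (2 * n + 6 * q) + 1 \<le> 8 * real R * real q" using M nq by linarith
          ultimately have "256 * (2 * Hr) * (real (2 * n + 6 * q) + 1) * (1 / A + \<eta>)
              \<le> 256 * (2 * Hr) * (8 * real R * real q) * (2 / A)"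
            using Hr A \<eta>0 by (intro mult_mono mult_nonneg_nonneg add_nonneg_nonneg) auto
          then have "\<kappa> * (256 * (2 * Hr) * (real (2 * n + 6 * q) + 1) * (1 / A + \<eta>))
              \<le> (8 * Hr * real R) * (256 * (2 * Hr) * (8 * real R * real q) * (2 / A))"
            by (rule mult_mono[OF \<kappa>]) (use Hr A \<eta>0 in simp_all)
          also have "\<dots> = (131072 * Hr\<^sup>2 * (real R)\<^sup>2) / A * (real q / 2)" by (simp add: power2_eq_square)
          also have "\<dots> = real q / 2" using A unfolding A_def[symmetric] by simp
          finally show ?thesis .
        qed
        show "\<kappa> * (A * (32 * \<eta> * (real (2 * n + 6 * q) + 1))) \<le> real n / 4"
        proof -
          have "32 * \<eta> * (real (2 * n + 6 * q) + 1) \<le> 32 * \<eta> * (4 * real n)"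
            by (rule mult_left_mono[OF M]) (use \<eta>0 in simp)
          then have "A * (32 * \<eta> * (real (2 * n + 6 * q) + 1)) \<le> A * (32 * \<eta> * (4 * real n))"
            by (rule mult_left_mono) (use A in simp)
          then have "\<kappa> * (A * (32 * \<eta> * (real (2 * n + 6 * q) + 1))) \<le> (8 * Hr * real R) * (A * (32 * \<eta> * (4 * real n)))"
            by (rule mult_mono[OF \<kappa>]) (use Hr A \<eta>0 in simp_all)
          also have "\<dots> = (4096 * (Hr * real R * A) * \<eta>) * (real n / 4)" by simp
          also have "\<dots> \<le> 1 * (real n / 4)" using \<eta> by (rule mult_right_mono) simp
          finally show ?thesis by simp
        qed
        show "2 ^ L \<le> real (2 * n + 6 * q) * (2 * pi / real (32 * q))"
        proof -
          have "8 * 2 ^ L * real q \<le> real (2 * n + 6 * q)" using nq by (simp add: R_def)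
          then have "8 * 2 ^ L * real q * (4 / real (32 * q)) \<le> real (2 * n + 6 * q) * (2 * pi / real (32 * q))"
            using pi_ge_two by (intro mult_mono divide_right_mono) auto
          then show ?thesis using q8 by simp
        qed
        show "2048 * (13833 * (2 * Hr)\<^sup>2 + 1 / 8) < real L + 1" using L by linarith
      qed (use I k in auto)
    qed
  qed
qed

section \<open>Conclusion\<close>

theorem corollary7p4:
  fixes C \<rho> :: real
  assumes "C > 0" and "0 \<le> \<rho>" and "\<rho> < 1"
  shows "(\<exists>\<alpha> \<beta> \<gamma> h n\<^sub>1. admissible_constants C \<rho> \<alpha> \<beta> \<gamma> h n\<^sub>1) \<and>
    (\<forall>A\<^sub>0>0. \<forall>k. \<forall>\<rho>' \<alpha> \<beta> \<gamma> h :: real. \<forall>n\<^sub>1 :: nat.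
       \<rho>' = (1 + \<rho>) / 2 \<longrightarrow>
       obstruction_supplies A\<^sub>0 (C / (1 - \<rho>')) k \<longrightarrow>
       \<alpha> = 1 / (real k - 1) \<longrightarrow>
       \<beta> = 2 powr (1 - real k) / (8 * real k * (real k + 1)) \<longrightarrow>
       \<gamma> = 2 powr (1 - real k) / (16 * real k * (real k + 1)) \<longrightarrow>
       n\<^sub>1 = 2 * (k\<^sup>2 - 1) \<longrightarrow>
       h = (1 - \<rho>) / (2 * exp 1 * C * (1 + \<alpha>)) \<longrightarrow>
       admissible_constants C \<rho> \<alpha> \<beta> \<gamma> h n\<^sub>1)"
proof (rule conjI)
  define r where "r = (1 + \<rho>) / 2"
  have r: "r < 1" using assms by (simp add: r_def)
  obtain \<alpha> \<epsilon> :: real and k n0 :: nat where pos: "\<alpha> > 0" "\<epsilon> > 0" "k > 0" "n0 > 0"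
    and density: "\<And>n (x :: nat \<Rightarrow> real) I. n \<ge> n0 \<Longrightarrow> finite I \<Longrightarrow> (\<And>i. i \<in> I \<Longrightarrow> x i \<in> {-1..1}) \<Longrightarrow>
       (1 - \<epsilon>) * real n \<le> real (card I) \<Longrightarrow>
       \<exists>S\<subseteq>I. card S \<le> k \<and> \<not> interpolable x ((1 + \<alpha>) * real n) (C / (1 - r)) S"
    using local_interpolation_density[of "C / (1 - r)"] by metis
  \<comment> \<open>The blocks of the maximal family cover more than \<open>\<epsilon> * n\<close>
    indices and have at most \<open>k\<close> elements each.\<close>
  define b where "b = \<epsilon> / real k"
  define \<beta> where "\<beta> = 2 powr (1 - real k) * b / 4"
  define h where "h = (1 - \<rho>) / (2 * exp 1 * C * (1 + \<alpha>))"
  have "1 - exp (- \<beta> * real n) \<le> measure_pmf.prob (random_signs n) (robust_failure_event C \<rho> \<alpha> \<beta> h n x)"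
    if n: "n \<ge> n0" and x: "\<forall>i\<in>{1..n}. x i \<in> {-1..1}" for n and x :: "nat \<Rightarrow> real"
  proof -
    \<comment> \<open>Blocks are selected by failing sign approximation, which is what the
      probability bound uses; a set that is not interpolable with norm \<open>C / (1 - r)\<close>
      has this property.\<close>
    let ?Q = "\<lambda>S. S \<noteq> {} \<and> card S \<le> k \<and> \<not> sign_approximable x ((1 + \<alpha>) * real n) C r S"
    obtain \<F> where \<F>: "finite \<F>" "\<And>S. S \<in> \<F> \<Longrightarrow> S \<subseteq> {1..n} \<and> ?Q S" "disjoint \<F>"
      "\<And>S. S \<subseteq> {1..n} - \<Union>\<F> \<Longrightarrow> \<not> ?Q S"
      by (rule maximal_disjoint_family[of "{1..n}" ?Q]) (simp, blast, rule that, assumption+)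
    let ?I = "{1..n} - \<Union>\<F>"
    have "\<not> (1 - \<epsilon>) * real n \<le> real (card ?I)"
    proof
      assume "(1 - \<epsilon>) * real n \<le> real (card ?I)"
      then obtain S where S: "S \<subseteq> ?I" "card S \<le> k"
        "\<not> interpolable x ((1 + \<alpha>) * real n) (C / (1 - r)) S"
        using density[OF n, of ?I x] x by auto
      have "finite S" using S(1) by (rule finite_subset) simp
      then have not_approx: "\<not> sign_approximable x ((1 + \<alpha>) * real n) C r S"
        using sign_approximable_imp_interpolable[OF _ r] S(3) by blast
      \<comment> \<open>The zero polynomial serves the empty set, so a set that is not sign
        approximable has an element.\<close>
      moreover have "S \<noteq> {}"
      proof
        assume "S = {}"
        moreover have "unit_norm 0 \<le> C" using assms(1) by (intro unit_norm_leI) simp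
        ultimately have "sign_approximable x ((1 + \<alpha>) * real n) C r S"
          unfolding sign_approximable_def using pos(1) by (auto intro!: exI[of _ 0])
        then show False using not_approx by simp
      qed
      ultimately show False using \<F>(4)[OF S(1)] S(2) by blast
    qed
    moreover have "real n \<le> real (card ?I) + real k * real (card \<F>)"
    proof -
      have sub: "\<Union>\<F> \<subseteq> {1..n}" using \<F>(2) by blast
      have "n = card {1..n}" by simp
      also have "\<dots> = card ?I + card (\<Union>\<F>)"
        using card_Diff_subset[OF finite_subset[OF sub finite_atLeastAtMost] sub] card_mono[OF _ sub] by simp
      also have "card (\<Union>\<F>) \<le> (\<Sum>S\<in>\<F>. card S)" by (rule card_Union_le_sum_card)
      also have "\<dots> \<le> (\<Sum>S\<in>\<F>. k)" using \<F>(2) by (intro sum_mono) blast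
      finally have "n \<le> card ?I + k * card \<F>" by (simp add: mult.commute)
      then have "real n \<le> real (card ?I + k * card \<F>)" by (simp only: of_nat_le_iff)
      then show ?thesis by simp
    qed
    ultimately have "\<epsilon> * real n \<le> real k * real (card \<F>)" by (simp add: algebra_simps)
    then have many: "b * real n \<le> real (card \<F>)" using pos(3) by (simp add: b_def divide_le_eq mult.commute)
    show ?thesis
    proof (rule robust_failure_probability[OF assms(1,3) pos(1) _ pos(3) _ h_def \<F>(3) _ many])
      show "n > 0" using n pos(4) by simp
      show "x i \<in> {-1..1}" if "i \<in> {1..n}" for i using x that by blast
      show "S \<subseteq> {1..n} \<and> S \<noteq> {} \<and> card S \<le> k
          \<and> \<not> sign_approximable x ((1 + \<alpha>) * real n) C ((1 + \<rho>) / 2) S" if "S \<in> \<F>" for S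
        using \<F>(2)[OF that] by (simp add: r_def)
    qed (simp_all add: \<beta>_def)
  qed
  moreover have "\<beta> > 0" "h > 0" using pos assms by (simp_all add: \<beta>_def b_def h_def)
  ultimately have "admissible_constants C \<rho> \<alpha> \<beta> \<beta> h n0"
    unfolding admissible_constants_def using pos(1) by simp
  then show "\<exists>\<alpha> \<beta> \<gamma> h n\<^sub>1. admissible_constants C \<rho> \<alpha> \<beta> \<gamma> h n\<^sub>1" by blast
qed (use assms in \<open>blast intro: admissible_of_obstruction\<close>)

end
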